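(* Let $\mathcal{A}$ be a von Neumann algebra with a faithful normal semifinite weight $\phi$, let $p_1,p_2\in(0,1]$, and let $(\sigma_{m,n})_{m,n\in\mathbb{N}_0}$ be a family of positive linear maps on $\mathcal{A}$ such that $\sigma_{0,0}=\mathrm{Id}_{\mathcal{A}}$; $\sigma_{1,0}$ and $\sigma_{0,1}$ are commuting, normal, completely positive, unital and $\phi$-invariant; and, for all $m,n\in\mathbb{N}_0$, $$\sigma_{1,0}\sigma_{m,n}=p_1\sigma_{m+1,n}+(1-p_1)\sigma_{m-1,n}\ (m\geq1),\qquad \sigma_{0,1}\sigma_{m,n}=p_2\sigma_{m,n+1}+(1-p_2)\sigma_{m,n-1}\ (n\geq1),$$ and $\sigma_{m,n}=\sigma_{0,n}\circ\sigma_{m,0}$. Put $S_{k_1,k_2}=\frac{1}{k_1k_2}\sum_{m=0}^{k_1-1}\sum_{n=0}^{k_2-1}\sigma_{m,n}$ for $k_1,k_2\in\mathbb{N}$. Let $\tilde\sigma_{1,0},\tilde\sigma_{0,1}\in B(\mathcal{H}_\phi)$ be the contractions induced by $\sigma_{1,0},\sigma_{0,1}$, and assume that the spectrum of $\tilde\sigma_{1,0}$ is contained in $D_{p_1}$ and the spectrum of $\tilde\sigma_{0,1}$ is contained in $D_{p_2}$. Let $A\in\mathcal{A}_0$. Then the multisequence $(S_{m,n}(A))_{m,n=1}^\infty$ converges strongly in Pringsheim's sense to some $\hat A\in\mathcal{A}_0$. Moreover, if $P\in B(\mathcal{H}_\phi)$ is the orthogonal projection onto $\{\eta\in\mathcal{H}_\phi:\tilde\sigma_{0,1}\eta=\tilde\sigma_{1,0}\eta=\eta\}$,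 then $\Lambda_\phi(\hat A)=P\Lambda_\phi(A)$.
   Context: $\mathbb{N}_0=\mathbb{N}\cup\{0\}$. $\mathcal{N}_\phi=\{A\in\mathcal{A}:\phi(A^*A)<\infty\}$, $\mathcal{A}_0=\mathcal{N}_\phi^*\cap\mathcal{N}_\phi$; $\mathcal{H}_\phi$ is the Hilbert space completion of $\mathcal{A}_0$ for the scalar product $\langle A,B\rangle_\phi=\phi(B^*A)$, and $\Lambda_\phi:\mathcal{A}_0\to\mathcal{H}_\phi$ is the canonical injection. A map $\sigma$ is $\phi$-invariant if $\phi(\sigma(x))=\phi(x)$ for all $x\in\mathcal{A}^+$. For $\sigma\in\{\sigma_{0,1},\sigma_{1,0}\}$, $\tilde\sigma$ is the continuous extension to $\mathcal{H}_\phi$ of the contractive map $\Lambda_\phi(B)\mapsto\Lambda_\phi(\sigma(B))$, $B\in\mathcal{A}_0$. Strong convergence means convergence in the strong operator topology of the von Neumann algebra $\mathcal{A}$. For $p\in(0,1]$, $$D_p=\Big\{z\in\mathbb{C}:\ \big|\sqrt{z+\sqrt{4p-4p^2}}\pm\sqrt{z-\sqrt{4p-4p^2}}\big|\leq2\sqrt p\ \text{ for both choices of sign}\Big\}$$ (the choice of branches of the complex square roots is irrelevant). A double sequence $(x_{k_1,k_2})$ converges to $x$ in Pringsheim's sense, in a given topology, if for every neighbourhood $U$ of $x$ there is $n\in\mathbb{N}$ with $x_{k_1,k_2}\in U$ whenever $\min\{k_1,k_2\}\geq n$. *)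

theory Defs
  imports "HOL-Analysis.Analysis"
begin

section \<open>Complex Hilbert spaces and bounded operators\<close>

text \<open>The scalar product is linear in its first argument.  Norm, topology and completeness are
  those of the underlying real Hilbert space, whose real inner product is the real part of the
  complex one; positive definiteness is inherited from \<^class>\<open>real_inner\<close>.\<close>

class chilbert = real_inner + complete_space +
  fixes scaleC :: "complex \<Rightarrow> 'a \<Rightarrow> 'a" (infixr \<open>*\<^sub>C\<close> 75)
    and cinner :: "'a \<Rightarrow> 'a \<Rightarrow> complex"
  assumes scaleC_add_right: "c *\<^sub>C (x + y) = c *\<^sub>C x + c *\<^sub>C y"
    and scaleC_add_left: "(c + d) *\<^sub>C x = c *\<^sub>C x + d *\<^sub>C x"
    and scaleC_scaleC: "c *\<^sub>C (d *\<^sub>C x) = (c * d) *\<^sub>C x"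
    and scaleC_of_real: "complex_of_real r *\<^sub>C x = r *\<^sub>R x"
    and cinner_commute: "cinner x y = cnj (cinner y x)"
    and cinner_add_left: "cinner (x + y) z = cinner x z + cinner y z"
    and cinner_scaleC_left: "cinner (c *\<^sub>C x) y = c * cinner x y"
    and inner_eq_Re_cinner: "inner x y = Re (cinner x y)"

lemma cinner_scaleC_right: "cinner x (c *\<^sub>C y) = cnj c * cinner x y"
  by (metis cinner_commute cinner_scaleC_left complex_cnj_mult)

lemma cinner_self: "cinner x x = complex_of_real ((norm x)\<^sup>2)"
proof (rule complex_eqI)
  show "Re (cinner x x) = Re (complex_of_real ((norm x)\<^sup>2))"
    by (simp add: inner_eq_Re_cinner[symmetric] power2_norm_eq_inner)
  have "Im (cinner x x) = - Im (cinner x x)"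
    using arg_cong[OF cinner_commute[of x x], of Im] by simp
  then show "Im (cinner x x) = Im (complex_of_real ((norm x)\<^sup>2))"
    by simp
qed

lemma norm_scaleC: "norm (c *\<^sub>C x) = cmod c * norm x"
proof -
  have "complex_of_real ((norm (c *\<^sub>C x))\<^sup>2) = cinner (c *\<^sub>C x) (c *\<^sub>C x)"
    by (simp add: cinner_self)
  also have "\<dots> = (c * cnj c) * cinner x x"
    by (simp add: cinner_scaleC_left cinner_scaleC_right)
  also have "\<dots> = complex_of_real ((cmod c * norm x)\<^sup>2)"
    by (simp add: cinner_self complex_norm_square[symmetric] power_mult_distrib)
  finally have "(norm (c *\<^sub>C x))\<^sup>2 = (cmod c * norm x)\<^sup>2"
    by (simp only: of_real_eq_iff)
  then show ?thesis
    by simp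
qed

lemma scaleC_scaleR_right: "c *\<^sub>C (r *\<^sub>R x) = r *\<^sub>R (c *\<^sub>C x)"
  by (simp only: scaleC_of_real[symmetric] scaleC_scaleC mult.commute)

lemma bounded_linear_scaleC: "bounded_linear ((*\<^sub>C) c)"
  by (rule bounded_linear_intro[of _ "cmod c"])
    (simp_all add: scaleC_add_right scaleC_scaleR_right norm_scaleC mult.commute)

text \<open>The algebra \<open>B(H)\<close>: the type of blinfuns consists of the bounded real-linear maps.\<close>

definition cbounded_ops :: "('h::chilbert \<Rightarrow>\<^sub>L 'h) set" where
  "cbounded_ops = {T. \<forall>c x. blinfun_apply T (c *\<^sub>C x) = c *\<^sub>C blinfun_apply T x}"

lift_definition op_scaleC :: "complex \<Rightarrow> ('h::chilbert \<Rightarrow>\<^sub>L 'h) \<Rightarrow> ('h \<Rightarrow>\<^sub>L 'h)"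
  is "\<lambda>c T x. c *\<^sub>C T x"
  by (rule bounded_linear_compose[OF bounded_linear_scaleC])

definition op_adj :: "('h::chilbert \<Rightarrow>\<^sub>L 'h) \<Rightarrow> ('h \<Rightarrow>\<^sub>L 'h)" where
  "op_adj T = (THE S. \<forall>x y. cinner (blinfun_apply T x) y = cinner x (blinfun_apply S y))"

definition op_spectrum :: "('h::chilbert \<Rightarrow>\<^sub>L 'h) \<Rightarrow> complex set" where
  "op_spectrum T = {z. \<not> (\<exists>S\<in>cbounded_ops.
     S o\<^sub>L (T - op_scaleC z id_blinfun) = id_blinfun \<and>
     (T - op_scaleC z id_blinfun) o\<^sub>L S = id_blinfun)}"

definition is_orthogonal_projection :: "('h::chilbert \<Rightarrow>\<^sub>L 'h) \<Rightarrow> 'h set \<Rightarrow> bool" where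
  "is_orthogonal_projection P M \<longleftrightarrow>
     P \<in> cbounded_ops \<and> P o\<^sub>L P = P \<and> op_adj P = P \<and> range (blinfun_apply P) = M"

section \<open>Von Neumann algebras and maps on them\<close>

definition von_neumann_algebra :: "('h::chilbert \<Rightarrow>\<^sub>L 'h) set \<Rightarrow> bool" where
  "von_neumann_algebra \<A> \<longleftrightarrow>
     \<A> \<subseteq> cbounded_ops \<and> id_blinfun \<in> \<A> \<and>
     (\<forall>a\<in>\<A>. \<forall>b\<in>\<A>. a + b \<in> \<A>) \<and>
     (\<forall>c. \<forall>a\<in>\<A>. op_scaleC c a \<in> \<A>) \<and>
     (\<forall>a\<in>\<A>. \<forall>b\<in>\<A>. a o\<^sub>L b \<in> \<A>) \<and>
     (\<forall>a\<in>\<A>. op_adj a \<in> \<A>) \<and>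
     closedin strong_operator_topology \<A>"

definition pos_part :: "('h::chilbert \<Rightarrow>\<^sub>L 'h) set \<Rightarrow> ('h \<Rightarrow>\<^sub>L 'h) set" where
  "pos_part \<A> = {a\<in>\<A>. \<forall>x. cinner (blinfun_apply a x) x \<in> \<real>\<^sub>\<ge>\<^sub>0}"

definition op_le :: "('h::chilbert \<Rightarrow>\<^sub>L 'h) \<Rightarrow> ('h \<Rightarrow>\<^sub>L 'h) \<Rightarrow> bool" where
  "op_le a b \<longleftrightarrow> b - a \<in> pos_part cbounded_ops"

definition is_supremum_in ::
  "('h::chilbert \<Rightarrow>\<^sub>L 'h) set \<Rightarrow> ('h \<Rightarrow>\<^sub>L 'h) set \<Rightarrow> ('h \<Rightarrow>\<^sub>L 'h) \<Rightarrow> bool" where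
  "is_supremum_in \<A> D s \<longleftrightarrow> s \<in> pos_part \<A> \<and> (\<forall>d\<in>D. op_le d s) \<and>
     (\<forall>u\<in>pos_part \<A>. (\<forall>d\<in>D. op_le d u) \<longrightarrow> op_le s u)"

definition op_directed :: "('h::chilbert \<Rightarrow>\<^sub>L 'h) set \<Rightarrow> bool" where
  "op_directed D \<longleftrightarrow> D \<noteq> {} \<and> (\<forall>a\<in>D. \<forall>b\<in>D. \<exists>c\<in>D. op_le a c \<and> op_le b c)"

definition positive_linear_map ::
  "('h::chilbert \<Rightarrow>\<^sub>L 'h) set \<Rightarrow> (('h \<Rightarrow>\<^sub>L 'h) \<Rightarrow> ('h \<Rightarrow>\<^sub>L 'h)) \<Rightarrow> bool" where
  "positive_linear_map \<A> \<sigma> \<longleftrightarrow>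
     (\<forall>a\<in>\<A>. \<sigma> a \<in> \<A>) \<and>
     (\<forall>a\<in>\<A>. \<forall>b\<in>\<A>. \<sigma> (a + b) = \<sigma> a + \<sigma> b) \<and>
     (\<forall>c. \<forall>a\<in>\<A>. \<sigma> (op_scaleC c a) = op_scaleC c (\<sigma> a)) \<and>
     (\<forall>a\<in>pos_part \<A>. \<sigma> a \<in> pos_part \<A>)"

definition normal_map ::
  "('h::chilbert \<Rightarrow>\<^sub>L 'h) set \<Rightarrow> (('h \<Rightarrow>\<^sub>L 'h) \<Rightarrow> ('h \<Rightarrow>\<^sub>L 'h)) \<Rightarrow> bool" where
  "normal_map \<A> \<sigma> \<longleftrightarrow> (\<forall>D s. D \<subseteq> pos_part \<A> \<longrightarrow> op_directed D \<longrightarrow>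
     is_supremum_in \<A> D s \<longrightarrow> is_supremum_in \<A> (\<sigma> ` D) (\<sigma> s))"

text \<open>Positivity of the \<open>n \<times> n\<close> operator matrix \<open>(a i j)\<close> as an operator on the direct sum
  of \<open>n\<close> copies of the Hilbert space.\<close>

definition matrix_pos :: "nat \<Rightarrow> (nat \<Rightarrow> nat \<Rightarrow> ('h::chilbert \<Rightarrow>\<^sub>L 'h)) \<Rightarrow> bool" where
  "matrix_pos n a \<longleftrightarrow>
     (\<forall>x::nat \<Rightarrow> 'h. (\<Sum>i<n. \<Sum>j<n. cinner (blinfun_apply (a i j) (x j)) (x i)) \<in> \<real>\<^sub>\<ge>\<^sub>0)"

definition completely_positive ::
  "('h::chilbert \<Rightarrow>\<^sub>L 'h) set \<Rightarrow> (('h \<Rightarrow>\<^sub>L 'h) \<Rightarrow> ('h \<Rightarrow>\<^sub>L 'h)) \<Rightarrow> bool" where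
  "completely_positive \<A> \<sigma> \<longleftrightarrow>
     (\<forall>n a. (\<forall>i<n. \<forall>j<n. a i j \<in> \<A>) \<longrightarrow> matrix_pos n a \<longrightarrow> matrix_pos n (\<lambda>i j. \<sigma> (a i j)))"

section \<open>Weights\<close>

text \<open>A weight is only meaningful on the positive part of the algebra; \<^typ>\<open>ennreal\<close> has
  \<open>0 * \<infinity> = 0\<close>, as required.\<close>

definition weight_on :: "('h::chilbert \<Rightarrow>\<^sub>L 'h) set \<Rightarrow> (('h \<Rightarrow>\<^sub>L 'h) \<Rightarrow> ennreal) \<Rightarrow> bool" where
  "weight_on \<A> \<phi> \<longleftrightarrow>
     (\<forall>a\<in>pos_part \<A>. \<forall>b\<in>pos_part \<A>. \<phi> (a + b) = \<phi> a + \<phi> b) \<and>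
     (\<forall>r\<ge>0. \<forall>a\<in>pos_part \<A>. \<phi> (r *\<^sub>R a) = ennreal r * \<phi> a)"

definition faithful_weight :: "('h::chilbert \<Rightarrow>\<^sub>L 'h) set \<Rightarrow> (('h \<Rightarrow>\<^sub>L 'h) \<Rightarrow> ennreal) \<Rightarrow> bool" where
  "faithful_weight \<A> \<phi> \<longleftrightarrow> (\<forall>a\<in>pos_part \<A>. \<phi> a = 0 \<longrightarrow> a = 0)"

definition normal_weight :: "('h::chilbert \<Rightarrow>\<^sub>L 'h) set \<Rightarrow> (('h \<Rightarrow>\<^sub>L 'h) \<Rightarrow> ennreal) \<Rightarrow> bool" where
  "normal_weight \<A> \<phi> \<longleftrightarrow> (\<forall>D s. D \<subseteq> pos_part \<A> \<longrightarrow> op_directed D \<longrightarrow>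
     is_supremum_in \<A> D s \<longrightarrow> \<phi> s = (SUP d\<in>D. \<phi> d))"

definition finite_pos ::
  "('h::chilbert \<Rightarrow>\<^sub>L 'h) set \<Rightarrow> (('h \<Rightarrow>\<^sub>L 'h) \<Rightarrow> ennreal) \<Rightarrow> ('h \<Rightarrow>\<^sub>L 'h) set" where
  "finite_pos \<A> \<phi> = {a\<in>pos_part \<A>. \<phi> a < \<infinity>}"

text \<open>The complex linear span of the convex cone \<open>finite_pos \<A> \<phi>\<close>, and the linear extension of
  the weight to it; by additivity the value does not depend on the chosen decomposition.\<close>

definition definition_domain ::
  "('h::chilbert \<Rightarrow>\<^sub>L 'h) set \<Rightarrow> (('h \<Rightarrow>\<^sub>L 'h) \<Rightarrow> ennreal) \<Rightarrow> ('h \<Rightarrow>\<^sub>L 'h) set" where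
  "definition_domain \<A> \<phi> = {(a - b) + op_scaleC \<i> (c - d) | a b c d.
     a \<in> finite_pos \<A> \<phi> \<and> b \<in> finite_pos \<A> \<phi> \<and> c \<in> finite_pos \<A> \<phi> \<and> d \<in> finite_pos \<A> \<phi>}"

definition weight_ext ::
  "('h::chilbert \<Rightarrow>\<^sub>L 'h) set \<Rightarrow> (('h \<Rightarrow>\<^sub>L 'h) \<Rightarrow> ennreal) \<Rightarrow> ('h \<Rightarrow>\<^sub>L 'h) \<Rightarrow> complex" where
  "weight_ext \<A> \<phi> x = (THE v. \<exists>a\<in>finite_pos \<A> \<phi>. \<exists>b\<in>finite_pos \<A> \<phi>.
     \<exists>c\<in>finite_pos \<A> \<phi>. \<exists>d\<in>finite_pos \<A> \<phi>.
       x = (a - b) + op_scaleC \<i> (c - d) \<and>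
       v = Complex (enn2real (\<phi> a) - enn2real (\<phi> b)) (enn2real (\<phi> c) - enn2real (\<phi> d)))"

text \<open>Density in the strong operator topology is equivalent to density in the weak or the
  \<open>\<sigma>\<close>-weak topology, because the domain is a \<open>*\<close>-subalgebra.\<close>

definition semifinite_weight :: "('h::chilbert \<Rightarrow>\<^sub>L 'h) set \<Rightarrow> (('h \<Rightarrow>\<^sub>L 'h) \<Rightarrow> ennreal) \<Rightarrow> bool" where
  "semifinite_weight \<A> \<phi> \<longleftrightarrow>
     \<A> \<subseteq> strong_operator_topology closure_of (definition_domain \<A> \<phi>)"

definition invariant_map ::
  "('h::chilbert \<Rightarrow>\<^sub>L 'h) set \<Rightarrow> (('h \<Rightarrow>\<^sub>L 'h) \<Rightarrow> ennreal) \<Rightarrow> (('h \<Rightarrow>\<^sub>L 'h) \<Rightarrow> ('h \<Rightarrow>\<^sub>L 'h)) \<Rightarrow> bool" where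
  "invariant_map \<A> \<phi> \<sigma> \<longleftrightarrow> (\<forall>a\<in>pos_part \<A>. \<phi> (\<sigma> a) = \<phi> a)"

section \<open>The Hilbert space of a weight\<close>

definition sq_integrable ::
  "('h::chilbert \<Rightarrow>\<^sub>L 'h) set \<Rightarrow> (('h \<Rightarrow>\<^sub>L 'h) \<Rightarrow> ennreal) \<Rightarrow> ('h \<Rightarrow>\<^sub>L 'h) set" where
  "sq_integrable \<A> \<phi> = {a\<in>\<A>. \<phi> (op_adj a o\<^sub>L a) < \<infinity>}"

definition sq_integrable_sym ::
  "('h::chilbert \<Rightarrow>\<^sub>L 'h) set \<Rightarrow> (('h \<Rightarrow>\<^sub>L 'h) \<Rightarrow> ennreal) \<Rightarrow> ('h \<Rightarrow>\<^sub>L 'h) set" where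
  "sq_integrable_sym \<A> \<phi> = op_adj ` sq_integrable \<A> \<phi> \<inter> sq_integrable \<A> \<phi>"

text \<open>The type \<open>'k\<close>, together with \<open>\<Lambda>\<close>, is a Hilbert space completion of
  \<open>sq_integrable_sym \<A> \<phi>\<close> for the scalar product \<open>\<langle>a, b\<rangle> = \<phi>(b* a)\<close>; this determines the pair
  up to a unique unitary.  Values of \<open>\<Lambda>\<close> outside \<open>sq_integrable_sym \<A> \<phi>\<close> are irrelevant.\<close>

definition weight_completion ::
  "('h::chilbert \<Rightarrow>\<^sub>L 'h) set \<Rightarrow> (('h \<Rightarrow>\<^sub>L 'h) \<Rightarrow> ennreal) \<Rightarrow> (('h \<Rightarrow>\<^sub>L 'h) \<Rightarrow> 'k::chilbert) \<Rightarrow> bool" where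
  "weight_completion \<A> \<phi> \<Lambda> \<longleftrightarrow>
     (\<forall>a\<in>sq_integrable_sym \<A> \<phi>. \<forall>b\<in>sq_integrable_sym \<A> \<phi>. \<Lambda> (a + b) = \<Lambda> a + \<Lambda> b) \<and>
     (\<forall>c. \<forall>a\<in>sq_integrable_sym \<A> \<phi>. \<Lambda> (op_scaleC c a) = c *\<^sub>C \<Lambda> a) \<and>
     (\<forall>a\<in>sq_integrable_sym \<A> \<phi>. \<forall>b\<in>sq_integrable_sym \<A> \<phi>.
        cinner (\<Lambda> a) (\<Lambda> b) = weight_ext \<A> \<phi> (op_adj b o\<^sub>L a)) \<and>
     closure (\<Lambda> ` sq_integrable_sym \<A> \<phi>) = UNIV"

definition induced_op ::
  "('h::chilbert \<Rightarrow>\<^sub>L 'h) set \<Rightarrow> (('h \<Rightarrow>\<^sub>L 'h) \<Rightarrow> ennreal) \<Rightarrow> (('h \<Rightarrow>\<^sub>L 'h) \<Rightarrow> 'k::chilbert) \<Rightarrow>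
   (('h \<Rightarrow>\<^sub>L 'h) \<Rightarrow> ('h \<Rightarrow>\<^sub>L 'h)) \<Rightarrow> ('k \<Rightarrow>\<^sub>L 'k)" where
  "induced_op \<A> \<phi> \<Lambda> \<sigma> =
     (THE T. \<forall>b\<in>sq_integrable_sym \<A> \<phi>. blinfun_apply T (\<Lambda> b) = \<Lambda> (\<sigma> b))"

section \<open>The spectral region, averages and Pringsheim convergence\<close>

definition D_region :: "real \<Rightarrow> complex set" where
  "D_region p = {z.
     cmod (csqrt (z + of_real (sqrt (4 * p - 4 * p\<^sup>2))) + csqrt (z - of_real (sqrt (4 * p - 4 * p\<^sup>2))))
       \<le> 2 * sqrt p \<and>
     cmod (csqrt (z + of_real (sqrt (4 * p - 4 * p\<^sup>2))) - csqrt (z - of_real (sqrt (4 * p - 4 * p\<^sup>2))))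
       \<le> 2 * sqrt p}"

definition double_average ::
  "(nat \<Rightarrow> nat \<Rightarrow> 'b \<Rightarrow> 'b::real_vector) \<Rightarrow> nat \<Rightarrow> nat \<Rightarrow> 'b \<Rightarrow> 'b" where
  "double_average \<sigma> k\<^sub>1 k\<^sub>2 a = (1 / (real k\<^sub>1 * real k\<^sub>2)) *\<^sub>R (\<Sum>m<k\<^sub>1. \<Sum>n<k\<^sub>2. \<sigma> m n a)"

definition pringsheim_limit :: "'a topology \<Rightarrow> (nat \<Rightarrow> nat \<Rightarrow> 'a) \<Rightarrow> 'a \<Rightarrow> bool" where
  "pringsheim_limit X f l \<longleftrightarrow> l \<in> topspace X \<and>
     (\<forall>U. openin X U \<longrightarrow> l \<in> U \<longrightarrow> (\<exists>n\<ge>1. \<forall>k\<^sub>1 k\<^sub>2. min k\<^sub>1 k\<^sub>2 \<ge> n \<longrightarrow> f k\<^sub>1 k\<^sub>2 \<in> U))"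

end

theory Submission
  imports Defs "HOL-Computational_Algebra.Polynomial"
begin

text \<open>The averages telescope on the coboundaries \<open>\<xi> - T\<xi>\<close> of the generators \<open>T\<close>, the induced contractions,
  so in Hilbert space they converge as soon as the induced operators of the \<open>\<sigma> m n\<close> are uniformly bounded.
  Boundedness comes from positivity: Kadison's inequality
  \<open>\<sigma>(b)\<^sup>2 \<le> \<sigma>(b\<^sup>2)\<close> for self-adjoint \<open>b\<close>, with \<open>\<phi>(\<sigma>(b\<^sup>2)) = \<phi>(b\<^sup>2)\<close>, bounds them on the closed real
  subspace generated by the self-adjoint elements of \<open>\<A>\<^sub>0\<close>.

  The passage from Hilbert space to strong convergence uses that, on bounded sets, a small value of
  \<open>\<phi>(y\<^sup>* y)\<close> forces \<open>y\<close> to be strongly small.  Along a fast sequence the operators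
  \<open>y\<^sub>j\<^sup>* y\<^sub>j\<close> are dominated by multiples of the suprema of \<open>z\<^sub>N(1 + z\<^sub>N)\<^sup>-\<^sup>1\<close>, where \<open>z\<^sub>N\<close> are the partial
  sums of a tail; by normality these suprema have small weight and by faithfulness they decrease to \<open>0\<close>.\<close>

section \<open>Positive operators on a real Hilbert space\<close>

text \<open>Convergence in the Hilbert space yields only a vector \<open>u\<close>, and nothing says
  at first that \<open>u\<close> comes from an operator. The averages of a self-adjoint
  \<open>b\<close> stay bounded by \<open>norm b\<close>, and their strong limit \<open>l\<close>
  along the diagonal is the candidate. But \<phi> need not be continuous along strong limits, so
  \<open>\<Lambda> l = u\<close> needs its own argument: along a fast subsequence the square of
  \<open>l\<close> minus an average is dominated by an operator of small weight, and domination
  survives strong limits. The function z / (1 + z) is used because it is operator monotone and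
  because on operators between 0 and c it can be undone at the cost of a factor 1 + c. Kadison's
  inequality is what positivity alone offers: the recurrence writes the maps of higher index as
  differences, through which complete positivity of the generators does not visibly pass. Invariance
  of the weight does pass, on elements of finite weight. Since self-adjoint elements form only a
  real space, the analysis is done with the real inner product; complex combinations enter at the
  end.\<close>

definition self_adjoint :: "('a::real_inner \<Rightarrow>\<^sub>L 'a) \<Rightarrow> bool" where
  "self_adjoint a \<longleftrightarrow> (\<forall>x y. blinfun_apply a x \<bullet> y = x \<bullet> blinfun_apply a y)"

text \<open>On a real space a nonnegative form does not force symmetry, so symmetry is demanded. For
  complex-linear operators the real notions agree with \<open>op_adj a = a\<close> and with
  membership in \<open>pos_part\<close>; see \<open>op_adj_self_adjoint\<close> and
  \<open>pos_part_iff\<close>.\<close>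

definition psd :: "('a::real_inner \<Rightarrow>\<^sub>L 'a) \<Rightarrow> bool" where
  "psd a \<longleftrightarrow> self_adjoint a \<and> (\<forall>x. 0 \<le> blinfun_apply a x \<bullet> x)"

lemma self_adjointD: "self_adjoint a \<Longrightarrow> blinfun_apply a x \<bullet> y = x \<bullet> blinfun_apply a y"
  by (simp add: self_adjoint_def)

lemma self_adjoint_id [simp]: "self_adjoint id_blinfun"
  by (simp add: self_adjoint_def)

lemma self_adjoint_0 [simp]: "self_adjoint 0"
  by (simp add: self_adjoint_def)

lemma self_adjoint_add: "self_adjoint a \<Longrightarrow> self_adjoint b \<Longrightarrow> self_adjoint (a + b)"
  by (simp add: self_adjoint_def blinfun.bilinear_simps inner_simps)

lemma self_adjoint_diff: "self_adjoint a \<Longrightarrow> self_adjoint b \<Longrightarrow> self_adjoint (a - b)"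
  by (simp add: self_adjoint_def blinfun.bilinear_simps inner_simps)

lemma self_adjoint_scaleR: "self_adjoint a \<Longrightarrow> self_adjoint (r *\<^sub>R a)"
  by (simp add: self_adjoint_def blinfun.bilinear_simps inner_simps)

lemma self_adjoint_sum: "(\<And>i. i \<in> I \<Longrightarrow> self_adjoint (f i)) \<Longrightarrow> self_adjoint (sum f I)"
  by (induction I rule: infinite_finite_induct) (auto intro: self_adjoint_add)

lemma self_adjoint_sandwich:
  "self_adjoint c \<Longrightarrow> self_adjoint a \<Longrightarrow> self_adjoint (c o\<^sub>L a o\<^sub>L c)"
  by (simp add: self_adjoint_def)

lemma psd_self_adjoint: "psd a \<Longrightarrow> self_adjoint a"
  by (simp add: psd_def)

lemma psd_nonneg: "psd a \<Longrightarrow> 0 \<le> blinfun_apply a x \<bullet> x"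
  by (simp add: psd_def)

lemma psd_id [simp]: "psd id_blinfun"
  by (simp add: psd_def)

lemma psd_0 [simp]: "psd 0"
  by (simp add: psd_def)

lemma psd_add: "psd a \<Longrightarrow> psd b \<Longrightarrow> psd (a + b)"
  by (simp add: psd_def self_adjoint_add blinfun.bilinear_simps inner_simps)

lemma psd_scaleR: "psd a \<Longrightarrow> 0 \<le> r \<Longrightarrow> psd (r *\<^sub>R a)"
  by (simp add: psd_def self_adjoint_scaleR blinfun.bilinear_simps)

lemma psd_sum: "(\<And>i. i \<in> I \<Longrightarrow> psd (f i)) \<Longrightarrow> psd (sum f I)"
  by (induction I rule: infinite_finite_induct) (auto intro: psd_add)

lemma psd_sandwich: "self_adjoint c \<Longrightarrow> psd a \<Longrightarrow> psd (c o\<^sub>L a o\<^sub>L c)"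
  unfolding psd_def by (metis self_adjoint_sandwich blinfun_apply_blinfun_compose self_adjointD)

lemma psd_square: "self_adjoint c \<Longrightarrow> psd (c o\<^sub>L c)"
  unfolding psd_def self_adjoint_def by (metis blinfun_apply_blinfun_compose inner_ge_zero)

lemma psd_diff_trans: "psd (b - a) \<Longrightarrow> psd (c - b) \<Longrightarrow> psd (c - a)"
  using psd_add[of "b - a" "c - b"] by simp

lemma psd_diffI:
  "self_adjoint a \<Longrightarrow> self_adjoint b \<Longrightarrow>
   (\<And>x. blinfun_apply a x \<bullet> x \<le> blinfun_apply b x \<bullet> x) \<Longrightarrow> psd (b - a)"
  by (simp add: psd_def self_adjoint_diff blinfun.bilinear_simps inner_simps)

lemma psd_diffD: "psd (b - a) \<Longrightarrow> blinfun_apply a x \<bullet> x \<le> blinfun_apply b x \<bullet> x"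
  by (simp add: psd_def blinfun.bilinear_simps inner_simps)

section \<open>Quadratic forms and norm estimates\<close>

lemma quadratic_form_bound:
  "\<bar>blinfun_apply a x \<bullet> x\<bar> \<le> norm a * (norm x)\<^sup>2"
proof -
  have "\<bar>blinfun_apply a x \<bullet> x\<bar> \<le> norm (blinfun_apply a x) * norm x"
    by (rule Cauchy_Schwarz_ineq2)
  also have "\<dots> \<le> (norm a * norm x) * norm x"
    by (intro mult_right_mono norm_blinfun) auto
  finally show ?thesis
    by (simp add: power2_eq_square mult.assoc)
qed

lemma psd_norm_diff:
  assumes "self_adjoint a" "norm a \<le> c"
  shows "psd (c *\<^sub>R id_blinfun - a)"
proof (rule psd_diffI[OF assms(1)])
  show "self_adjoint (c *\<^sub>R id_blinfun :: 'a \<Rightarrow>\<^sub>L 'a)"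
    by (simp add: self_adjoint_scaleR)
  fix x
  have "blinfun_apply a x \<bullet> x \<le> norm a * (norm x)\<^sup>2"
    using quadratic_form_bound[of a x] by linarith
  also have "\<dots> \<le> c * (norm x)\<^sup>2"
    by (intro mult_right_mono assms) auto
  finally show "blinfun_apply a x \<bullet> x \<le> blinfun_apply (c *\<^sub>R id_blinfun) x \<bullet> x"
    by (simp add: blinfun.bilinear_simps power2_norm_eq_inner)
qed

text \<open>Evaluation at the vertex \<open>- B / Y\<close>. The case \<open>X = 0\<close> gives
  \<open>B = 0\<close>; in this form it turns a first-order condition into orthogonality.\<close>

lemma nonneg_quadratic_discriminant:
  fixes X B Y :: real
  assumes "\<And>t. 0 \<le> X + 2 * t * B + t\<^sup>2 * Y" and "0 \<le> Y"
  shows "B\<^sup>2 \<le> X * Y"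
proof (cases "Y = 0")
  case True
  have "B = 0"
  proof (rule ccontr)
    assume "B \<noteq> 0"
    \<comment> \<open>For \<open>Y = 0\<close> the expression is affine in t; this t gives it the
      value -1.\<close>
    with assms(1)[of "- (X + 1) / (2 * B)"] True show False
      by (simp add: field_simps)
  qed
  with True show ?thesis by simp
next
  case False
  with \<open>0 \<le> Y\<close> have Y: "0 < Y" by simp
  have "X + 2 * (- B / Y) * B + (- B / Y)\<^sup>2 * Y = X - B\<^sup>2 / Y"
    using Y by (simp add: field_simps power2_eq_square)
  with assms(1)[of "- B / Y"] have "B\<^sup>2 / Y \<le> X" by simp
  then show ?thesis using Y by (simp add: field_simps)
qed

lemma psd_Cauchy_Schwarz:
  assumes "psd a"
  shows "(blinfun_apply a x \<bullet> y)\<^sup>2 \<le> (blinfun_apply a x \<bullet> x) * (blinfun_apply a y \<bullet> y)"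
proof (rule nonneg_quadratic_discriminant)
  fix t
  have "0 \<le> blinfun_apply a (x + t *\<^sub>R y) \<bullet> (x + t *\<^sub>R y)"
    by (rule psd_nonneg[OF assms])
  also have "\<dots> = blinfun_apply a x \<bullet> x + 2 * t * (blinfun_apply a x \<bullet> y) + t\<^sup>2 * (blinfun_apply a y \<bullet> y)"
    using self_adjointD[OF psd_self_adjoint[OF assms], of y x]
    by (simp add: blinfun.bilinear_simps inner_simps inner_commute power2_eq_square algebra_simps)
  finally show "0 \<le> \<dots>" .
qed (rule psd_nonneg[OF assms])

text \<open>This is a^2 \<le> c a without square roots: Cauchy-Schwarz for the form of
  \<open>a\<close>, taken at x and a x, followed by division by the squared norm of a x.\<close>

lemma psd_norm_sq_le:
  assumes "psd a" "psd (c *\<^sub>R id_blinfun - a)"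
  shows "(norm (blinfun_apply a x))\<^sup>2 \<le> c * (blinfun_apply a x \<bullet> x)"
proof (cases "blinfun_apply a x = 0")
  case True
  then show ?thesis by simp
next
  case False
  let ?y = "blinfun_apply a x"
  have "((norm ?y)\<^sup>2)\<^sup>2 \<le> (?y \<bullet> x) * (blinfun_apply a ?y \<bullet> ?y)"
    using psd_Cauchy_Schwarz[OF assms(1), of x ?y] by (simp add: power2_norm_eq_inner)
  also have "\<dots> \<le> (?y \<bullet> x) * (c * (norm ?y)\<^sup>2)"
    using psd_diffD[OF assms(2), of ?y] psd_nonneg[OF assms(1), of x]
    by (intro mult_left_mono) (simp_all add: blinfun.bilinear_simps power2_norm_eq_inner)
  finally have "(norm ?y)\<^sup>2 * (norm ?y)\<^sup>2 \<le> (c * (?y \<bullet> x)) * (norm ?y)\<^sup>2"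
    by (simp add: power2_eq_square algebra_simps)
  then show ?thesis by (rule mult_right_le_imp_le) (use False in simp)
qed

lemma psd_norm_le:
  assumes "psd a" "psd (c *\<^sub>R id_blinfun - a)" "0 \<le> c"
  shows "norm (blinfun_apply a x) \<le> c * norm x"
proof -
  have "(norm (blinfun_apply a x))\<^sup>2 \<le> c * (blinfun_apply a x \<bullet> x)"
    by (rule psd_norm_sq_le[OF assms(1,2)])
  also have "\<dots> \<le> c * (c * (x \<bullet> x))"
    using psd_diffD[OF assms(2), of x] assms(3)
    by (intro mult_left_mono) (simp_all add: blinfun.bilinear_simps)
  also have "\<dots> = (c * norm x)\<^sup>2"
    by (simp only: power_mult_distrib power2_norm_eq_inner) (simp only: power2_eq_square mult.assoc)
  finally show ?thesis
    by (rule power2_le_imp_le) (use assms(3) in simp)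
qed

subsection \<open>Orthogonal decomposition and adjoints\<close>

text \<open>The parallelogram law makes a minimising sequence for the distance Cauchy; orthogonality
  is the first-order condition at the nearest point.\<close>

lemma orthogonal_decomposition:
  fixes x :: "'a::{real_inner,complete_space}"
  assumes W: "subspace W" "closed W"
  obtains w where "w \<in> W" "\<And>v. v \<in> W \<Longrightarrow> (x - w) \<bullet> v = 0"
proof -
  define d where "d = infdist x W"
  have W0: "W \<noteq> {}" using subspace_0[OF W(1)] by auto
  have dle: "d \<le> norm (x - v)" if "v \<in> W" for v
    using infdist_le[OF that, of x] by (simp add: d_def dist_norm)
  have d0: "0 \<le> d" by (simp add: d_def infdist_nonneg)
  define e where "e n = 1 / (real n + 1)" for n
  have e0: "0 < e n" for n by (simp add: e_def)
  have "\<exists>v\<in>W. norm (x - v) < d + e n" for n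
  proof (rule ccontr)
    assume "\<not> ?thesis"
    then have "d + e n \<le> infdist x W"
      unfolding infdist_notempty[OF W0]
      by (intro cINF_greatest[OF W0]) (auto simp: dist_norm not_less)
    then show False using e0[of n] by (simp add: d_def)
  qed
  then obtain v where vW: "v n \<in> W" and vd: "norm (x - v n) < d + e n" for n
    by metis
  have lim_e: "e \<longlonglongrightarrow> 0"
    unfolding e_def using LIMSEQ_inverse_real_of_nat by (simp add: inverse_eq_divide add.commute)
  \<comment> \<open>The midpoint lies in \<open>W\<close>, hence at distance at least
    \<open>d\<close> from x; the parallelogram law leaves 4 (d + e)^2 - 4 d^2.\<close>
  have bound: "(norm (v m - v n))\<^sup>2 \<le> 8 * d * e N + 4 * (e N)\<^sup>2" if "N \<le> m" "N \<le> n" for m n N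
  proof -
    have le: "(norm (x - v k))\<^sup>2 \<le> (d + e N)\<^sup>2" if "N \<le> k" for k
    proof -
      have "e k \<le> e N" using that by (simp add: e_def frac_le)
      then show ?thesis using vd[of k] by (intro power_mono) auto
    qed
    have "(1/2) *\<^sub>R (v m + v n) \<in> W"
      by (intro subspace_scale subspace_add W vW)
    then have "d\<^sup>2 \<le> (norm (x - (1/2) *\<^sub>R (v m + v n)))\<^sup>2"
      by (intro power_mono dle d0)
    moreover have "(norm (v m - v n))\<^sup>2 =
        2 * (norm (x - v m))\<^sup>2 + 2 * (norm (x - v n))\<^sup>2 - 4 * (norm (x - (1/2) *\<^sub>R (v m + v n)))\<^sup>2"
      by (simp add: power2_norm_eq_inner inner_simps inner_commute algebra_simps)
    ultimately have "(norm (v m - v n))\<^sup>2 \<le> 2 * (d + e N)\<^sup>2 + 2 * (d + e N)\<^sup>2 - 4 * d\<^sup>2"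
      using le[OF that(1)] le[OF that(2)] by linarith
    then show ?thesis by (simp add: power2_eq_square algebra_simps)
  qed
  have "Cauchy v"
    unfolding Cauchy_iff
  proof (intro allI impI)
    fix \<epsilon> :: real assume \<epsilon>: "0 < \<epsilon>"
    have "(\<lambda>N. 8 * d * e N + 4 * (e N)\<^sup>2) \<longlonglongrightarrow> 8 * d * 0 + 4 * 0\<^sup>2"
      by (intro tendsto_intros lim_e)
    then have "\<forall>\<^sub>F N in sequentially. 8 * d * e N + 4 * (e N)\<^sup>2 < \<epsilon>\<^sup>2"
      by (rule order_tendstoD(2)) (use \<epsilon> in simp)
    then obtain N where N: "8 * d * e N + 4 * (e N)\<^sup>2 < \<epsilon>\<^sup>2"
      using eventually_happens trivial_limit_sequentially by blast
    have "norm (v m - v n) < \<epsilon>" if "m \<ge> N" "n \<ge> N" for m n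
    proof (rule power2_less_imp_less)
      show "(norm (v m - v n))\<^sup>2 < \<epsilon>\<^sup>2" using bound[OF that] N by linarith
      show "0 \<le> \<epsilon>" using \<epsilon> by simp
    qed
    then show "\<exists>M. \<forall>m\<ge>M. \<forall>n\<ge>M. norm (v m - v n) < \<epsilon>" by blast
  qed
  then obtain w where w: "v \<longlonglongrightarrow> w"
    using Cauchy_convergent_iff convergent_def by blast
  have wW: "w \<in> W"
    using closed_sequentially[OF W(2)] vW w by blast
  have "(\<lambda>n. d + e n) \<longlonglongrightarrow> d + 0" by (intro tendsto_intros lim_e)
  moreover have "(\<lambda>n. norm (x - v n)) \<longlonglongrightarrow> norm (x - w)" by (intro tendsto_intros w)
  ultimately have xw: "norm (x - w) \<le> d"
    using vd by (intro LIMSEQ_le[of "\<lambda>n. norm (x - v n)" _ "\<lambda>n. d + e n"]) (auto intro: less_imp_le)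
  show thesis
  proof (rule that[OF wW])
    fix u assume u: "u \<in> W"
    \<comment> \<open>Moving from \<open>w\<close> along \<open>u\<close> cannot decrease the
      distance, so the coefficient linear in t vanishes.\<close>
    have "((x - w) \<bullet> u)\<^sup>2 \<le> 0 * (u \<bullet> u)"
    proof (rule nonneg_quadratic_discriminant)
      fix t :: real
      have "w - t *\<^sub>R u \<in> W" by (intro subspace_diff subspace_scale W wW u)
      then have "(norm (x - w))\<^sup>2 \<le> (norm (x - (w - t *\<^sub>R u)))\<^sup>2"
        using dle xw by (intro power_mono) force+
      moreover have "(norm (x - (w - t *\<^sub>R u)))\<^sup>2 = (norm (x - w))\<^sup>2 + 2 * t * ((x - w) \<bullet> u) + t\<^sup>2 * (u \<bullet> u)"
        unfolding power2_norm_eq_inner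
        by (simp add: inner_simps inner_commute power2_eq_square algebra_simps)
      ultimately show "0 \<le> 0 + 2 * t * ((x - w) \<bullet> u) + t\<^sup>2 * (u \<bullet> u)"
        by linarith
    qed simp
    then show "(x - w) \<bullet> u = 0" by simp
  qed
qed

lemma Riesz_representation:
  fixes f :: "'a::{real_inner,complete_space} \<Rightarrow> real"
  assumes f: "bounded_linear f"
  obtains z where "\<And>x. f x = x \<bullet> z"
proof (cases "\<forall>x. f x = 0")
  case True
  then show ?thesis using that[of 0] by simp
next
  case False
  interpret f: bounded_linear f by (rule f)
  obtain x0 where x0: "f x0 \<noteq> 0" using False by blast
  have "subspace {x. f x = 0}"
    by (auto intro!: subspaceI simp: f.add f.scaleR f.zero)
  moreover have "closed {x. f x = 0}"
    by (intro closed_Collect_eq f.continuous_on continuous_intros)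
  ultimately obtain w where w: "f w = 0" "\<And>v. f v = 0 \<Longrightarrow> (x0 - w) \<bullet> v = 0"
    using orthogonal_decomposition[of "{x. f x = 0}" x0] by auto
  define u where "u = x0 - w"
  have fu: "f u \<noteq> 0" using x0 w by (simp add: u_def f.diff)
  then have u0: "u \<noteq> 0" by (auto simp: f.zero)
  show ?thesis
  proof (rule that)
    fix x
    have "f (x - (f x / f u) *\<^sub>R u) = 0"
      using fu by (simp add: f.diff f.scaleR)
    then have "u \<bullet> (x - (f x / f u) *\<^sub>R u) = 0"
      unfolding u_def by (rule w(2))
    then have "x \<bullet> u = (f x / f u) * (u \<bullet> u)"
      by (simp add: inner_simps inner_commute)
    then show "f x = x \<bullet> ((f u / (u \<bullet> u)) *\<^sub>R u)"
      using fu u0 by (simp add: field_simps)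
  qed
qed

lemma adjoint_exists:
  fixes T :: "'a::{real_inner,complete_space} \<Rightarrow>\<^sub>L 'a"
  obtains S :: "'a \<Rightarrow>\<^sub>L 'a" where "\<And>x y. blinfun_apply T x \<bullet> y = x \<bullet> blinfun_apply S y"
proof -
  have "\<exists>z. \<forall>x. blinfun_apply T x \<bullet> y = x \<bullet> z" for y
  proof -
    have "bounded_linear (\<lambda>x. blinfun_apply T x \<bullet> y)"
      by (rule bounded_linear_compose[OF bounded_linear_inner_left blinfun.bounded_linear_right])
    then show ?thesis by (rule Riesz_representation) auto
  qed
  then obtain s where s: "blinfun_apply T x \<bullet> y = x \<bullet> s y" for x y by metis
  have "bounded_linear s"
  proof (rule bounded_linear_intro[where K = "norm T"])
    show "s (x + y) = s x + s y" for x y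
      by (rule vector_eq_ldot[THEN iffD1]) (simp add: s[symmetric] inner_simps)
    show "s (r *\<^sub>R x) = r *\<^sub>R s x" for r x
      by (rule vector_eq_ldot[THEN iffD1]) (simp add: s[symmetric] inner_simps)
    show "norm (s x) \<le> norm x * norm T" for x
    proof (cases "s x = 0")
      case False
      have "norm (s x) * norm (s x) = blinfun_apply T (s x) \<bullet> x"
        by (simp add: s power2_norm_eq_inner[symmetric] power2_eq_square[symmetric])
      also have "\<dots> \<le> norm (blinfun_apply T (s x)) * norm x"
        by (rule norm_cauchy_schwarz)
      also have "\<dots> \<le> (norm T * norm (s x)) * norm x"
        by (intro mult_right_mono norm_blinfun) auto
      finally have "norm (s x) * norm (s x) \<le> (norm x * norm T) * norm (s x)"
        by (simp add: mult_ac)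
      then show ?thesis by (rule mult_right_le_imp_le) (use False in simp)
    qed simp
  qed
  then show thesis
    using that[of "Blinfun s"] by (simp add: bounded_linear_Blinfun_apply s)
qed

subsection \<open>Strong limits and resolvents\<close>

lemma strong_limit_exists:
  fixes a :: "nat \<Rightarrow> ('a::real_normed_vector \<Rightarrow>\<^sub>L 'b::real_normed_vector)"
  assumes conv: "\<And>x. convergent (\<lambda>n. blinfun_apply (a n) x)" and C: "\<And>n. norm (a n) \<le> C"
  obtains s where "\<And>x. (\<lambda>n. blinfun_apply (a n) x) \<longlonglongrightarrow> blinfun_apply s x" "norm s \<le> C"
proof -
  define f where "f x = lim (\<lambda>n. blinfun_apply (a n) x)" for x
  have f: "(\<lambda>n. blinfun_apply (a n) x) \<longlonglongrightarrow> f x" for x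
    using conv[of x] by (simp add: f_def convergent_LIMSEQ_iff)
  have C0: "0 \<le> C" using C[of 0] norm_ge_zero order_trans by blast
  have bd: "norm (f x) \<le> C * norm x" for x
  proof (rule LIMSEQ_le_const2[OF tendsto_norm[OF f]])
    have "norm (blinfun_apply (a n) x) \<le> C * norm x" for n
      using norm_blinfun[of "a n" x] mult_right_mono[OF C[of n] norm_ge_zero[of x]] by linarith
    then show "\<exists>N. \<forall>n\<ge>N. norm (blinfun_apply (a n) x) \<le> C * norm x" by blast
  qed
  have "bounded_linear f"
  proof (rule bounded_linear_intro[where K = C])
    fix x y r
    show "f (x + y) = f x + f y"
      by (rule LIMSEQ_unique[OF f]) (simp add: blinfun.bilinear_simps tendsto_add f)
    show "f (r *\<^sub>R x) = r *\<^sub>R f x"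
      by (rule LIMSEQ_unique[OF f]) (simp add: blinfun.bilinear_simps tendsto_scaleR f)
    show "norm (f x) \<le> norm x * C" using bd[of x] by (simp add: mult.commute)
  qed
  then have app: "blinfun_apply (Blinfun f) = f" by (rule bounded_linear_Blinfun_apply)
  show thesis
    by (rule that[of "Blinfun f"]) (auto simp: app f bd C0 intro: norm_blinfun_bound)
qed

lemma self_adjoint_strong_limit:
  assumes "\<And>n. self_adjoint (a n)" "\<And>x. (\<lambda>n. blinfun_apply (a n) x) \<longlonglongrightarrow> blinfun_apply s x"
  shows "self_adjoint s"
  unfolding self_adjoint_def
proof (intro allI)
  fix x y
  have "(\<lambda>n. blinfun_apply (a n) x \<bullet> y) \<longlonglongrightarrow> blinfun_apply s x \<bullet> y"
    by (intro tendsto_intros assms)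
  moreover have "(\<lambda>n. x \<bullet> blinfun_apply (a n) y) \<longlonglongrightarrow> x \<bullet> blinfun_apply s y"
    by (intro tendsto_intros assms)
  ultimately show "blinfun_apply s x \<bullet> y = x \<bullet> blinfun_apply s y"
    using assms(1) by (simp add: self_adjoint_def LIMSEQ_unique)
qed

lemma psd_strong_limit:
  assumes "\<And>n. psd (a n)" "\<And>x. (\<lambda>n. blinfun_apply (a n) x) \<longlonglongrightarrow> blinfun_apply s x"
  shows "psd s"
  unfolding psd_def
proof (intro conjI allI)
  show "self_adjoint s"
    by (rule self_adjoint_strong_limit[OF psd_self_adjoint[OF assms(1)] assms(2)])
  fix x
  have "(\<lambda>n. blinfun_apply (a n) x \<bullet> x) \<longlonglongrightarrow> blinfun_apply s x \<bullet> x"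
    by (intro tendsto_intros assms)
  then show "0 \<le> blinfun_apply s x \<bullet> x"
    using psd_nonneg[OF assms(1)] by (intro LIMSEQ_le_const) auto
qed

text \<open>At each x the quadratic forms increase and are bounded, hence converge. The differences
  lie between 0 and \<open>c\<close>, so \<open>psd_norm_sq_le\<close> upgrades this to convergence
  of the vectors.\<close>

lemma increasing_bounded_strong_limit:
  fixes a :: "nat \<Rightarrow> ('a::{real_inner,complete_space} \<Rightarrow>\<^sub>L 'a)"
  assumes pos: "\<And>n. psd (a n)" and mono: "\<And>m n. m \<le> n \<Longrightarrow> psd (a n - a m)"
    and bd: "\<And>n. psd (c *\<^sub>R id_blinfun - a n)" and c: "0 \<le> c"
  obtains s where "psd s" "\<And>x. (\<lambda>n. blinfun_apply (a n) x) \<longlonglongrightarrow> blinfun_apply s x"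
    "\<And>n. psd (s - a n)"
proof -
  have conv: "convergent (\<lambda>n. blinfun_apply (a n) x)" for x
  proof -
    define q where "q n = blinfun_apply (a n) x \<bullet> x" for n
    have "incseq q"
      unfolding incseq_def q_def using psd_diffD[OF mono] by blast
    moreover have "q n \<le> c * (x \<bullet> x)" for n
      using psd_diffD[OF bd[of n], of x] by (simp add: q_def blinfun.bilinear_simps)
    ultimately have "Cauchy q"
      using incseq_convergent convergent_Cauchy convergentI by metis
    have key: "(norm (blinfun_apply (a n) x - blinfun_apply (a m) x))\<^sup>2 \<le> c * \<bar>q n - q m\<bar>" if "m \<le> n" for m n
    proof -
      have "psd (c *\<^sub>R id_blinfun - (a n - a m))"
        using psd_add[OF bd[of n] pos[of m]] by (simp add: algebra_simps)
      from psd_norm_sq_le[OF mono[OF that] this, of x]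
      show ?thesis
        using c mult_left_mono[OF abs_ge_self[of "q n - q m"] c]
        by (simp add: blinfun.bilinear_simps inner_simps q_def)
    qed
    have "Cauchy (\<lambda>n. blinfun_apply (a n) x)"
      unfolding Cauchy_iff
    proof (intro allI impI)
      fix e :: real assume e: "0 < e"
      \<comment> \<open>Dividing by c + 1 instead of c also covers \<open>c = 0\<close>.\<close>
      then have "0 < e\<^sup>2 / (c + 1)" using c by simp
      then obtain N where N: "\<And>m n. m \<ge> N \<Longrightarrow> n \<ge> N \<Longrightarrow> \<bar>q m - q n\<bar> < e\<^sup>2 / (c + 1)"
        using \<open>Cauchy q\<close> unfolding Cauchy_iff real_norm_def by metis
      have *: "norm (blinfun_apply (a n) x - blinfun_apply (a m) x) < e" if "m \<ge> N" "m \<le> n" for m n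
      proof (rule power2_less_imp_less)
        have "(norm (blinfun_apply (a n) x - blinfun_apply (a m) x))\<^sup>2 \<le> (c + 1) * \<bar>q n - q m\<bar>"
          using key[OF that(2)] by (simp add: algebra_simps)
        also have "\<dots> < (c + 1) * (e\<^sup>2 / (c + 1))"
          using N[of n m] that c by (intro mult_strict_left_mono) auto
        finally show "(norm (blinfun_apply (a n) x - blinfun_apply (a m) x))\<^sup>2 < e\<^sup>2"
          using c by simp
      qed (use e in simp)
      have "norm (blinfun_apply (a m) x - blinfun_apply (a n) x) < e" if "m \<ge> N" "n \<ge> N" for m n
        using *[of m n] *[of n m] that by (cases "m \<le> n") (auto simp: norm_minus_commute)
      then show "\<exists>M. \<forall>m\<ge>M. \<forall>n\<ge>M. norm (blinfun_apply (a m) x - blinfun_apply (a n) x) < e" by blast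
    qed
    then show ?thesis by (rule Cauchy_convergent)
  qed
  have "norm (a n) \<le> c" for n
    by (intro norm_blinfun_bound c psd_norm_le[OF pos bd c])
  with conv obtain s where s: "\<And>x. (\<lambda>n. blinfun_apply (a n) x) \<longlonglongrightarrow> blinfun_apply s x"
    by (rule strong_limit_exists) blast
  show thesis
  proof (rule that[OF psd_strong_limit[OF pos s] s])
    fix n
    show "psd (s - a n)"
    proof (rule psd_strong_limit)
      show "psd (a (n + k) - a n)" for k by (rule mono) simp
      show "(\<lambda>k. blinfun_apply (a (n + k) - a n) x) \<longlonglongrightarrow> blinfun_apply (s - a n) x" for x
        using LIMSEQ_ignore_initial_segment[OF s[of x], of n]
        by (simp add: blinfun.bilinear_simps add.commute tendsto_diff)
    qed
  qed
qed

text \<open>Sequential closedness suffices because resolvents arise below as strong limits of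
  sequences of polynomials.\<close>

definition strongly_seq_closed :: "('a::real_normed_vector \<Rightarrow>\<^sub>L 'b::real_normed_vector) set \<Rightarrow> bool" where
  "strongly_seq_closed X \<longleftrightarrow> (\<forall>f l. (\<forall>n. f n \<in> X) \<longrightarrow>
     (\<forall>x. (\<lambda>n. blinfun_apply (f n) x) \<longlonglongrightarrow> blinfun_apply l x) \<longrightarrow> l \<in> X)"

text \<open>The equation (1 + z) y = x is solved as y = x / c + t y with t = 1 - (1 + z) / c. The
  iterates are polynomials in \<open>z\<close>, so the resolvent lies in every strongly sequentially
  closed unital algebra \<open>X\<close> that contains \<open>z\<close>; this is how it is found in
  a von Neumann algebra.\<close>

lemma resolvent_exists:
  fixes z :: "'a::{real_inner,complete_space} \<Rightarrow>\<^sub>L 'a"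
  assumes z: "psd z"
    and X: "strongly_seq_closed X" "id_blinfun \<in> X" "z \<in> X"
      "\<And>a b. a \<in> X \<Longrightarrow> b \<in> X \<Longrightarrow> a + b \<in> X" "\<And>r a. a \<in> X \<Longrightarrow> r *\<^sub>R a \<in> X"
      "\<And>a b. a \<in> X \<Longrightarrow> b \<in> X \<Longrightarrow> a o\<^sub>L b \<in> X"
  obtains R where "R \<in> X" "(id_blinfun + z) o\<^sub>L R = id_blinfun"
proof -
  \<comment> \<open>With this c the operator 1 + z lies between 1 and c, so \<open>t\<close> lies
    between 0 and \<open>K\<close>, and \<open>K\<close> is less than 1.\<close>
  define c where "c = 1 + norm z"
  have c: "0 < c" "1 \<le> c" by (auto simp: c_def add_pos_nonneg)
  define t where "t = (1 - 1/c) *\<^sub>R id_blinfun + (- 1/c) *\<^sub>R z"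
  define K where "K = 1 - 1/c"
  have K: "0 \<le> K" "K < 1" using c by (auto simp: K_def)
  have t_app: "blinfun_apply t x = x - (1/c) *\<^sub>R (x + blinfun_apply z x)" for x
    by (simp add: t_def blinfun.bilinear_simps algebra_simps)
  have "t = (1/c) *\<^sub>R (norm z *\<^sub>R id_blinfun - z)"
  proof (rule blinfun_eqI)
    fix x
    have "(1 - 1/c) = norm z / c" using c by (simp add: c_def field_simps)
    then show "blinfun_apply t x = blinfun_apply ((1/c) *\<^sub>R (norm z *\<^sub>R id_blinfun - z)) x"
      unfolding t_def by (simp add: blinfun.bilinear_simps scaleR_diff_right)
  qed
  then have "psd t"
    using psd_scaleR[OF psd_norm_diff[OF psd_self_adjoint[OF z] order_refl], of "1/c"] c by simp
  moreover have "psd (K *\<^sub>R id_blinfun - t)"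
    using psd_scaleR[OF z, of "1/c"] c by (simp add: t_def K_def)
  ultimately have tK: "norm (blinfun_apply t x) \<le> K * norm x" for x
    using psd_norm_le K by blast
  \<comment> \<open>The Picard iteration carried out on operators, started at 0; at each x its limit
    is the fixed point \<open>g x\<close>.\<close>
  define r where "r = rec_nat (0::'a \<Rightarrow>\<^sub>L 'a) (\<lambda>_ R. (1/c) *\<^sub>R id_blinfun + (t o\<^sub>L R))"
  have r0: "r 0 = 0" and rS: "r (Suc n) = (1/c) *\<^sub>R id_blinfun + (t o\<^sub>L r n)" for n
    by (simp_all add: r_def)
  have "\<exists>y. (1/c) *\<^sub>R x + blinfun_apply t y = y" for x
  proof -
    have "\<exists>!y\<in>UNIV. (1/c) *\<^sub>R x + blinfun_apply t y = y"
    proof (rule Banach_fix[where c = K])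
      show "\<And>y y'. y \<in> UNIV \<Longrightarrow> y' \<in> UNIV \<Longrightarrow>
          dist ((1/c) *\<^sub>R x + blinfun_apply t y) ((1/c) *\<^sub>R x + blinfun_apply t y') \<le> K * dist y y'"
        by (simp add: dist_norm blinfun.diff_right[symmetric] tK)
    qed (use K in \<open>auto simp: complete_UNIV\<close>)
    then show ?thesis by blast
  qed
  then obtain g where g: "(1/c) *\<^sub>R x + blinfun_apply t (g x) = g x" for x by metis
  have lim: "(\<lambda>n. blinfun_apply (r n) x) \<longlonglongrightarrow> g x" for x
  proof -
    have "norm (blinfun_apply (r n) x - g x) \<le> K ^ n * norm (g x)" for n
    proof (induction n)
      case (Suc n)
      have "blinfun_apply (r (Suc n)) x - g x = blinfun_apply t (blinfun_apply (r n) x - g x)"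
        by (subst (1) g[of x, symmetric]) (simp add: rS blinfun.bilinear_simps)
      then have "norm (blinfun_apply (r (Suc n)) x - g x) \<le> K * norm (blinfun_apply (r n) x - g x)"
        using tK by metis
      also have "\<dots> \<le> K * (K ^ n * norm (g x))"
        by (intro mult_left_mono Suc K)
      finally show ?case by (simp add: mult.assoc)
    qed (simp add: r0)
    moreover have "(\<lambda>n. K ^ n * norm (g x)) \<longlonglongrightarrow> 0"
      using K by (intro tendsto_mult_left_zero LIMSEQ_realpow_zero) auto
    ultimately have "(\<lambda>n. blinfun_apply (r n) x - g x) \<longlonglongrightarrow> 0"
      by (intro Lim_null_comparison[of "\<lambda>n. blinfun_apply (r n) x - g x" "\<lambda>n. K ^ n * norm (g x)"]) auto
    then show ?thesis by (simp add: LIM_zero_iff)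
  qed
  have "norm (r n) \<le> 1" for n
  proof (induction n)
    case (Suc n)
    have "norm (blinfun_apply (r (Suc n)) x) \<le> 1 * norm x" for x
    proof -
      have "norm (blinfun_apply (r (Suc n)) x) \<le> norm ((1/c) *\<^sub>R x) + norm (blinfun_apply t (blinfun_apply (r n) x))"
        by (simp add: rS blinfun.bilinear_simps norm_triangle_ineq del: norm_scaleR)
      also have "\<dots> \<le> (1/c) * norm x + K * norm (blinfun_apply (r n) x)"
        using tK c by (intro add_mono) auto
      also have "\<dots> \<le> (1/c) * norm x + K * norm x"
        using norm_blinfun[of "r n" x] mult_right_mono[OF Suc norm_ge_zero[of x]] K c
        by (intro add_mono mult_left_mono) auto
      also have "\<dots> = 1 * norm x" by (simp add: K_def algebra_simps)
      finally show ?thesis .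
    qed
    then show ?case by (intro norm_blinfun_bound) auto
  qed (simp add: r0)
  moreover have "convergent (\<lambda>n. blinfun_apply (r n) x)" for x
    using lim convergentI by blast
  ultimately obtain R where R: "\<And>x. (\<lambda>n. blinfun_apply (r n) x) \<longlonglongrightarrow> blinfun_apply R x"
    using strong_limit_exists by metis
  have Rg: "blinfun_apply R x = g x" for x
    by (rule LIMSEQ_unique[OF R lim])
  have "t \<in> X" unfolding t_def by (intro X)
  have "r n \<in> X" for n
  proof (induction n)
    case 0
    show ?case using X(5)[OF X(2), of 0] by (simp add: r0)
  next
    case (Suc n)
    then show ?case unfolding rS by (intro X \<open>t \<in> X\<close>)
  qed
  with R have "R \<in> X"
    using X(1) unfolding strongly_seq_closed_def by blast
  moreover have "(id_blinfun + z) o\<^sub>L R = id_blinfun"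
  proof (rule blinfun_eqI)
    fix x
    have "(1/c) *\<^sub>R (g x + blinfun_apply z (g x)) = (1/c) *\<^sub>R x"
      using g[of x] unfolding t_app by (simp add: algebra_simps)
    then show "blinfun_apply ((id_blinfun + z) o\<^sub>L R) x = blinfun_apply id_blinfun x"
      using c by (simp add: Rg blinfun.bilinear_simps)
  qed
  ultimately show thesis by (rule that)
qed

text \<open>\<open>cutoff z = z (1 + z)\<^sup>-\<^sup>1\<close>: an operator monotone function that is bounded by \<open>1\<close> and by \<open>z\<close>.\<close>

definition cutoff :: "('a::real_inner \<Rightarrow>\<^sub>L 'a) \<Rightarrow> ('a \<Rightarrow>\<^sub>L 'a)" where
  "cutoff z = id_blinfun - (THE R. (id_blinfun + z) o\<^sub>L R = id_blinfun)"

lemma resolvent_app: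
  assumes "(id_blinfun + z) o\<^sub>L R = id_blinfun"
  shows "blinfun_apply R x + blinfun_apply z (blinfun_apply R x) = x"
proof -
  have "blinfun_apply ((id_blinfun + z) o\<^sub>L R) x = blinfun_apply id_blinfun x"
    using assms by (rule arg_cong)
  then show ?thesis by (simp add: blinfun.bilinear_simps)
qed

text \<open>Uniqueness behind \<open>THE\<close>: (1 + z) u = 0 makes the squared norm of u plus a
  nonnegative number equal to 0.\<close>

lemma cutoff_resolvent:
  assumes z: "psd z" and R: "(id_blinfun + z) o\<^sub>L R = id_blinfun"
  shows "cutoff z = id_blinfun - R"
proof -
  have "S = R" if S: "(id_blinfun + z) o\<^sub>L S = id_blinfun" for S
  proof (rule blinfun_eqI)
    fix x
    define u where "u = blinfun_apply S x - blinfun_apply R x"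
    have "u + blinfun_apply z u = 0"
      using resolvent_app[OF R, of x] resolvent_app[OF S, of x]
      by (simp add: u_def blinfun.bilinear_simps algebra_simps)
    then have "u \<bullet> u + blinfun_apply z u \<bullet> u = 0"
      by (metis inner_add_left inner_zero_left)
    then have "u \<bullet> u \<le> 0" using psd_nonneg[OF z, of u] by linarith
    then have "u = 0" by (metis inner_eq_zero_iff inner_ge_zero order_antisym)
    then show "blinfun_apply S x = blinfun_apply R x" by (simp add: u_def)
  qed
  then have "(THE S. (id_blinfun + z) o\<^sub>L S = id_blinfun) = R"
    using R by (intro the_equality)
  then show ?thesis by (simp add: cutoff_def)
qed

text \<open>The form of the resolvent at x is the maximum over y of 2 <x, y> - <(1 + z) y, y>,
  attained at y = R x. Order properties of \<open>cutoff\<close> then follow by choosing y, even for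
  operators that do not commute.\<close>

lemma resolvent_variational:
  assumes z: "psd z" and R: "(id_blinfun + z) o\<^sub>L R = id_blinfun"
  shows "2 * (x \<bullet> y) - y \<bullet> y - blinfun_apply z y \<bullet> y \<le> blinfun_apply R x \<bullet> x"
proof -
  define v where "v = blinfun_apply R x"
  have x: "x = v + blinfun_apply z v" using resolvent_app[OF R, of x] by (simp add: v_def)
  have "0 \<le> blinfun_apply (id_blinfun + z) (y - v) \<bullet> (y - v)"
    by (intro psd_nonneg psd_add psd_id z)
  also have "\<dots> = y \<bullet> y + blinfun_apply z y \<bullet> y - 2 * (x \<bullet> y) + v \<bullet> x"
    using self_adjointD[OF psd_self_adjoint[OF z], of y v]
    by (simp add: x blinfun.bilinear_simps inner_simps inner_commute algebra_simps)
  finally show ?thesis by (simp add: v_def)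
qed

lemma resolvent_self_adjoint:
  assumes z: "psd z" and R: "(id_blinfun + z) o\<^sub>L R = id_blinfun"
  shows "self_adjoint R"
  unfolding self_adjoint_def
proof (intro allI)
  fix x y
  let ?u = "blinfun_apply R x" and ?v = "blinfun_apply R y"
  have "?u \<bullet> (?v + blinfun_apply z ?v) = (?u + blinfun_apply z ?u) \<bullet> ?v"
    using self_adjointD[OF psd_self_adjoint[OF z]] by (simp add: inner_simps)
  then show "?u \<bullet> y = x \<bullet> ?v" by (simp add: resolvent_app[OF R])
qed

lemma resolvent_any:
  fixes z :: "'a::{real_inner,complete_space} \<Rightarrow>\<^sub>L 'a"
  assumes "psd z"
  obtains R where "(id_blinfun + z) o\<^sub>L R = id_blinfun"
  by (rule resolvent_exists[OF assms, of UNIV]) (auto simp: strongly_seq_closed_def)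

lemma cutoff_self_adjoint:
  fixes z :: "'a::{real_inner,complete_space} \<Rightarrow>\<^sub>L 'a"
  assumes "psd z"
  shows "self_adjoint (cutoff z)"
  using resolvent_any[OF assms] cutoff_resolvent[OF assms] resolvent_self_adjoint[OF assms]
    self_adjoint_diff[OF self_adjoint_id] by metis

text \<open>A larger operator lowers the function maximised in \<open>resolvent_variational\<close>,
  so the resolvent decreases.\<close>

lemma cutoff_mono:
  fixes z w :: "'a::{real_inner,complete_space} \<Rightarrow>\<^sub>L 'a"
  assumes z: "psd z" and w: "psd w" and le: "psd (w - z)"
  shows "psd (cutoff w - cutoff z)"
proof -
  obtain R where R: "(id_blinfun + z) o\<^sub>L R = id_blinfun" by (rule resolvent_any[OF z])
  obtain S where S: "(id_blinfun + w) o\<^sub>L S = id_blinfun" by (rule resolvent_any[OF w])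
  have "psd (R - S)"
  proof (rule psd_diffI)
    show "self_adjoint S" "self_adjoint R"
      using resolvent_self_adjoint z w R S by blast+
    fix x
    \<comment> \<open>The maximiser for \<open>w\<close>, used as a test vector in the problem for
      \<open>z\<close>.\<close>
    define u where "u = blinfun_apply S x"
    have "x \<bullet> u = u \<bullet> u + blinfun_apply w u \<bullet> u"
      using resolvent_app[OF S, of x] by (metis inner_add_left u_def)
    moreover have "blinfun_apply z u \<bullet> u \<le> blinfun_apply w u \<bullet> u"
      by (rule psd_diffD[OF le])
    ultimately show "blinfun_apply S x \<bullet> x \<le> blinfun_apply R x \<bullet> x"
      using resolvent_variational[OF z R, of x u] by (simp add: u_def inner_commute)
  qed
  then show ?thesis by (simp add: cutoff_resolvent[OF z R] cutoff_resolvent[OF w S])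
qed

text \<open>The last bound is the operator form of s \<le> (1 + c) s / (1 + s) for 0 \<le> s \<le>
  c: on bounded operators the cutoff loses only a constant factor.\<close>

lemma cutoff_bounds:
  fixes z :: "'a::{real_inner,complete_space} \<Rightarrow>\<^sub>L 'a"
  assumes z: "psd z"
  shows "psd (cutoff z)" "psd (id_blinfun - cutoff z)" "psd (z - cutoff z)"
    "psd (c *\<^sub>R id_blinfun - z) \<Longrightarrow> psd ((1 + c) *\<^sub>R cutoff z - z)"
proof -
  obtain R where R: "(id_blinfun + z) o\<^sub>L R = id_blinfun" by (rule resolvent_any[OF z])
  have cut: "cutoff z = id_blinfun - R" by (rule cutoff_resolvent[OF z R])
  have sa: "self_adjoint (cutoff z)" by (rule cutoff_self_adjoint[OF z])
  have saz: "self_adjoint z" by (rule psd_self_adjoint[OF z])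
  \<comment> \<open>With v = R x one has x = v + z v, and the cutoff sends x to z v.\<close>
  have form: "blinfun_apply (cutoff z) x \<bullet> x =
      blinfun_apply z (blinfun_apply R x) \<bullet> blinfun_apply R x + (norm (blinfun_apply z (blinfun_apply R x)))\<^sup>2" for x
  proof -
    let ?v = "blinfun_apply R x"
    have "blinfun_apply (cutoff z) x = blinfun_apply z ?v"
      using resolvent_app[OF R, of x] by (simp add: cut blinfun.bilinear_simps algebra_simps)
    moreover have "blinfun_apply z ?v \<bullet> x = blinfun_apply z ?v \<bullet> (?v + blinfun_apply z ?v)"
      by (simp add: resolvent_app[OF R])
    ultimately show ?thesis by (simp add: inner_simps power2_norm_eq_inner)
  qed
  show "psd (cutoff z)"
    unfolding psd_def using sa psd_nonneg[OF z] by (simp add: form)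
  show "psd (id_blinfun - cutoff z)"
  proof (rule psd_diffI[OF sa self_adjoint_id])
    fix x
    have "0 \<le> blinfun_apply R x \<bullet> x"
      using resolvent_variational[OF z R, of x 0] by (simp add: blinfun.bilinear_simps)
    then show "blinfun_apply (cutoff z) x \<bullet> x \<le> blinfun_apply id_blinfun x \<bullet> x"
      by (simp add: cut blinfun.bilinear_simps inner_simps)
  qed
  show "psd (z - cutoff z)"
  proof (rule psd_diffI[OF sa saz])
    fix x
    show "blinfun_apply (cutoff z) x \<bullet> x \<le> blinfun_apply z x \<bullet> x"
      using resolvent_variational[OF z R, of x x]
      by (simp add: cut blinfun.bilinear_simps inner_simps)
  qed
  assume c: "psd (c *\<^sub>R id_blinfun - z)"
  show "psd ((1 + c) *\<^sub>R cutoff z - z)"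
  proof (rule psd_diffI[OF saz self_adjoint_scaleR[OF sa]])
    fix x
    let ?v = "blinfun_apply R x"
    let ?w = "blinfun_apply z ?v"
    have "blinfun_apply z x \<bullet> x = blinfun_apply z (?v + ?w) \<bullet> (?v + ?w)"
      by (simp add: resolvent_app[OF R])
    also have "\<dots> = ?w \<bullet> ?v + 2 * (norm ?w)\<^sup>2 + blinfun_apply z ?w \<bullet> ?w"
      using self_adjointD[OF saz, of ?w ?v]
      by (simp add: blinfun.bilinear_simps inner_simps power2_norm_eq_inner)
    also have "blinfun_apply z ?w \<bullet> ?w \<le> c * (norm ?w)\<^sup>2"
      using psd_diffD[OF c, of ?w] by (simp add: blinfun.bilinear_simps power2_norm_eq_inner)
    finally have "blinfun_apply z x \<bullet> x \<le> ?w \<bullet> ?v + 2 * (norm ?w)\<^sup>2 + c * (norm ?w)\<^sup>2" by simp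
    \<comment> \<open>z^2 \<le> c z at \<open>?v\<close>: this absorbs the one squared norm of
      \<open>?w\<close> that the previous estimate has in excess.\<close>
    moreover have "(norm ?w)\<^sup>2 \<le> c * (?w \<bullet> ?v)"
      by (rule psd_norm_sq_le[OF z c])
    ultimately show "blinfun_apply z x \<bullet> x \<le> blinfun_apply ((1 + c) *\<^sub>R cutoff z) x \<bullet> x"
      by (simp add: blinfun.bilinear_simps form algebra_simps)
  qed
qed

section \<open>Operators on a complex Hilbert space\<close>

lemma cbounded_opsD: "T \<in> cbounded_ops \<Longrightarrow> blinfun_apply T (c *\<^sub>C x) = c *\<^sub>C blinfun_apply T x"
  by (simp add: cbounded_ops_def)

lemma cinner_add_right: "cinner x (y + z) = cinner x y + cinner x z"
  by (metis cinner_add_left cinner_commute complex_cnj_add)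

lemma inner_scaleC_i_right: "x \<bullet> (\<i> *\<^sub>C y) = Im (cinner x y)"
  by (simp add: inner_eq_Re_cinner cinner_scaleC_right)

lemma inner_scaleC_i_left: "(\<i> *\<^sub>C x) \<bullet> y = - Im (cinner x y)"
  by (simp add: inner_eq_Re_cinner cinner_scaleC_left)

text \<open>Up to sign, the imaginary part of the complex inner product is the real inner product
  with x replaced by i x; complex linearity of \<open>T\<close> lets the factor i pass.\<close>

lemma adjoint_cinner:
  assumes T: "T \<in> cbounded_ops" and S: "\<And>x y. blinfun_apply T x \<bullet> y = x \<bullet> blinfun_apply S y"
  shows "cinner (blinfun_apply T x) y = cinner x (blinfun_apply S y)"
proof (rule complex_eqI)
  show "Re (cinner (blinfun_apply T x) y) = Re (cinner x (blinfun_apply S y))"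
    using S[of x y] by (simp add: inner_eq_Re_cinner)
  have "blinfun_apply T (\<i> *\<^sub>C x) \<bullet> y = (\<i> *\<^sub>C x) \<bullet> blinfun_apply S y"
    by (rule S)
  then show "Im (cinner (blinfun_apply T x) y) = Im (cinner x (blinfun_apply S y))"
    by (simp add: cbounded_opsD[OF T] inner_scaleC_i_left)
qed

lemma op_adj_eqI:
  assumes T: "T \<in> cbounded_ops" and S: "\<And>x y. blinfun_apply T x \<bullet> y = x \<bullet> blinfun_apply S y"
  shows "op_adj T = S"
  unfolding op_adj_def
proof (rule the_equality)
  show "\<forall>x y. cinner (blinfun_apply T x) y = cinner x (blinfun_apply S y)"
    using adjoint_cinner[OF T S] by blast
  fix R assume R: "\<forall>x y. cinner (blinfun_apply T x) y = cinner x (blinfun_apply R y)"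
  have "x \<bullet> blinfun_apply R y = x \<bullet> blinfun_apply S y" for x y
    using R S[of x y] by (simp add: inner_eq_Re_cinner)
  then show "R = S"
    by (intro blinfun_eqI vector_eq_ldot[THEN iffD1]) blast
qed

lemma op_adj_inner:
  assumes T: "T \<in> cbounded_ops"
  shows "blinfun_apply T x \<bullet> y = x \<bullet> blinfun_apply (op_adj T) y"
proof -
  obtain S where S: "\<And>x y. blinfun_apply T x \<bullet> y = x \<bullet> blinfun_apply S y"
    using adjoint_exists[of T] by blast
  with op_adj_eqI[OF T S] show ?thesis by simp
qed

lemma op_adj_inner_left:
  "T \<in> cbounded_ops \<Longrightarrow> blinfun_apply (op_adj T) x \<bullet> y = x \<bullet> blinfun_apply T y"
  by (metis inner_commute op_adj_inner)

lemma op_adj_cinner: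
  "T \<in> cbounded_ops \<Longrightarrow> cinner (blinfun_apply T x) y = cinner x (blinfun_apply (op_adj T) y)"
  by (rule adjoint_cinner[OF _ op_adj_inner])

lemma op_adj_cbounded:
  assumes T: "T \<in> cbounded_ops"
  shows "op_adj T \<in> cbounded_ops"
  unfolding cbounded_ops_def
proof (intro CollectI allI)
  fix c x
  have "y \<bullet> blinfun_apply (op_adj T) (c *\<^sub>C x) = y \<bullet> (c *\<^sub>C blinfun_apply (op_adj T) x)" for y
  proof -
    have "y \<bullet> blinfun_apply (op_adj T) (c *\<^sub>C x) = Re (cinner (blinfun_apply T y) (c *\<^sub>C x))"
      unfolding inner_eq_Re_cinner[symmetric] by (simp only: op_adj_inner[OF T])
    also have "\<dots> = Re (cinner y (c *\<^sub>C blinfun_apply (op_adj T) x))"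
      by (simp only: cinner_scaleC_right op_adj_cinner[OF T])
    finally show ?thesis by (simp only: inner_eq_Re_cinner)
  qed
  then show "blinfun_apply (op_adj T) (c *\<^sub>C x) = c *\<^sub>C blinfun_apply (op_adj T) x"
    by (rule vector_eq_ldot[THEN iffD1, OF allI])
qed

lemma op_adj_self_adjoint: "T \<in> cbounded_ops \<Longrightarrow> self_adjoint T \<longleftrightarrow> op_adj T = T"
  by (metis op_adj_eqI op_adj_inner self_adjoint_def)

lemma op_adj_op_adj: "T \<in> cbounded_ops \<Longrightarrow> op_adj (op_adj T) = T"
  by (rule op_adj_eqI[OF op_adj_cbounded op_adj_inner_left])

lemma op_adj_add:
  "S \<in> cbounded_ops \<Longrightarrow> T \<in> cbounded_ops \<Longrightarrow> op_adj (S + T) = op_adj S + op_adj T"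
  by (rule op_adj_eqI)
    (simp_all add: cbounded_ops_def scaleC_add_right blinfun.bilinear_simps inner_simps op_adj_inner)

lemma op_adj_op_scaleC:
  assumes T: "T \<in> cbounded_ops"
  shows "op_adj (op_scaleC c T) = op_scaleC (cnj c) (op_adj T)"
proof (rule op_adj_eqI)
  show "op_scaleC c T \<in> cbounded_ops"
    using T by (simp add: cbounded_ops_def op_scaleC.rep_eq scaleC_scaleC mult.commute)
  show "blinfun_apply (op_scaleC c T) x \<bullet> y = x \<bullet> blinfun_apply (op_scaleC (cnj c) (op_adj T)) y" for x y
    by (simp add: inner_eq_Re_cinner op_scaleC.rep_eq cinner_scaleC_left cinner_scaleC_right
        op_adj_cinner[OF T])
qed

lemma psd_op_adj_comp: "T \<in> cbounded_ops \<Longrightarrow> psd (op_adj T o\<^sub>L T)"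
  unfolding psd_def self_adjoint_def
  by (metis blinfun_apply_blinfun_compose inner_commute inner_ge_zero op_adj_inner)

lemma op_adj_comp_form: "T \<in> cbounded_ops \<Longrightarrow> blinfun_apply (op_adj T o\<^sub>L T) x \<bullet> x = (norm (blinfun_apply T x))\<^sup>2"
  by (simp add: op_adj_inner_left power2_norm_eq_inner)

lemma op_scaleC_of_real: "op_scaleC (complex_of_real r) a = r *\<^sub>R a"
  by (rule blinfun_eqI) (simp add: op_scaleC.rep_eq scaleC_of_real blinfun.bilinear_simps)

text \<open>Real values of <a x, x> mean that a x is orthogonal to i x for the real inner product.
  Polarising this at x + i y gives symmetry.\<close>

lemma pos_part_iff:
  fixes \<A> :: "('h::chilbert \<Rightarrow>\<^sub>L 'h) set"
  assumes "\<A> \<subseteq> cbounded_ops"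
  shows "a \<in> pos_part \<A> \<longleftrightarrow> a \<in> \<A> \<and> psd a"
proof (cases "a \<in> \<A>")
  case True
  then have a: "a \<in> cbounded_ops" using assms by blast
  have pos: "cinner (blinfun_apply a x) x \<in> \<real>\<^sub>\<ge>\<^sub>0 \<longleftrightarrow>
      0 \<le> blinfun_apply a x \<bullet> x \<and> blinfun_apply a x \<bullet> (\<i> *\<^sub>C x) = 0" for x
    by (simp add: complex_nonneg_Reals_iff inner_eq_Re_cinner[symmetric] inner_scaleC_i_right)
  have "self_adjoint a" if *: "\<And>x. blinfun_apply a x \<bullet> (\<i> *\<^sub>C x) = 0"
    unfolding self_adjoint_def
  proof (intro allI)
    fix x y :: 'h
    let ?y = "\<i> *\<^sub>C y"
    have iy: "\<i> *\<^sub>C ?y = - y"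
      using scaleC_of_real[of "-1" y] by (simp add: scaleC_scaleC)
    have "blinfun_apply a (x + ?y) \<bullet> (\<i> *\<^sub>C (x + ?y)) = 0" by (rule *)
    then have "blinfun_apply a x \<bullet> (\<i> *\<^sub>C ?y) + blinfun_apply a ?y \<bullet> (\<i> *\<^sub>C x) = 0"
      using *[of x] *[of ?y] by (simp add: scaleC_add_right blinfun.bilinear_simps inner_simps)
    moreover have "blinfun_apply a ?y \<bullet> (\<i> *\<^sub>C x) = blinfun_apply a y \<bullet> x"
      by (simp add: cbounded_opsD[OF a] inner_eq_Re_cinner cinner_scaleC_left cinner_scaleC_right)
    ultimately show "blinfun_apply a x \<bullet> y = x \<bullet> blinfun_apply a y"
      by (simp add: iy inner_commute)
  qed
  moreover have "blinfun_apply a x \<bullet> (\<i> *\<^sub>C x) = 0" if "self_adjoint a" for x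
  proof -
    have "blinfun_apply a x \<bullet> (\<i> *\<^sub>C x) = x \<bullet> (\<i> *\<^sub>C blinfun_apply a x)"
      using self_adjointD[OF that, of x "\<i> *\<^sub>C x"] by (simp add: cbounded_opsD[OF a])
    also have "\<dots> = - (blinfun_apply a x \<bullet> (\<i> *\<^sub>C x))"
      using arg_cong[OF cinner_commute[of x "blinfun_apply a x"], of Im]
      by (simp add: inner_scaleC_i_right)
    finally show ?thesis by simp
  qed
  ultimately show ?thesis
    using True by (auto simp: pos_part_def pos psd_def)
qed (simp add: pos_part_def)

lemma op_le_iff:
  assumes "a \<in> cbounded_ops" "b \<in> cbounded_ops"
  shows "op_le a b \<longleftrightarrow> psd (b - a)"
proof -
  have "- (c *\<^sub>C y) = c *\<^sub>C (- y)" for c and y :: 'a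
    using scaleC_scaleR_right[of c "-1" y] by simp
  then have "b - a \<in> cbounded_ops"
    using assms by (simp add: cbounded_ops_def blinfun.bilinear_simps)
      (metis add_uminus_conv_diff scaleC_add_right)
  then show ?thesis
    unfolding op_le_def by (simp add: pos_part_iff)
qed

text \<open>The topology is the pullback of pointwise convergence. The filter is arbitrary because
  both sequences and the product filter of double sequences occur.\<close>

lemma limitin_strong_operator_topology:
  assumes "\<And>x. ((\<lambda>n. blinfun_apply (f n) x) \<longlongrightarrow> blinfun_apply l x) F"
  shows "limitin strong_operator_topology f l F"
proof -
  have *: "limitin (product_topology (\<lambda>_. euclidean) UNIV) (\<lambda>n. blinfun_apply (f n)) (blinfun_apply l) F"
    unfolding limitin_componentwise using assms by simp
  show ?thesis
    unfolding limitin_def strong_operator_topology_topspace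
  proof (intro conjI allI impI UNIV_I)
    fix U assume U: "openin strong_operator_topology U \<and> l \<in> U"
    then obtain V where V: "open V" "U = blinfun_apply -` V"
      unfolding strong_operator_topology_def openin_pullback_topology by auto
    have "\<forall>\<^sub>F n in F. blinfun_apply (f n) \<in> V"
      by (rule limitinD[OF *]) (use U V in \<open>auto simp: euclidean_product_topology\<close>)
    then show "\<forall>\<^sub>F n in F. f n \<in> U" by (simp add: V)
  qed
qed

section \<open>Normal weights and strong convergence\<close>

locale vn_algebra =
  fixes \<A> :: "('h::chilbert \<Rightarrow>\<^sub>L 'h) set"
  assumes vN: "von_neumann_algebra \<A>"
begin

lemma alg_cbounded: "a \<in> \<A> \<Longrightarrow> a \<in> cbounded_ops"
  using vN unfolding von_neumann_algebra_def by blast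

lemma alg_id: "id_blinfun \<in> \<A>"
  using vN unfolding von_neumann_algebra_def by blast

lemma alg_add: "a \<in> \<A> \<Longrightarrow> b \<in> \<A> \<Longrightarrow> a + b \<in> \<A>"
  using vN unfolding von_neumann_algebra_def by blast

lemma alg_scaleC: "a \<in> \<A> \<Longrightarrow> op_scaleC c a \<in> \<A>"
  using vN unfolding von_neumann_algebra_def by blast

lemma alg_comp: "a \<in> \<A> \<Longrightarrow> b \<in> \<A> \<Longrightarrow> a o\<^sub>L b \<in> \<A>"
  using vN unfolding von_neumann_algebra_def by blast

lemma alg_adj: "a \<in> \<A> \<Longrightarrow> op_adj a \<in> \<A>"
  using vN unfolding von_neumann_algebra_def by blast

lemma alg_scaleR: "a \<in> \<A> \<Longrightarrow> r *\<^sub>R a \<in> \<A>"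
  using alg_scaleC[of a "complex_of_real r"] by (simp add: op_scaleC_of_real)

lemma alg_diff: "a \<in> \<A> \<Longrightarrow> b \<in> \<A> \<Longrightarrow> a - b \<in> \<A>"
  using alg_add[of a "(-1) *\<^sub>R b"] alg_scaleR[of b "-1"] by simp

lemma alg_0: "0 \<in> \<A>"
  using alg_scaleR[OF alg_id, of 0] by simp

lemma alg_sum: "(\<And>i. i \<in> I \<Longrightarrow> f i \<in> \<A>) \<Longrightarrow> sum f I \<in> \<A>"
  by (induction I rule: infinite_finite_induct) (auto intro: alg_add alg_0)

lemmas alg_intros = alg_id alg_add alg_scaleC alg_comp alg_adj alg_scaleR alg_diff alg_0 alg_sum

lemma alg_strongly_seq_closed: "strongly_seq_closed \<A>"
  unfolding strongly_seq_closed_def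
proof (intro allI impI)
  fix f :: "nat \<Rightarrow> ('h \<Rightarrow>\<^sub>L 'h)" and l
  assume f: "\<forall>n. f n \<in> \<A>" and l: "\<forall>x. (\<lambda>n. blinfun_apply (f n) x) \<longlonglongrightarrow> blinfun_apply l x"
  have "limitin strong_operator_topology f l sequentially"
    using l by (intro limitin_strong_operator_topology) blast
  then show "l \<in> \<A>"
    using vN f unfolding von_neumann_algebra_def
    by (intro limitin_closedin[of strong_operator_topology f l sequentially \<A>]) auto
qed

lemma alg_strong_limit:
  "(\<And>n. f n \<in> \<A>) \<Longrightarrow> (\<And>x. (\<lambda>n. blinfun_apply (f n) x) \<longlonglongrightarrow> blinfun_apply l x) \<Longrightarrow> l \<in> \<A>"
  using alg_strongly_seq_closed unfolding strongly_seq_closed_def by blast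

lemma pos_alg_iff: "a \<in> pos_part \<A> \<longleftrightarrow> a \<in> \<A> \<and> psd a"
  by (rule pos_part_iff) (auto intro: alg_cbounded)

lemma cutoff_alg: "z \<in> \<A> \<Longrightarrow> psd z \<Longrightarrow> cutoff z \<in> \<A>"
  by (rule resolvent_exists[of z \<A>])
    (auto intro: alg_intros alg_strongly_seq_closed simp: cutoff_resolvent)

end

text \<open>Iterate |a + b|^2 \<le> 2 |a|^2 + 2 |b|^2, splitting off the first term each time. It
  bounds the square of a telescoping sum of operators by a sum of squares whose weights do not
  depend on \<open>N\<close>.\<close>

lemma norm_sum_weighted:
  fixes v :: "nat \<Rightarrow> 'a::real_inner"
  shows "(norm (\<Sum>j<N. v j))\<^sup>2 \<le> (\<Sum>j<N. 2 ^ (j + 1) * (norm (v j))\<^sup>2)"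
proof (induction N arbitrary: v)
  case (Suc N)
  have two: "(norm (a + b))\<^sup>2 \<le> 2 * (norm a)\<^sup>2 + 2 * (norm b)\<^sup>2" for a b :: 'a
    using zero_le_power2[of "norm (a - b)"]
    by (simp only: power2_norm_eq_inner) (simp add: inner_simps inner_commute)
  have "(norm (\<Sum>j<Suc N. v j))\<^sup>2 \<le> 2 * (norm (v 0))\<^sup>2 + 2 * (norm (\<Sum>j<N. v (Suc j)))\<^sup>2"
    unfolding sum.lessThan_Suc_shift by (rule two)
  also have "\<dots> \<le> 2 * (norm (v 0))\<^sup>2 + 2 * (\<Sum>j<N. 2 ^ (j + 1) * (norm (v (Suc j)))\<^sup>2)"
    using Suc[of "\<lambda>j. v (Suc j)"] by linarith
  also have "\<dots> = (\<Sum>j<Suc N. 2 ^ (j + 1) * (norm (v j))\<^sup>2)"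
    unfolding sum.lessThan_Suc_shift by (simp add: sum_distrib_left mult.assoc)
  finally show ?case .
qed simp

section \<open>Consequences of normality and faithfulness of a weight\<close>

locale vn_weight = vn_algebra \<A> for \<A> :: "('h::chilbert \<Rightarrow>\<^sub>L 'h) set" +
  fixes \<phi> :: "('h \<Rightarrow>\<^sub>L 'h) \<Rightarrow> ennreal"
  assumes weight: "weight_on \<A> \<phi>" and faithful: "faithful_weight \<A> \<phi>"
    and normal: "normal_weight \<A> \<phi>"
begin

lemma weight_add: "a \<in> \<A> \<Longrightarrow> psd a \<Longrightarrow> b \<in> \<A> \<Longrightarrow> psd b \<Longrightarrow> \<phi> (a + b) = \<phi> a + \<phi> b"
  using weight unfolding weight_on_def by (meson pos_alg_iff)

lemma weight_scaleR: "a \<in> \<A> \<Longrightarrow> psd a \<Longrightarrow> 0 \<le> r \<Longrightarrow> \<phi> (r *\<^sub>R a) = ennreal r * \<phi> a"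
  using weight unfolding weight_on_def by (meson pos_alg_iff)

lemma weight_0: "\<phi> 0 = 0"
  using weight_scaleR[OF alg_0 psd_0, of 0] by simp

lemma weight_mono: "a \<in> \<A> \<Longrightarrow> psd a \<Longrightarrow> b \<in> \<A> \<Longrightarrow> psd (b - a) \<Longrightarrow> \<phi> a \<le> \<phi> b"
  using weight_add[of a "b - a"] alg_diff[of b a] by (simp add: add_increasing2)

lemma weight_sum:
  "(\<And>i. i \<in> I \<Longrightarrow> f i \<in> \<A>) \<Longrightarrow> (\<And>i. i \<in> I \<Longrightarrow> psd (f i)) \<Longrightarrow> \<phi> (sum f I) = (\<Sum>i\<in>I. \<phi> (f i))"
  by (induction I rule: infinite_finite_induct) (auto simp: weight_0 weight_add alg_sum psd_sum)

text \<open>The strong limit of an increasing sequence is the supremum of its range, so normality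
  applies to it.\<close>

lemma weight_strong_limit_le:
  assumes a: "\<And>n. a n \<in> \<A>" "\<And>n. psd (a n)" "\<And>m n. m \<le> n \<Longrightarrow> psd (a n - a m)"
    and s: "\<And>x. (\<lambda>n. blinfun_apply (a n) x) \<longlonglongrightarrow> blinfun_apply s x" "\<And>n. psd (s - a n)"
    and d: "\<And>n. \<phi> (a n) \<le> \<delta>"
  shows "\<phi> s \<le> \<delta>"
proof -
  have sA: "s \<in> \<A>" by (rule alg_strong_limit[OF a(1) s(1)])
  have "op_directed (range (a :: nat \<Rightarrow> 'h \<Rightarrow>\<^sub>L 'h))"
    unfolding op_directed_def
  proof (intro conjI ballI)
    fix u v assume "u \<in> range a" "v \<in> range a"
    then obtain m n where "u = a m" "v = a n" by blast
    then show "\<exists>c\<in>range a. op_le u c \<and> op_le v c"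
      by (intro bexI[of _ "a (max m n)"]) (auto simp: op_le_iff alg_cbounded a)
  qed simp
  moreover have "is_supremum_in \<A> (range a) s"
    unfolding is_supremum_in_def
  proof (intro conjI ballI impI)
    show "s \<in> pos_part \<A>"
      using sA psd_strong_limit[OF a(2) s(1)] by (simp add: pos_alg_iff)
    show "op_le d s" if "d \<in> range a" for d
      using that s(2) a(1) sA by (auto simp: op_le_iff alg_cbounded)
    fix u assume u: "u \<in> pos_part \<A>" "\<forall>d\<in>range a. op_le d u"
    then have uA: "u \<in> \<A>" by (simp add: pos_alg_iff)
    have "psd (u - s)"
    proof (rule psd_strong_limit)
      show "psd (u - a n)" for n
        using u(2) a(1) uA by (auto simp: op_le_iff alg_cbounded)
      show "(\<lambda>n. blinfun_apply (u - a n) x) \<longlonglongrightarrow> blinfun_apply (u - s) x" for x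
        unfolding blinfun.bilinear_simps by (intro tendsto_intros s)
    qed
    then show "op_le s u" using uA sA by (simp add: op_le_iff alg_cbounded)
  qed
  moreover have "range a \<subseteq> pos_part \<A>" using a by (auto simp: pos_alg_iff)
  ultimately have "\<phi> s = (SUP d\<in>range a. \<phi> d)"
    using normal unfolding normal_weight_def by blast
  also have "\<dots> \<le> \<delta>" using d by (auto intro: SUP_least)
  finally show ?thesis .
qed

text \<open>\<open>G\<close> is the supremum of the cutoffs of the partial sums: the partial sums themselves may be unbounded,
  so that normality of the weight does not apply to them.\<close>

lemma envelope_exists:
  fixes y :: "nat \<Rightarrow> ('h \<Rightarrow>\<^sub>L 'h)"
  assumes y: "\<And>j. y j \<in> \<A>" "\<And>j. psd (y j)"
  obtains G where "G \<in> \<A>" "psd G" "psd (id_blinfun - G)"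
    "\<And>N. psd (G - cutoff (\<Sum>j<N. y j))"
    "\<And>u. (\<And>N. psd (u - cutoff (\<Sum>j<N. y j))) \<Longrightarrow> psd (u - G)"
    "\<And>\<delta>. (\<And>N. (\<Sum>j<N. \<phi> (y j)) \<le> \<delta>) \<Longrightarrow> \<phi> G \<le> \<delta>"
proof -
  define z where "z N = (\<Sum>j<N. y j)" for N :: nat
  have z: "z N \<in> \<A>" "psd (z N)" for N
    unfolding z_def by (auto intro: alg_sum psd_sum y)
  have z_mono: "psd (z n - z m)" if "m \<le> n" for m n
  proof -
    have "z n - z m = (\<Sum>j\<in>{..<n} - {..<m}. y j)"
      unfolding z_def using that by (subst sum_diff) auto
    then show ?thesis by (simp add: psd_sum y)
  qed
  let ?a = "\<lambda>N. cutoff (z N)"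
  have a: "?a N \<in> \<A>" "psd (?a N)" "psd (1 *\<^sub>R id_blinfun - ?a N)" "psd (z N - ?a N)" for N
    using z cutoff_bounds[OF z(2)] by (auto intro: cutoff_alg)
  have a_mono: "psd (?a n - ?a m)" if "m \<le> n" for m n
    by (intro cutoff_mono z z_mono that)
  obtain G where G: "psd G" "\<And>x. (\<lambda>n. blinfun_apply (?a n) x) \<longlonglongrightarrow> blinfun_apply G x"
    "\<And>n. psd (G - ?a n)"
    by (rule increasing_bounded_strong_limit[of ?a 1]) (use a a_mono in auto)
  have GA: "G \<in> \<A>" by (rule alg_strong_limit[OF a(1) G(2)])
  have least: "psd (u - G)" if "\<And>N. psd (u - ?a N)" for u
  proof (rule psd_strong_limit[OF that])
    show "(\<lambda>n. blinfun_apply (u - ?a n) x) \<longlonglongrightarrow> blinfun_apply (u - G) x" for x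
      unfolding blinfun.bilinear_simps by (intro tendsto_intros G)
  qed
  show thesis
  proof (rule that[OF GA G(1)])
    show "psd (id_blinfun - G)" using least[of id_blinfun] a(3) by simp
    show "psd (G - cutoff (\<Sum>j<N. y j))" for N
      using G(3)[of N] by (simp add: z_def)
    show "psd (u - G)" if "\<And>N. psd (u - cutoff (\<Sum>j<N. y j))" for u
      using least[of u] that by (simp add: z_def)
    fix \<delta> assume d: "\<And>N. (\<Sum>j<N. \<phi> (y j)) \<le> \<delta>"
    show "\<phi> G \<le> \<delta>"
    proof (rule weight_strong_limit_le[OF a(1,2) a_mono G(2,3)])
      fix N
      have "\<phi> (?a N) \<le> \<phi> (z N)" by (intro weight_mono a z)
      also have "\<dots> = (\<Sum>j<N. \<phi> (y j))" unfolding z_def by (intro weight_sum y)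
      finally show "\<phi> (?a N) \<le> \<delta>" using d order_trans by blast
    qed
  qed
qed

text \<open>Chain: w \<le> (1 + c) \<open>cutoff w\<close>, and \<open>cutoff w\<close> lies below
  the cutoff of the partial sum, hence below \<open>G\<close>. So an envelope built from cutoffs
  still controls every bounded operator below a partial sum.\<close>

lemma envelope_dominates:
  fixes y :: "nat \<Rightarrow> ('h \<Rightarrow>\<^sub>L 'h)"
  assumes "\<And>j. psd (y j)" "psd (G - cutoff (\<Sum>j<N. y j))"
    and w: "psd w" "psd (c *\<^sub>R id_blinfun - w)" "psd ((\<Sum>j<N. y j) - w)" and c: "0 \<le> c"
  shows "psd ((1 + c) *\<^sub>R G - w)"
proof -
  have "psd (cutoff (\<Sum>j<N. y j) - cutoff w)"
    by (rule cutoff_mono) (simp_all add: w psd_sum assms)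
  then have "psd (G - cutoff w)"
    using assms(2) by (rule psd_diff_trans)
  then have "psd ((1 + c) *\<^sub>R (G - cutoff w))"
    using c by (intro psd_scaleR) auto
  then show ?thesis
    using psd_diff_trans[OF cutoff_bounds(4)[OF w(1,2)], of "(1 + c) *\<^sub>R G"]
    by (simp add: scaleR_diff_right)
qed

text \<open>Faithfulness gives no rate, so \<delta> depends on x and comes from a contradiction:
  counterexamples \<open>y n\<close> would exist with summable weights.\<close>

lemma weight_small_imp_strongly_small:
  assumes "0 < \<epsilon>" "0 \<le> C"
  obtains \<delta> :: real where "0 < \<delta>"
    "\<And>y. y \<in> \<A> \<Longrightarrow> norm y \<le> C \<Longrightarrow> \<phi> (op_adj y o\<^sub>L y) \<le> ennreal \<delta> \<Longrightarrow> norm (blinfun_apply y x) < \<epsilon>"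
proof (rule ccontr)
  assume "\<not> thesis"
  with that have "\<exists>y\<in>\<A>. norm y \<le> C \<and> \<phi> (op_adj y o\<^sub>L y) \<le> ennreal \<delta> \<and> \<epsilon> \<le> norm (blinfun_apply y x)"
    if "0 < \<delta>" for \<delta>
    using \<open>0 < \<delta>\<close> by (meson not_le)
  then have "\<exists>y\<in>\<A>. norm y \<le> C \<and> \<phi> (op_adj y o\<^sub>L y) \<le> ennreal ((1/2) ^ n) \<and> \<epsilon> \<le> norm (blinfun_apply y x)" for n :: nat
    by simp
  then obtain y where y: "\<And>n. y n \<in> \<A>" "\<And>n. norm (y n) \<le> C"
      "\<And>n. \<phi> (op_adj (y n) o\<^sub>L y n) \<le> ennreal ((1/2) ^ n)" "\<And>n. \<epsilon> \<le> norm (blinfun_apply (y n) x)"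
    by metis
  define W where "W n = op_adj (y n) o\<^sub>L y n" for n
  have W: "W n \<in> \<A>" "psd (W n)" for n
    unfolding W_def by (auto intro: alg_intros y psd_op_adj_comp alg_cbounded)
  have W_bound: "psd (C\<^sup>2 *\<^sub>R id_blinfun - W n)" for n
  proof (rule psd_diffI)
    fix v
    have "norm (blinfun_apply (y n) v) \<le> C * norm v"
      using norm_blinfun[of "y n" v] mult_right_mono[OF y(2) norm_ge_zero[of v]] order_trans by blast
    then have "(norm (blinfun_apply (y n) v))\<^sup>2 \<le> (C * norm v)\<^sup>2"
      by (intro power_mono) auto
    then show "blinfun_apply (W n) v \<bullet> v \<le> blinfun_apply (C\<^sup>2 *\<^sub>R id_blinfun) v \<bullet> v"
      by (simp add: W_def op_adj_inner_left alg_cbounded y power_mult_distrib power2_norm_eq_inner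
          blinfun.bilinear_simps)
  qed (auto intro: self_adjoint_scaleR psd_self_adjoint W)
  \<comment> \<open>\<open>G\<close> is the least envelope of the tail that starts at m, and 2
    (1/2)^m bounds the total weight of that tail.\<close>
  define env where "env m G \<longleftrightarrow> G \<in> \<A> \<and> psd G \<and> psd (id_blinfun - G) \<and>
    (\<forall>N. psd (G - cutoff (\<Sum>j<N. W (m + j)))) \<and>
    (\<forall>u. (\<forall>N. psd (u - cutoff (\<Sum>j<N. W (m + j)))) \<longrightarrow> psd (u - G)) \<and>
    \<phi> G \<le> ennreal (2 * (1/2) ^ m)" for m G
  have "\<exists>G. env m G" for m
  proof -
    obtain G where G: "G \<in> \<A>" "psd G" "psd (id_blinfun - G)"
      "\<And>N. psd (G - cutoff (\<Sum>j<N. W (m + j)))"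
      "\<And>u. (\<And>N. psd (u - cutoff (\<Sum>j<N. W (m + j)))) \<Longrightarrow> psd (u - G)"
      "\<And>\<delta>. (\<And>N. (\<Sum>j<N. \<phi> (W (m + j))) \<le> \<delta>) \<Longrightarrow> \<phi> G \<le> \<delta>"
      by (rule envelope_exists[of "\<lambda>j. W (m + j)"]) (use W in auto)
    have "(\<Sum>j<N. \<phi> (W (m + j))) \<le> ennreal (2 * (1/2) ^ m)" for N
    proof -
      have "(\<Sum>j<N. \<phi> (W (m + j))) \<le> (\<Sum>j<N. ennreal ((1/2) ^ (m + j)))"
        unfolding W_def by (intro sum_mono y)
      also have "\<dots> = ennreal (\<Sum>j<N. (1/2) ^ (m + j))" by (rule sum_ennreal) simp
      also have "(\<Sum>j<N. (1/2) ^ (m + j)) = (1/2) ^ m * (\<Sum>j<N. (1/2 :: real) ^ j)"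
        by (simp add: power_add sum_distrib_left)
      also have "(\<Sum>j<N. (1/2 :: real) ^ j) = 2 - 2 * (1/2) ^ N"
        by (subst sum_gp_strict) (simp add: field_simps)
      also have "ennreal ((1/2) ^ m * (2 - 2 * (1/2) ^ N)) \<le> ennreal (2 * (1/2) ^ m)"
        by (intro ennreal_leI) (simp add: algebra_simps)
      finally show ?thesis .
    qed
    then have "\<phi> G \<le> ennreal (2 * (1/2) ^ m)" by (rule G(6))
    with G show ?thesis unfolding env_def by blast
  qed
  then obtain G where "\<And>m. env m (G m)" by metis
  then have G: "G m \<in> \<A>" "psd (G m)" "psd (id_blinfun - G m)"
      "psd (G m - cutoff (\<Sum>j<N. W (m + j)))"
      "\<And>u. (\<And>N. psd (u - cutoff (\<Sum>j<N. W (m + j)))) \<Longrightarrow> psd (u - G m)"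
      "\<phi> (G m) \<le> ennreal (2 * (1/2) ^ m)" for m N
    unfolding env_def by blast+
  have G_step: "psd (G m - G (Suc m))" for m
  proof (rule G(5))
    fix N
    \<comment> \<open>\<open>N\<close> terms of the tail from m + 1, preceded by the term at m, are
      N + 1 terms of the tail from m.\<close>
    have "psd (cutoff (\<Sum>j<Suc N. W (m + j)) - cutoff (\<Sum>j<N. W (Suc m + j)))"
      by (rule cutoff_mono)
        (simp_all add: psd_sum psd_add W sum.lessThan_Suc_shift del: sum.lessThan_Suc)
    then show "psd (G m - cutoff (\<Sum>j<N. W (Suc m + j)))"
      using G(4) by (rule psd_diff_trans)
  qed
  have G_anti: "psd (G m - G n)" if "m \<le> n" for m n
    using that by (induction rule: dec_induct) (auto intro: psd_diff_trans G_step)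
  \<comment> \<open>The limit theorem concerns increasing sequences, hence the passage to
    \<open>G 0 - G n\<close>.\<close>
  obtain s where s: "\<And>v. (\<lambda>n. blinfun_apply (G 0 - G n) v) \<longlonglongrightarrow> blinfun_apply s v"
    "\<And>n. psd (s - (G 0 - G n))"
  proof (rule increasing_bounded_strong_limit[of "\<lambda>n. G 0 - G n" 1])
    show "psd (G 0 - G n)" for n by (rule G_anti) simp
    show "psd ((G 0 - G n) - (G 0 - G m))" if "m \<le> n" for m n
      using G_anti[OF that] by simp
    show "psd (1 *\<^sub>R id_blinfun - (G 0 - G n))" for n
      using psd_add[OF G(3)[of 0] G(2)[of n]] by (simp add: algebra_simps)
  qed (auto intro: that)
  define g where "g = G 0 - s"
  have Gg: "(\<lambda>n. blinfun_apply (G n) v) \<longlonglongrightarrow> blinfun_apply g v" for v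
    using tendsto_diff[OF tendsto_const s(1), of "blinfun_apply (G 0) v" v]
    by (simp add: g_def blinfun.bilinear_simps)
  have g: "g \<in> \<A>" "psd g"
    by (rule alg_strong_limit[OF G(1) Gg]) (rule psd_strong_limit[OF G(2) Gg])
  \<comment> \<open>The infimum \<open>g\<close> lies below every \<open>G m\<close>, so
    monotonicity of the weight is enough along this decreasing sequence.\<close>
  have "\<phi> g \<le> ennreal (2 * (1/2) ^ m)" for m
  proof -
    have "psd (G m - g)" using s(2)[of m] by (simp add: g_def algebra_simps)
    then have "\<phi> g \<le> \<phi> (G m)" using g G(1) by (intro weight_mono) auto
    then show ?thesis using G(6) order_trans by blast
  qed
  moreover have "(\<lambda>m. ennreal (2 * (1/2) ^ m)) \<longlonglongrightarrow> ennreal (2 * 0)"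
    by (intro tendsto_ennrealI tendsto_mult tendsto_const LIMSEQ_realpow_zero) auto
  ultimately have "\<phi> g \<le> ennreal (2 * 0)"
    by (intro LIMSEQ_le_const) auto
  then have "g = 0"
    using faithful g unfolding faithful_weight_def by (simp add: pos_alg_iff)
  then have "(\<lambda>n. (1 + C\<^sup>2) * (blinfun_apply (G n) x \<bullet> x)) \<longlonglongrightarrow> (1 + C\<^sup>2) * (blinfun_apply 0 x \<bullet> x)"
    using Gg[of x] by (intro tendsto_mult tendsto_inner tendsto_const) simp
  moreover have "\<epsilon>\<^sup>2 \<le> (1 + C\<^sup>2) * (blinfun_apply (G n) x \<bullet> x)" for n
  proof -
    \<comment> \<open>Domination with the one-term partial sum, which is \<open>W n\<close>
      itself.\<close>
    have "psd ((1 + C\<^sup>2) *\<^sub>R G n - W n)"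
      by (rule envelope_dominates[where y = "\<lambda>j. W (n + j)" and N = 1])
        (use W W_bound G(4)[of n 1] in auto)
    then have "blinfun_apply (W n) x \<bullet> x \<le> (1 + C\<^sup>2) * (blinfun_apply (G n) x \<bullet> x)"
      using psd_diffD by (fastforce simp: blinfun.bilinear_simps)
    moreover have "\<epsilon>\<^sup>2 \<le> (norm (blinfun_apply (y n) x))\<^sup>2"
      using y(4) assms(1) by (intro power_mono) auto
    ultimately show ?thesis
      unfolding W_def by (simp add: op_adj_comp_form[simplified] alg_cbounded y op_adj_inner_left power2_norm_eq_inner)
  qed
  ultimately have "\<epsilon>\<^sup>2 \<le> (1 + C\<^sup>2) * (blinfun_apply 0 x \<bullet> x)"
    by (intro LIMSEQ_le_const) auto
  then show False using assms(1) by simp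
qed

text \<open>A completeness statement, by which limit vectors are later recognised as images of
  operators. Strong convergence follows from the preceding lemma; for the weights,
  \<open>l - y k\<close> is treated as a telescoping series along a fast subsequence.\<close>

lemma weight_Cauchy_limit:
  assumes y: "\<And>k. y k \<in> \<A>" "\<And>k. self_adjoint (y k)" "\<And>k. norm (y k) \<le> C"
    and cauchy: "\<And>\<delta>::real. 0 < \<delta> \<Longrightarrow> \<exists>N. \<forall>m\<ge>N. \<forall>n\<ge>N. \<phi> ((y m - y n) o\<^sub>L (y m - y n)) \<le> ennreal \<delta>"
  obtains l where "l \<in> \<A>" "self_adjoint l" "norm l \<le> C"
    "\<And>x. (\<lambda>k. blinfun_apply (y k) x) \<longlonglongrightarrow> blinfun_apply l x"
    "\<And>\<delta>::real. 0 < \<delta> \<Longrightarrow> \<exists>N. \<forall>k\<ge>N. \<phi> ((l - y k) o\<^sub>L (l - y k)) \<le> ennreal \<delta>"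
proof -
  have C: "0 \<le> C" using y(3)[of 0] norm_ge_zero order_trans by blast
  have sd: "self_adjoint (y m - y n)" for m n by (intro self_adjoint_diff y)
  have norm_d: "norm (y m - y n) \<le> 2 * C" for m n
    using norm_triangle_ineq4[of "y m" "y n"] y(3)[of m] y(3)[of n] by linarith
  have "convergent (\<lambda>k. blinfun_apply (y k) x)" for x
  proof (rule Cauchy_convergent, unfold Cauchy_iff, intro allI impI)
    fix \<epsilon> :: real assume "0 < \<epsilon>"
    then obtain \<delta> :: real where d: "0 < \<delta>"
      "\<And>z. z \<in> \<A> \<Longrightarrow> norm z \<le> 2 * C \<Longrightarrow> \<phi> (op_adj z o\<^sub>L z) \<le> ennreal \<delta> \<Longrightarrow> norm (blinfun_apply z x) < \<epsilon>"
      using weight_small_imp_strongly_small[of \<epsilon> "2 * C" x] C by auto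
    obtain N where N: "\<And>m n. m \<ge> N \<Longrightarrow> n \<ge> N \<Longrightarrow> \<phi> ((y m - y n) o\<^sub>L (y m - y n)) \<le> ennreal \<delta>"
      using cauchy[OF d(1)] by blast
    have "norm (blinfun_apply (y m - y n) x) < \<epsilon>" if "m \<ge> N" "n \<ge> N" for m n
    proof (rule d(2))
      have "op_adj (y m - y n) = y m - y n"
        using sd op_adj_self_adjoint alg_cbounded alg_diff y(1) by metis
      then show "\<phi> (op_adj (y m - y n) o\<^sub>L (y m - y n)) \<le> ennreal \<delta>"
        using N[OF that] by simp
    qed (auto intro: alg_diff y norm_d)
    then show "\<exists>M. \<forall>m\<ge>M. \<forall>n\<ge>M. norm (blinfun_apply (y m) x - blinfun_apply (y n) x) < \<epsilon>"
      by (auto simp: blinfun.bilinear_simps)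
  qed
  then obtain l where l: "\<And>x. (\<lambda>k. blinfun_apply (y k) x) \<longlonglongrightarrow> blinfun_apply l x" "norm l \<le> C"
    using strong_limit_exists y(3) by metis
  have lA: "l \<in> \<A>" by (rule alg_strong_limit[OF y(1) l(1)])
  have ls: "self_adjoint l" by (rule self_adjoint_strong_limit[OF y(2) l(1)])
  have conv: "\<exists>N. \<forall>k\<ge>N. \<phi> ((l - y k) o\<^sub>L (l - y k)) \<le> ennreal \<delta>" if \<delta>: "0 < \<delta>" for \<delta> :: real
  proof -
    \<comment> \<open>Differences of the \<open>y k\<close> have norm at most 2 C, so their squares
      are bounded by \<open>c\<close>.\<close>
    define c where "c = (2 * C)\<^sup>2"
    have c: "0 \<le> c" by (simp add: c_def)
    \<comment> \<open>The envelope below has weight at most 4 \<eta> and enters with the factor 1 +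
      c.\<close>
    define \<eta> where "\<eta> = \<delta> / (4 * (1 + c))"
    have \<eta>: "0 < \<eta>" using \<delta> c by (simp add: \<eta>_def)
    \<comment> \<open>The rate (1/8)^j beats the factors 2^(j + 1) of
      \<open>norm_sum_weighted\<close>: their product 2 (1/4)^j is summable.\<close>
    have "\<exists>N. \<forall>m\<ge>N. \<forall>n\<ge>N. \<phi> ((y m - y n) o\<^sub>L (y m - y n)) \<le> ennreal (\<eta> * (1/8) ^ j)" for j :: nat
      using \<eta> by (intro cauchy) simp
    then obtain N where N: "\<And>j m n. m \<ge> N j \<Longrightarrow> n \<ge> N j \<Longrightarrow>
        \<phi> ((y m - y n) o\<^sub>L (y m - y n)) \<le> ennreal (\<eta> * (1/8) ^ j)"
      by metis
    \<comment> \<open>\<open>M j\<close> is at least \<open>N j\<close> and at least the preceding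
      threshold; the summand j makes it tend to infinity.\<close>
    define M where "M j = j + (\<Sum>i\<le>j. N i)" for j
    have M: "N j \<le> M j" "N j \<le> M (Suc j)" "j \<le> M j" for j
      by (auto simp: M_def member_le_sum trans_le_add2 intro: order_trans[OF member_le_sum[of j "{..j}" N]])
    have "\<phi> ((l - y k) o\<^sub>L (l - y k)) \<le> ennreal \<delta>" if k: "k \<ge> N 0" for k
    proof -
      \<comment> \<open>The telescoping sum starts at \<open>y k\<close> itself and only then
        follows the fast subsequence.\<close>
      define u where "u j = y (if j = 0 then k else M j)" for j
      define d where "d j = u (Suc j) - u j" for j
      define Y where "Y j = 2 ^ (j + 1) *\<^sub>R (d j o\<^sub>L d j)" for j
      have d: "d j \<in> \<A>" "self_adjoint (d j)" for j
        unfolding d_def u_def by (auto intro: alg_diff self_adjoint_diff y)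
      have Y: "Y j \<in> \<A>" "psd (Y j)" for j
        unfolding Y_def by (intro alg_intros d) (intro psd_scaleR psd_square d, simp)
      have d_weight: "\<phi> (d j o\<^sub>L d j) \<le> ennreal (\<eta> * (1/8) ^ j)" for j
        unfolding d_def u_def using k M by (intro N) (auto split: if_splits)
      have Y_weight: "\<phi> (Y j) \<le> ennreal (2 * \<eta> * (1/4) ^ j)" for j
      proof -
        have "\<phi> (Y j) = ennreal (2 ^ (j + 1)) * \<phi> (d j o\<^sub>L d j)"
          unfolding Y_def by (intro weight_scaleR alg_intros psd_square d) auto
        also have "\<dots> \<le> ennreal (2 ^ (j + 1)) * ennreal (\<eta> * (1/8) ^ j)"
          by (intro mult_left_mono d_weight) auto
        also have "\<dots> = ennreal (2 ^ (j + 1) * (\<eta> * (1/8) ^ j))"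
          using \<eta> by (subst ennreal_mult) auto
        also have "2 ^ (j + 1) * (\<eta> * (1/8) ^ j) = 2 * \<eta> * (2 * (1/8)) ^ j"
          unfolding power_mult_distrib by simp
        finally show ?thesis by simp
      qed
      obtain G where G: "G \<in> \<A>" "psd G" "\<And>n. psd (G - cutoff (\<Sum>j<n. Y j))"
        "\<And>\<delta>. (\<And>n. (\<Sum>j<n. \<phi> (Y j)) \<le> \<delta>) \<Longrightarrow> \<phi> G \<le> \<delta>"
        by (rule envelope_exists[of Y]) (use Y in auto)
      have "\<phi> G \<le> ennreal (4 * \<eta>)"
      proof (rule G(4))
        fix n
        have "(\<Sum>j<n. \<phi> (Y j)) \<le> (\<Sum>j<n. ennreal (2 * \<eta> * (1/4) ^ j))"
          by (intro sum_mono Y_weight)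
        also have "\<dots> = ennreal (\<Sum>j<n. 2 * \<eta> * (1/4) ^ j)"
          using \<eta> by (intro sum_ennreal) auto
        also have "(\<Sum>j<n. 2 * \<eta> * (1/4) ^ j) = 2 * \<eta> * (\<Sum>j<n. (1/4 :: real) ^ j)"
          by (simp add: sum_distrib_left)
        also have "(\<Sum>j<n. (1/4 :: real) ^ j) = 4/3 * (1 - (1/4) ^ n)"
          by (subst sum_gp_strict) (simp add: field_simps)
        also have "ennreal (2 * \<eta> * (4/3 * (1 - (1/4) ^ n))) \<le> ennreal (2 * \<eta> * 2)"
        proof (intro ennreal_leI mult_left_mono)
          have "4/3 * (1 - q) \<le> 2" if "0 \<le> q" for q :: real using that by simp
          from this[of "(1/4) ^ n"] show "4/3 * (1 - (1/4 :: real) ^ n) \<le> 2" by simp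
        qed (use \<eta> in auto)
        finally show "(\<Sum>j<n. \<phi> (Y j)) \<le> ennreal (4 * \<eta>)" by simp
      qed
      define w where "w n = (u n - u 0) o\<^sub>L (u n - u 0)" for n
      have su: "self_adjoint (u n - u 0)" "norm (u n - u 0) \<le> 2 * C" for n
        unfolding u_def by (rule sd, rule norm_d)
      have w_form: "blinfun_apply (w n) x \<bullet> x = (norm (blinfun_apply (u n - u 0) x))\<^sup>2" for n x
        using self_adjointD[OF su(1)] by (simp add: w_def power2_norm_eq_inner)
      have w_psd: "psd (w n)" for n unfolding w_def by (intro psd_square su)
      have "psd ((1 + c) *\<^sub>R G - w n)" for n
      proof (rule envelope_dominates[where y = Y and N = n])
        show "psd (c *\<^sub>R id_blinfun - w n)"
        proof (rule psd_diffI)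
          fix v
          have "norm (blinfun_apply (u n - u 0) v) \<le> 2 * C * norm v"
            using norm_blinfun[of "u n - u 0" v] mult_right_mono[OF su(2) norm_ge_zero[of v]] order_trans
            by blast
          then have "(norm (blinfun_apply (u n - u 0) v))\<^sup>2 \<le> (2 * C * norm v)\<^sup>2"
            by (intro power_mono) auto
          then show "blinfun_apply (w n) v \<bullet> v \<le> blinfun_apply (c *\<^sub>R id_blinfun) v \<bullet> v"
            unfolding w_form by (simp add: c_def power_mult_distrib power2_norm_eq_inner blinfun.bilinear_simps)
        qed (auto intro: psd_self_adjoint w_psd self_adjoint_scaleR)
        show "psd ((\<Sum>j<n. Y j) - w n)"
        proof (rule psd_diffI)
          fix v
          have sum_d: "u n - u 0 = (\<Sum>j<n. d j)"
            unfolding d_def by (simp add: sum_lessThan_telescope)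
          have "blinfun_apply (w n) v \<bullet> v = (norm (\<Sum>j<n. blinfun_apply (d j) v))\<^sup>2"
            unfolding w_form sum_d by (simp add: blinfun.sum_left)
          also have "\<dots> \<le> (\<Sum>j<n. 2 ^ (j + 1) * (norm (blinfun_apply (d j) v))\<^sup>2)"
            by (rule norm_sum_weighted)
          also have "\<dots> = blinfun_apply (\<Sum>j<n. Y j) v \<bullet> v"
            unfolding blinfun.sum_left inner_sum_left Y_def
            using self_adjointD[OF d(2)]
            by (intro sum.cong) (auto simp: blinfun.bilinear_simps power2_norm_eq_inner)
          finally show "blinfun_apply (w n) v \<bullet> v \<le> blinfun_apply (\<Sum>j<n. Y j) v \<bullet> v" .
        qed (auto intro: psd_self_adjoint w_psd psd_sum Y)
      qed (auto intro: Y G w_psd c)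
      moreover have "(\<lambda>n. blinfun_apply ((1 + c) *\<^sub>R G - w n) x) \<longlonglongrightarrow>
          blinfun_apply ((1 + c) *\<^sub>R G - ((l - y k) o\<^sub>L (l - y k))) x" for x
      proof -
        have uM: "(\<lambda>n. blinfun_apply (u n) v) \<longlonglongrightarrow> blinfun_apply l v" for v
        proof -
          have "filterlim M at_top sequentially"
            by (rule filterlim_at_top_mono[OF filterlim_ident]) (simp add: M)
          then have "(\<lambda>n. blinfun_apply (y (M n)) v) \<longlonglongrightarrow> blinfun_apply l v"
            using filterlim_compose[OF l(1)] by blast
          then show ?thesis
            by (rule Lim_transform_eventually)
              (auto simp: u_def eventually_sequentially intro: exI[of _ 1])
        qed
        have "(\<lambda>n. blinfun_apply (u n - u 0) (blinfun_apply (u n - u 0) x)) \<longlonglongrightarrow>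
            blinfun_apply (l - u 0) (blinfun_apply (l - u 0) x)"
        proof -
          let ?D = "\<lambda>n. u n - u 0" and ?L = "l - u 0"
          have D: "(\<lambda>n. blinfun_apply (?D n) v) \<longlonglongrightarrow> blinfun_apply ?L v" for v
            unfolding blinfun.bilinear_simps by (intro tendsto_intros uM)
          \<comment> \<open>Multiplication is strongly continuous on bounded sets: D D x = D (D x -
            L x) + D L x, and the first term is controlled by the bound 2 C.\<close>
          have "(\<lambda>n. blinfun_apply (?D n) (blinfun_apply (?D n) x - blinfun_apply ?L x)) \<longlonglongrightarrow> 0"
          proof (rule Lim_null_comparison)
            show "\<forall>\<^sub>F n in sequentially. norm (blinfun_apply (?D n) (blinfun_apply (?D n) x - blinfun_apply ?L x))
                \<le> 2 * C * norm (blinfun_apply (?D n) x - blinfun_apply ?L x)"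
              using norm_blinfun mult_right_mono[OF su(2) norm_ge_zero] order_trans
              by (intro always_eventually allI) blast
            have "(\<lambda>n. 2 * C * norm (blinfun_apply (?D n) x - blinfun_apply ?L x)) \<longlonglongrightarrow>
                2 * C * norm (blinfun_apply ?L x - blinfun_apply ?L x)"
              by (intro tendsto_intros D)
            then show "(\<lambda>n. 2 * C * norm (blinfun_apply (?D n) x - blinfun_apply ?L x)) \<longlonglongrightarrow> 0" by simp
          qed
          from tendsto_add[OF this D[of "blinfun_apply ?L x"]] show ?thesis
            by (simp add: blinfun.diff_right)
        qed
        then show ?thesis
          unfolding w_def by (simp add: u_def[of 0] blinfun.diff_left[of "(1 + c) *\<^sub>R G"] tendsto_diff)
      qed
      ultimately have le: "psd ((1 + c) *\<^sub>R G - ((l - y k) o\<^sub>L (l - y k)))"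
        by (rule psd_strong_limit)
      have "\<phi> ((l - y k) o\<^sub>L (l - y k)) \<le> \<phi> ((1 + c) *\<^sub>R G)"
        by (intro weight_mono alg_intros le psd_square self_adjoint_diff lA ls y G)
      also have "\<dots> = ennreal (1 + c) * \<phi> G"
        using c by (intro weight_scaleR G) auto
      also have "\<dots> \<le> ennreal (1 + c) * ennreal (4 * \<eta>)"
        by (intro mult_left_mono \<open>\<phi> G \<le> ennreal (4 * \<eta>)\<close>) auto
      also have "\<dots> = ennreal ((1 + c) * (4 * \<eta>))"
        using c \<eta> by (subst ennreal_mult) auto
      also have "(1 + c) * (4 * \<eta>) = \<delta>"
        using c by (simp add: \<eta>_def field_simps)
      finally show ?thesis .
    qed
    then show ?thesis by blast
  qed
  show thesis by (rule that[OF lA ls l(2,1) conv])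
qed

end

section \<open>Schwarz inequalities for positive unital maps\<close>

text \<open>Polynomial calculus in Horner form. It carries identities between real polynomials,
  which can be checked at real points, over to operators.\<close>

definition op_poly :: "real poly \<Rightarrow> ('a::real_normed_vector \<Rightarrow>\<^sub>L 'a) \<Rightarrow> ('a \<Rightarrow>\<^sub>L 'a)" where
  "op_poly p b = fold_coeffs (\<lambda>c T. c *\<^sub>R id_blinfun + (b o\<^sub>L T)) p 0"

lemma op_poly_0 [simp]: "op_poly 0 b = 0"
  by (simp add: op_poly_def)

lemma op_poly_pCons [simp]: "op_poly (pCons c p) b = c *\<^sub>R id_blinfun + (b o\<^sub>L op_poly p b)"
  by (cases "p = 0 \<and> c = 0") (auto simp: op_poly_def)

lemma op_poly_add: "op_poly (p + q) b = op_poly p b + op_poly q b"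
  by (induction p q rule: poly_induct2) (auto intro!: blinfun_eqI simp: blinfun.bilinear_simps algebra_simps)

lemma op_poly_smult: "op_poly (smult r p) b = r *\<^sub>R op_poly p b"
  by (induction p) (auto intro!: blinfun_eqI simp: blinfun.bilinear_simps algebra_simps)

lemma op_poly_mult: "op_poly (p * q) b = op_poly p b o\<^sub>L op_poly q b"
  by (induction p)
    (auto intro!: blinfun_eqI simp: op_poly_add op_poly_smult blinfun.bilinear_simps)

lemma op_poly_sum: "op_poly (sum f I) b = (\<Sum>i\<in>I. op_poly (f i) b)"
  by (induction I rule: infinite_finite_induct) (auto simp: op_poly_add)

lemma op_poly_commute: "b o\<^sub>L op_poly p b = op_poly p b o\<^sub>L b"
proof (induction p)
  case (pCons c p)
  have "blinfun_apply b (blinfun_apply (op_poly p b) x) = blinfun_apply (op_poly p b) (blinfun_apply b x)" for x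
    using arg_cong[OF pCons.IH, of "\<lambda>T. blinfun_apply T x"] by simp
  then show ?case
    by (auto intro!: blinfun_eqI simp: blinfun.bilinear_simps)
qed simp

lemma op_poly_self_adjoint:
  assumes b: "self_adjoint b"
  shows "self_adjoint (op_poly p b)"
proof (induction p)
  case (pCons c p)
  have "blinfun_apply b (blinfun_apply (op_poly p b) x) = blinfun_apply (op_poly p b) (blinfun_apply b x)" for x
    using arg_cong[OF op_poly_commute, of "\<lambda>T. blinfun_apply T x"] by simp
  then have "self_adjoint (b o\<^sub>L op_poly p b)"
    using b pCons.IH by (simp add: self_adjoint_def)
  then show ?case
    by (simp add: self_adjoint_add self_adjoint_scaleR)
qed simp

lemma (in vn_algebra) op_poly_alg: "b \<in> \<A> \<Longrightarrow> op_poly p b \<in> \<A>"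
  by (induction p) (auto intro: alg_intros)

text \<open>This needs no spectral theorem: even powers are split off as a sandwich by
  \<open>q\<close>, which reduces the claim to 1, b, 1 - b and b (1 - b).\<close>

lemma op_poly_Bernstein_psd:
  assumes b: "psd b" "psd (id_blinfun - b)"
  shows "psd (op_poly ([:0, 1:] ^ i * [:1, -1:] ^ j) b)"
proof -
  define X Y :: "real poly" where "X = [:0, 1:]" and "Y = [:1, -1:]"
  define q where "q = X ^ (i div 2) * Y ^ (j div 2)"
  define m where "m = X ^ (i mod 2) * Y ^ (j mod 2)"
  have half: "z ^ k = z ^ (k div 2) * z ^ (k mod 2) * z ^ (k div 2)" for z :: "real poly" and k
  proof -
    have "k = k div 2 + k mod 2 + k div 2" by presburger
    then show ?thesis by (metis power_add)
  qed
  have "X ^ i * Y ^ j = q * m * q"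
    unfolding q_def m_def by (subst half[of X i], subst half[of Y j]) (simp add: mult_ac)
  then have "op_poly (X ^ i * Y ^ j) b = op_poly q b o\<^sub>L op_poly m b o\<^sub>L op_poly q b"
    by (simp add: op_poly_mult)
  moreover have "psd (op_poly m b)"
  proof -
    have X: "op_poly X b = b" and Y: "op_poly Y b = id_blinfun - b"
      by (auto simp: X_def Y_def intro!: blinfun_eqI simp: blinfun.bilinear_simps)
    \<comment> \<open>As b and 1 - b add up to 1, their product is a sum of two sandwiches.\<close>
    have "op_poly (X * Y) b = (b o\<^sub>L (id_blinfun - b) o\<^sub>L b) + ((id_blinfun - b) o\<^sub>L b o\<^sub>L (id_blinfun - b))"
      unfolding op_poly_mult X Y by (auto intro!: blinfun_eqI simp: blinfun.bilinear_simps)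
    then have "psd (op_poly (X * Y) b)"
      using b by (simp add: psd_add psd_sandwich psd_self_adjoint)
    moreover have "op_poly 1 b = id_blinfun"
      by (auto simp: one_pCons intro!: blinfun_eqI simp: blinfun.bilinear_simps)
    moreover have "m = 1 \<or> m = X \<or> m = Y \<or> m = X * Y"
      unfolding m_def by (cases "even i"; cases "even j") (auto simp: odd_iff_mod_2_eq_one even_iff_mod_2_eq_zero)
    ultimately show ?thesis using X Y b by auto
  qed
  ultimately show ?thesis
    using psd_sandwich[OF op_poly_self_adjoint[OF psd_self_adjoint[OF b(1)]]]
    unfolding X_def Y_def by metis
qed

definition Bernstein_poly :: "nat \<Rightarrow> nat \<Rightarrow> real poly" where
  "Bernstein_poly n k = smult (of_nat (n choose k)) ([:0, 1:] ^ k * [:1, -1:] ^ (n - k))"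

lemma poly_Bernstein_poly: "poly (Bernstein_poly n k) x = Bernstein n k x"
  by (simp add: Bernstein_poly_def Bernstein_def)

text \<open>Total mass, mean and second moment of the binomial distribution divided by n, whose
  variance is x (1 - x) / n. Real polynomials that agree at every point are equal.\<close>

lemma Bernstein_poly_sums:
  assumes "0 < n"
  shows "(\<Sum>k\<le>n. Bernstein_poly n k) = 1"
    "(\<Sum>k\<le>n. smult (real k / n) (Bernstein_poly n k)) = [:0, 1:]"
    "(\<Sum>k\<le>n. smult ((real k / n)\<^sup>2) (Bernstein_poly n k)) = [:0, 1:] * [:0, 1:] + smult (1 / n) ([:0, 1:] * [:1, -1:])"
proof -
  have "poly (\<Sum>k\<le>n. Bernstein_poly n k) x = poly 1 x" for x
    by (simp add: poly_sum poly_Bernstein_poly)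
  then show "(\<Sum>k\<le>n. Bernstein_poly n k) = 1"
    using poly_eq_poly_eq_iff by blast
  have "poly (\<Sum>k\<le>n. smult (real k / n) (Bernstein_poly n k)) x = poly [:0, 1:] x" for x
  proof -
    have "poly (\<Sum>k\<le>n. smult (real k / n) (Bernstein_poly n k)) x = (\<Sum>k\<le>n. real k * Bernstein n k x) / n"
      by (simp add: poly_sum poly_Bernstein_poly sum_divide_distrib del: sum_k_Bernstein)
    then show ?thesis unfolding sum_k_Bernstein using assms by simp
  qed
  then show "(\<Sum>k\<le>n. smult (real k / n) (Bernstein_poly n k)) = [:0, 1:]"
    using poly_eq_poly_eq_iff by blast
  have "poly (\<Sum>k\<le>n. smult ((real k / n)\<^sup>2) (Bernstein_poly n k)) x =
      poly ([:0, 1:] * [:0, 1:] + smult (1 / n) ([:0, 1:] * [:1, -1:])) x" for x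
  proof -
    \<comment> \<open>The square of k is written as k (k - 1) + k, to match the known factorial
      moments.\<close>
    have "poly (\<Sum>k\<le>n. smult ((real k / n)\<^sup>2) (Bernstein_poly n k)) x =
        (\<Sum>k\<le>n. (real k * (real k - 1) * Bernstein n k x + real k * Bernstein n k x) / n\<^sup>2)"
      unfolding poly_sum poly_smult poly_Bernstein_poly
      by (intro sum.cong) (auto simp: power_divide power2_eq_square algebra_simps)
    also have "\<dots> = (real n * (real n - 1) * x\<^sup>2 + real n * x) / n\<^sup>2"
      unfolding sum_divide_distrib[symmetric] sum.distrib by simp
    also have "\<dots> = x * x + 1 / n * (x * (1 - x))"
      using assms by (simp add: field_simps power2_eq_square)
    finally show ?thesis by (simp add: algebra_simps)
  qed
  then show "(\<Sum>k\<le>n. smult ((real k / n)\<^sup>2) (Bernstein_poly n k)) =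
      [:0, 1:] * [:0, 1:] + smult (1 / n) ([:0, 1:] * [:1, -1:])"
    using poly_eq_poly_eq_iff by blast
qed

text \<open>A variance is nonnegative: with y the mean, the forms of \<open>E k\<close> at t k x - y
  add up to the difference of the two sides.\<close>

lemma partition_of_unity_Schwarz:
  assumes E: "\<And>k. k \<in> I \<Longrightarrow> psd (E k)" and sum: "(\<Sum>k\<in>I. E k) = id_blinfun"
  shows "(norm (blinfun_apply (\<Sum>k\<in>I. t k *\<^sub>R E k) x))\<^sup>2 \<le> blinfun_apply (\<Sum>k\<in>I. (t k)\<^sup>2 *\<^sub>R E k) x \<bullet> x"
proof -
  define y where "y = blinfun_apply (\<Sum>k\<in>I. t k *\<^sub>R E k) x"
  have "0 \<le> (\<Sum>k\<in>I. blinfun_apply (E k) (t k *\<^sub>R x - y) \<bullet> (t k *\<^sub>R x - y))"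
    by (intro sum_nonneg psd_nonneg E)
  also have "\<dots> = (\<Sum>k\<in>I. (t k)\<^sup>2 * (blinfun_apply (E k) x \<bullet> x) - 2 * (t k * (blinfun_apply (E k) x \<bullet> y))
      + blinfun_apply (E k) y \<bullet> y)"
  proof (intro sum.cong refl)
    fix k assume "k \<in> I"
    then have "blinfun_apply (E k) y \<bullet> x = blinfun_apply (E k) x \<bullet> y"
      using self_adjointD[OF psd_self_adjoint[OF E]] by (metis inner_commute)
    then show "blinfun_apply (E k) (t k *\<^sub>R x - y) \<bullet> (t k *\<^sub>R x - y) =
        (t k)\<^sup>2 * (blinfun_apply (E k) x \<bullet> x) - 2 * (t k * (blinfun_apply (E k) x \<bullet> y)) + blinfun_apply (E k) y \<bullet> y"
      by (simp add: blinfun.bilinear_simps inner_simps power2_eq_square algebra_simps)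
  qed
  also have "\<dots> = blinfun_apply (\<Sum>k\<in>I. (t k)\<^sup>2 *\<^sub>R E k) x \<bullet> x
      - 2 * (blinfun_apply (\<Sum>k\<in>I. t k *\<^sub>R E k) x \<bullet> y) + blinfun_apply (\<Sum>k\<in>I. E k) y \<bullet> y"
    by (simp add: blinfun.bilinear_simps inner_sum_left sum.distrib sum_subtractf sum_distrib_left)
  also have "\<dots> = blinfun_apply (\<Sum>k\<in>I. (t k)\<^sup>2 *\<^sub>R E k) x \<bullet> x - (norm y)\<^sup>2"
    by (simp add: sum y_def[symmetric] power2_norm_eq_inner)
  finally show ?thesis by (simp add: y_def)
qed

section \<open>Kadison and Schwarz inequalities for maps of the algebra\<close>

context vn_algebra
begin

context
  fixes \<sigma> :: "('h \<Rightarrow>\<^sub>L 'h) \<Rightarrow> ('h \<Rightarrow>\<^sub>L 'h)"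
  assumes \<sigma>: "positive_linear_map \<A> \<sigma>"
begin

lemma map_alg: "a \<in> \<A> \<Longrightarrow> \<sigma> a \<in> \<A>"
  using \<sigma> unfolding positive_linear_map_def by blast

lemma map_add: "a \<in> \<A> \<Longrightarrow> b \<in> \<A> \<Longrightarrow> \<sigma> (a + b) = \<sigma> a + \<sigma> b"
  using \<sigma> unfolding positive_linear_map_def by blast

lemma map_scaleC: "a \<in> \<A> \<Longrightarrow> \<sigma> (op_scaleC c a) = op_scaleC c (\<sigma> a)"
  using \<sigma> unfolding positive_linear_map_def by blast

lemma map_scaleR: "a \<in> \<A> \<Longrightarrow> \<sigma> (r *\<^sub>R a) = r *\<^sub>R \<sigma> a"
  using map_scaleC[of a "complex_of_real r"] by (simp add: op_scaleC_of_real)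

lemma map_diff: "a \<in> \<A> \<Longrightarrow> b \<in> \<A> \<Longrightarrow> \<sigma> (a - b) = \<sigma> a - \<sigma> b"
  using map_add[of a "(-1) *\<^sub>R b"] map_scaleR[of b "-1"] alg_scaleR[of b "-1"] by simp

lemma map_0: "\<sigma> 0 = 0"
  using map_scaleR[OF alg_0, of 0] by simp

lemma map_sum: "(\<And>i. i \<in> I \<Longrightarrow> f i \<in> \<A>) \<Longrightarrow> \<sigma> (sum f I) = (\<Sum>i\<in>I. \<sigma> (f i))"
  by (induction I rule: infinite_finite_induct) (auto simp: map_0 map_add alg_sum)

lemma map_psd: "a \<in> \<A> \<Longrightarrow> psd a \<Longrightarrow> psd (\<sigma> a)"
  using \<sigma> unfolding positive_linear_map_def by (meson pos_alg_iff)

text \<open>A self-adjoint \<open>a\<close> is the difference of the positive operators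
  \<open>?c\<close> and \<open>?c - a\<close>.\<close>

lemma map_self_adjoint:
  assumes "a \<in> \<A>" "self_adjoint a"
  shows "self_adjoint (\<sigma> a)"
proof -
  let ?c = "norm a *\<^sub>R id_blinfun :: 'h \<Rightarrow>\<^sub>L 'h"
  have "\<sigma> (?c - (?c - a)) = \<sigma> ?c - \<sigma> (?c - a)"
    by (intro map_diff alg_intros assms)
  moreover have "psd (\<sigma> ?c)" "psd (\<sigma> (?c - a))"
    by (intro map_psd alg_intros assms psd_scaleR psd_id psd_norm_diff order_refl norm_ge_zero)+
  ultimately show ?thesis
    by (simp add: self_adjoint_diff psd_self_adjoint)
qed

end

text \<open>The formulas for \<open>h\<close> and \<open>k\<close> are exported because membership
  in \<open>sq_integrable_sym\<close> is later read off from them.\<close>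

lemma self_adjoint_decomposition:
  assumes a: "a \<in> \<A>"
  obtains h k where "h \<in> \<A>" "k \<in> \<A>" "self_adjoint h" "self_adjoint k"
    "a = h + op_scaleC \<i> k" "op_adj a = h + op_scaleC (- \<i>) k"
    "h = (1/2) *\<^sub>R (a + op_adj a)" "k = op_scaleC (- \<i> / 2) a + op_scaleC (\<i> / 2) (op_adj a)"
proof -
  define h where "h = (1/2) *\<^sub>R (a + op_adj a)"
  define k where "k = op_scaleC (- \<i> / 2) a + op_scaleC (\<i> / 2) (op_adj a)"
  note acb = alg_cbounded[OF a]
  have h_eq: "h = op_scaleC (1/2) a + op_scaleC (1/2) (op_adj a)"
    using op_scaleC_of_real[of "1/2" a] op_scaleC_of_real[of "1/2" "op_adj a"]
    by (simp add: h_def scaleR_add_right)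
  have A: "h \<in> \<A>" "k \<in> \<A>" unfolding h_def k_def by (intro alg_intros a)+
  have "op_adj h = h" "op_adj k = k"
    unfolding h_eq k_def
    by (simp_all add: op_adj_add op_adj_op_scaleC op_adj_op_adj alg_cbounded alg_intros a add.commute)
  then have sa: "self_adjoint h" "self_adjoint k"
    using op_adj_self_adjoint alg_cbounded A by blast+
  have comb: "op_scaleC c a + op_scaleC d (op_adj a) + op_scaleC e (op_scaleC c' a + op_scaleC d' (op_adj a)) =
      op_scaleC (c + e * c') a + op_scaleC (d + e * d') (op_adj a)" for c d e c' d'
    by (auto intro!: blinfun_eqI simp: blinfun.bilinear_simps op_scaleC.rep_eq scaleC_add_right scaleC_add_left scaleC_scaleC)
  have one: "op_scaleC 1 T = T" and zero: "op_scaleC 0 T = 0" for T :: "'h \<Rightarrow>\<^sub>L 'h"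
    using op_scaleC_of_real[of 1 T] op_scaleC_of_real[of 0 T] by simp_all
  show thesis
  proof (rule that[OF A sa _ _ h_def k_def])
    show "a = h + op_scaleC \<i> k" "op_adj a = h + op_scaleC (- \<i>) k"
      unfolding h_eq k_def comb by (simp_all add: one zero)
  qed
qed

lemma map_adj:
  assumes \<sigma>: "positive_linear_map \<A> \<sigma>" and a: "a \<in> \<A>"
  shows "\<sigma> (op_adj a) = op_adj (\<sigma> a)"
proof -
  obtain h k where hk: "h \<in> \<A>" "k \<in> \<A>" "self_adjoint h" "self_adjoint k"
    "a = h + op_scaleC \<i> k" "op_adj a = h + op_scaleC (- \<i>) k"
    by (rule self_adjoint_decomposition[OF a])
  have \<sigma>hk: "\<sigma> h \<in> cbounded_ops" "\<sigma> k \<in> cbounded_ops" "op_scaleC \<i> (\<sigma> k) \<in> cbounded_ops"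
    using hk by (auto intro: alg_cbounded map_alg[OF \<sigma>] alg_scaleC)
  then have adj: "op_adj (\<sigma> h) = \<sigma> h" "op_adj (\<sigma> k) = \<sigma> k"
    using map_self_adjoint[OF \<sigma>] hk op_adj_self_adjoint by blast+
  have "op_adj (\<sigma> a) = op_adj (\<sigma> h + op_scaleC \<i> (\<sigma> k))"
    by (simp add: hk(5) map_add[OF \<sigma>] map_scaleC[OF \<sigma>] hk(1,2) alg_scaleC)
  also have "\<dots> = \<sigma> h + op_scaleC (- \<i>) (\<sigma> k)"
    using \<sigma>hk by (simp add: op_adj_add op_adj_op_scaleC adj)
  also have "\<dots> = \<sigma> (op_adj a)"
    by (simp add: hk(6) map_add[OF \<sigma>] map_scaleC[OF \<sigma>] hk(1,2) alg_scaleC)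
  finally show ?thesis by simp
qed

text \<open>A merely positive map need not satisfy the Schwarz inequality on all of the algebra; for
  self-adjoint \<open>b\<close> it does, because the Bernstein polynomials of \<open>b\<close> form positive partitions of unity
  whose first and second moments approximate \<open>b\<close> and \<open>b\<^sup>2\<close>.\<close>

lemma Kadison_inequality_unit_interval:
  assumes \<sigma>: "positive_linear_map \<A> \<sigma>" "\<sigma> id_blinfun = id_blinfun"
    and b: "b \<in> \<A>" "psd b" "psd (id_blinfun - b)"
  shows "(norm (blinfun_apply (\<sigma> b) x))\<^sup>2 \<le> blinfun_apply (\<sigma> (b o\<^sub>L b)) x \<bullet> x"
proof -
  define e where "e n k = op_poly (Bernstein_poly n k) b" for n k
  have eA: "e n k \<in> \<A>" for n k unfolding e_def by (rule op_poly_alg[OF b(1)])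
  have e_psd: "psd (e n k)" for n k
    unfolding e_def Bernstein_poly_def op_poly_smult
    by (intro psd_scaleR op_poly_Bernstein_psd b) simp
  let ?r = "b o\<^sub>L (id_blinfun - b)"
  have X: "op_poly [:0, 1:] b = b" and Y: "op_poly [:1, -1:] b = id_blinfun - b"
    and one: "op_poly 1 b = id_blinfun"
    by (auto simp: one_pCons intro!: blinfun_eqI simp: blinfun.bilinear_simps)
  \<comment> \<open>The Bernstein partition has first moment b and second moment b^2 + b (1 - b) /
    n; the last term is an error that disappears as n grows.\<close>
  have step: "(norm (blinfun_apply (\<sigma> b) x))\<^sup>2 \<le>
      blinfun_apply (\<sigma> (b o\<^sub>L b)) x \<bullet> x + (1 / real n) * (blinfun_apply (\<sigma> ?r) x \<bullet> x)" if n: "0 < n" for n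
  proof -
    note sums = Bernstein_poly_sums[OF n, THEN arg_cong[where f = "\<lambda>p. op_poly p b"]]
    have s0: "(\<Sum>k\<le>n. e n k) = id_blinfun"
      using sums(1) by (simp add: e_def op_poly_sum one)
    have s1: "(\<Sum>k\<le>n. (real k / n) *\<^sub>R e n k) = b"
      using sums(2) by (simp add: e_def op_poly_sum op_poly_smult X del: op_poly_pCons)
    have s2: "(\<Sum>k\<le>n. ((real k / n)\<^sup>2) *\<^sub>R e n k) = (b o\<^sub>L b) + (1 / n) *\<^sub>R ?r"
      using sums(3) unfolding op_poly_sum op_poly_smult op_poly_add op_poly_mult X Y e_def .
    have "(norm (blinfun_apply (\<Sum>k\<le>n. (real k / n) *\<^sub>R \<sigma> (e n k)) x))\<^sup>2 \<le>
        blinfun_apply (\<Sum>k\<le>n. (real k / n)\<^sup>2 *\<^sub>R \<sigma> (e n k)) x \<bullet> x"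
    proof (rule partition_of_unity_Schwarz)
      show "psd (\<sigma> (e n k))" for k by (rule map_psd[OF \<sigma>(1) eA e_psd])
      show "(\<Sum>k\<le>n. \<sigma> (e n k)) = id_blinfun"
        using s0 \<sigma>(2) map_sum[OF \<sigma>(1), of "{..n}" "e n"] eA by simp
    qed
    moreover have lin: "(\<Sum>k\<le>n. t k *\<^sub>R \<sigma> (e n k)) = \<sigma> (\<Sum>k\<le>n. t k *\<^sub>R e n k)" for t
      using eA by (simp add: map_sum[OF \<sigma>(1)] map_scaleR[OF \<sigma>(1)] alg_scaleR)
    moreover have "\<sigma> ((b o\<^sub>L b) + (1 / n) *\<^sub>R ?r) = \<sigma> (b o\<^sub>L b) + (1 / n) *\<^sub>R \<sigma> ?r"
      by (simp only: map_add[OF \<sigma>(1)] map_scaleR[OF \<sigma>(1)] alg_intros b)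
    ultimately show ?thesis
      unfolding lin s1 s2 by (simp add: blinfun.bilinear_simps inner_simps)
  qed
  have "(\<lambda>n. blinfun_apply (\<sigma> (b o\<^sub>L b)) x \<bullet> x + (1 / real n) * (blinfun_apply (\<sigma> ?r) x \<bullet> x)) \<longlonglongrightarrow>
      blinfun_apply (\<sigma> (b o\<^sub>L b)) x \<bullet> x + 0 * (blinfun_apply (\<sigma> ?r) x \<bullet> x)"
    by (intro tendsto_intros lim_1_over_n)
  then show ?thesis
    using step by (intro LIMSEQ_le_const[of _ "blinfun_apply (\<sigma> (b o\<^sub>L b)) x \<bullet> x"]) (auto intro!: exI[of _ 1])
qed

text \<open>As \<sigma> is unital, both sides change compatibly under affine maps of
  \<open>b\<close>, so \<open>b\<close> may be moved into the unit interval.\<close>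

lemma Kadison_inequality:
  assumes \<sigma>: "positive_linear_map \<A> \<sigma>" "\<sigma> id_blinfun = id_blinfun"
    and b: "b \<in> \<A>" "self_adjoint b"
  shows "psd (\<sigma> (b o\<^sub>L b) - (\<sigma> b o\<^sub>L \<sigma> b))"
proof (rule psd_diffI)
  \<comment> \<open>The summand 1 keeps c positive when \<open>b = 0\<close>.\<close>
  define c where "c = norm b + 1"
  have c: "0 < c" "norm b \<le> c" by (auto simp: c_def add_nonneg_pos)
  define b' where "b' = (1 / (2 * c)) *\<^sub>R (c *\<^sub>R id_blinfun + b)"
  have b'A: "b' \<in> \<A>" unfolding b'_def by (intro alg_intros b)
  have "psd (c *\<^sub>R id_blinfun - (-1) *\<^sub>R b)"
    using b c by (intro psd_norm_diff self_adjoint_scaleR) auto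
  then have b'1: "psd b'"
    unfolding b'_def using c by (intro psd_scaleR) auto
  have "id_blinfun - b' = (1 / (2 * c)) *\<^sub>R (c *\<^sub>R id_blinfun - b)"
    unfolding b'_def using c
    by (intro blinfun_eqI) (simp add: blinfun.bilinear_simps scaleR_add_right scaleR_diff_right, simp add: scaleR_add_left[symmetric] algebra_simps)
  then have b'2: "psd (id_blinfun - b')"
    using psd_norm_diff[OF b(2) c(2)] c by (simp add: psd_scaleR)
  have b_eq: "b = (2 * c) *\<^sub>R b' - c *\<^sub>R id_blinfun"
    unfolding b'_def using c by simp
  have bb_eq: "b o\<^sub>L b = (4 * c\<^sup>2) *\<^sub>R (b' o\<^sub>L b') - (4 * c\<^sup>2) *\<^sub>R b' + c\<^sup>2 *\<^sub>R id_blinfun"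
    unfolding b_eq
    by (intro blinfun_eqI) (simp add: blinfun.bilinear_simps power2_eq_square algebra_simps, simp add: scaleR_add_left[symmetric])
  have \<sigma>b: "\<sigma> b = (2 * c) *\<^sub>R \<sigma> b' - c *\<^sub>R id_blinfun"
    unfolding b_eq using b'A
    by (simp add: map_diff[OF \<sigma>(1)] map_scaleR[OF \<sigma>(1)] \<sigma>(2) alg_intros)
  have \<sigma>bb: "\<sigma> (b o\<^sub>L b) = (4 * c\<^sup>2) *\<^sub>R \<sigma> (b' o\<^sub>L b') - (4 * c\<^sup>2) *\<^sub>R \<sigma> b' + c\<^sup>2 *\<^sub>R id_blinfun"
    unfolding bb_eq using b'A
    by (simp add: map_add[OF \<sigma>(1)] map_diff[OF \<sigma>(1)] map_scaleR[OF \<sigma>(1)] \<sigma>(2) alg_intros)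
  show sa: "self_adjoint (\<sigma> b o\<^sub>L \<sigma> b)" "self_adjoint (\<sigma> (b o\<^sub>L b))"
    by (intro psd_self_adjoint psd_square map_self_adjoint[OF \<sigma>(1)] map_psd[OF \<sigma>(1)] b alg_intros)+
  fix x
  have "blinfun_apply (\<sigma> b o\<^sub>L \<sigma> b) x \<bullet> x = (norm (blinfun_apply (\<sigma> b) x))\<^sup>2"
    using self_adjointD[OF map_self_adjoint[OF \<sigma>(1) b]] by (simp add: power2_norm_eq_inner)
  also have "\<dots> = 4 * c\<^sup>2 * (norm (blinfun_apply (\<sigma> b') x))\<^sup>2 - 4 * c\<^sup>2 * (blinfun_apply (\<sigma> b') x \<bullet> x) + c\<^sup>2 * (x \<bullet> x)"
    unfolding \<sigma>b power2_norm_eq_inner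
    by (simp add: blinfun.bilinear_simps inner_simps inner_commute power2_eq_square algebra_simps)
  also have "\<dots> \<le> 4 * c\<^sup>2 * (blinfun_apply (\<sigma> (b' o\<^sub>L b')) x \<bullet> x) - 4 * c\<^sup>2 * (blinfun_apply (\<sigma> b') x \<bullet> x) + c\<^sup>2 * (x \<bullet> x)"
    by (intro add_mono diff_mono mult_left_mono Kadison_inequality_unit_interval[OF \<sigma> b'A b'1 b'2]) auto
  also have "\<dots> = blinfun_apply (\<sigma> (b o\<^sub>L b)) x \<bullet> x"
    unfolding \<sigma>bb by (simp add: blinfun.bilinear_simps inner_simps)
  finally show "blinfun_apply (\<sigma> b o\<^sub>L \<sigma> b) x \<bullet> x \<le> blinfun_apply (\<sigma> (b o\<^sub>L b)) x \<bullet> x" .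
qed

lemma map_norm_le:
  assumes \<sigma>: "positive_linear_map \<A> \<sigma>" "\<sigma> id_blinfun = id_blinfun"
    and b: "b \<in> \<A>" "self_adjoint b"
  shows "norm (\<sigma> b) \<le> norm b"
proof (rule norm_blinfun_bound)
  fix x
  have "psd ((norm b)\<^sup>2 *\<^sub>R id_blinfun - (b o\<^sub>L b))"
  proof (rule psd_norm_diff)
    show "self_adjoint (b o\<^sub>L b)" by (intro psd_self_adjoint psd_square b)
    show "norm (b o\<^sub>L b) \<le> (norm b)\<^sup>2"
      using norm_blinfun_compose[of b b] by (simp add: power2_eq_square)
  qed
  then have "psd (\<sigma> ((norm b)\<^sup>2 *\<^sub>R id_blinfun - (b o\<^sub>L b)))"
    by (intro map_psd[OF \<sigma>(1)] alg_intros b)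
  then have le: "psd ((norm b)\<^sup>2 *\<^sub>R id_blinfun - \<sigma> (b o\<^sub>L b))"
    using b by (simp add: map_diff[OF \<sigma>(1)] map_scaleR[OF \<sigma>(1)] \<sigma>(2) alg_intros)
  have "(norm (blinfun_apply (\<sigma> b) x))\<^sup>2 = blinfun_apply (\<sigma> b o\<^sub>L \<sigma> b) x \<bullet> x"
    using self_adjointD[OF map_self_adjoint[OF \<sigma>(1) b]] by (simp add: power2_norm_eq_inner)
  also have "\<dots> \<le> blinfun_apply ((norm b)\<^sup>2 *\<^sub>R id_blinfun) x \<bullet> x"
    by (rule psd_diffD[OF psd_diff_trans[OF Kadison_inequality[OF \<sigma> b] le]])
  also have "\<dots> = (norm b * norm x)\<^sup>2"
    by (simp add: blinfun.bilinear_simps power_mult_distrib power2_norm_eq_inner)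
  finally show "norm (blinfun_apply (\<sigma> b) x) \<le> norm b * norm x"
    by (rule power2_le_imp_le) simp
qed simp

text \<open>The 2 by 2 matrix \<open>a\<close> built from 1, b and \<open>op_adj b\<close> has the
  form |x0 + b x1|^2, and \<sigma> keeps it positive. Unlike Kadison's inequality this covers all of
  the algebra, which makes the generators contractions on the whole Hilbert space.\<close>

lemma Schwarz_completely_positive:
  assumes \<sigma>: "positive_linear_map \<A> \<sigma>" "\<sigma> id_blinfun = id_blinfun" "completely_positive \<A> \<sigma>"
    and b: "b \<in> \<A>"
  shows "psd (\<sigma> (op_adj b o\<^sub>L b) - (op_adj (\<sigma> b) o\<^sub>L \<sigma> b))"
proof (rule psd_diffI)
  note cb = alg_cbounded[OF b] and \<sigma>cb = alg_cbounded[OF map_alg[OF \<sigma>(1) b]]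
  show "self_adjoint (op_adj (\<sigma> b) o\<^sub>L \<sigma> b)" "self_adjoint (\<sigma> (op_adj b o\<^sub>L b))"
    by (intro psd_self_adjoint psd_op_adj_comp map_psd[OF \<sigma>(1)] cb \<sigma>cb b alg_intros)+
  fix v
  define a :: "nat \<Rightarrow> nat \<Rightarrow> 'h \<Rightarrow>\<^sub>L 'h" where
    "a i j = (if i = 0 then if j = 0 then id_blinfun else b else if j = 0 then op_adj b else op_adj b o\<^sub>L b)" for i j
  have "a i j \<in> \<A>" for i j unfolding a_def by (auto intro: alg_intros b)
  moreover have "matrix_pos 2 a"
    unfolding matrix_pos_def
  proof
    fix x :: "nat \<Rightarrow> 'h"
    let ?u = "x 0 + blinfun_apply b (x 1)"
    have "cinner (blinfun_apply (op_adj b) y) z = cinner y (blinfun_apply b z)" for y z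
      using op_adj_cinner[OF cb] by (metis cinner_commute)
    then have "(\<Sum>i<2. \<Sum>j<2. cinner (blinfun_apply (a i j) (x j)) (x i)) = cinner ?u ?u"
      by (simp add: a_def numeral_2_eq_2 cinner_add_left cinner_add_right)
    then show "(\<Sum>i<2. \<Sum>j<2. cinner (blinfun_apply (a i j) (x j)) (x i)) \<in> \<real>\<^sub>\<ge>\<^sub>0"
      unfolding cinner_self by simp
  qed
  ultimately have "matrix_pos 2 (\<lambda>i j. \<sigma> (a i j))"
    using \<sigma>(3) unfolding completely_positive_def by blast
  then have pos: "(\<Sum>i<2. \<Sum>j<2. cinner (blinfun_apply (\<sigma> (a i j)) (x j)) (x i)) \<in> \<real>\<^sub>\<ge>\<^sub>0" for x
    unfolding matrix_pos_def by (rule spec)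
  \<comment> \<open>For second component \<open>v\<close>, this first component minimises the form
    of the image matrix.\<close>
  define x :: "nat \<Rightarrow> 'h" where "x = (\<lambda>k. if k = 0 then - blinfun_apply (\<sigma> b) v else v)"
  have "0 \<le> Re (\<Sum>i<2. \<Sum>j<2. cinner (blinfun_apply (\<sigma> (a i j)) (x j)) (x i))"
    using pos[of x] by (simp only: complex_nonneg_Reals_iff)
  also have "\<dots> = blinfun_apply (\<sigma> (op_adj b o\<^sub>L b)) v \<bullet> v - blinfun_apply (op_adj (\<sigma> b) o\<^sub>L \<sigma> b) v \<bullet> v"
    by (simp add: a_def x_def numeral_2_eq_2 inner_eq_Re_cinner[symmetric] \<sigma>(2) map_adj[OF \<sigma>(1) b]
        blinfun.bilinear_simps)
  finally show "blinfun_apply (op_adj (\<sigma> b) o\<^sub>L \<sigma> b) v \<bullet> v \<le> blinfun_apply (\<sigma> (op_adj b o\<^sub>L b)) v \<bullet> v"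
    by simp
qed

end

section \<open>The Hilbert space of the weight\<close>

lemma contraction_extension:
  fixes f :: "'a::real_normed_vector \<Rightarrow> 'b::{real_normed_vector,complete_space}"
  assumes V: "subspace V" "closure V = UNIV"
    and add: "\<And>x y. x \<in> V \<Longrightarrow> y \<in> V \<Longrightarrow> f (x + y) = f x + f y"
    and scale: "\<And>r x. x \<in> V \<Longrightarrow> f (r *\<^sub>R x) = r *\<^sub>R f x"
    and contr: "\<And>x. x \<in> V \<Longrightarrow> norm (f x) \<le> norm x"
  obtains T where "\<And>x. x \<in> V \<Longrightarrow> blinfun_apply T x = f x" "\<And>x. norm (blinfun_apply T x) \<le> norm x"
proof -
  have diff: "f x - f y = f (x - y)" if "x \<in> V" "y \<in> V" for x y
    using add[OF that(1) subspace_scale[OF V(1) that(2), of "-1"]] scale[OF that(2), of "-1"] by simp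
  have "uniformly_continuous_on V f"
    unfolding uniformly_continuous_on_def dist_norm
    using diff contr subspace_diff[OF V(1)] by (metis order_le_less_trans)
  then obtain g where g: "uniformly_continuous_on (closure V) g" "\<And>x. x \<in> V \<Longrightarrow> f x = g x"
    by (rule uniformly_continuous_on_extension_on_closure) auto
  then have "continuous_on UNIV g"
    using V(2) uniformly_continuous_imp_continuous by metis
  then have lim_g: "(\<lambda>n. g (s n)) \<longlonglongrightarrow> g x" if "s \<longlonglongrightarrow> x" for s :: "nat \<Rightarrow> 'a" and x
    using that continuous_on_tendsto_compose by fastforce
  have approx: "\<exists>s. (\<forall>n::nat. s n \<in> V) \<and> s \<longlonglongrightarrow> x" for x
    using V(2) closure_sequential[of x V] by blast
  have g_add: "g (x + y) = g x + g y" for x y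
  proof -
    obtain s t where st: "\<forall>n::nat. s n \<in> V" "s \<longlonglongrightarrow> x" "\<forall>n::nat. t n \<in> V" "t \<longlonglongrightarrow> y"
      using approx by metis
    have "g (s n + t n) = g (s n) + g (t n)" for n
      using st add g(2) subspace_add[OF V(1)] by metis
    then have "(\<lambda>n. g (s n) + g (t n)) \<longlonglongrightarrow> g (x + y)"
      using lim_g[OF tendsto_add[OF st(2,4)]] by simp
    moreover have "(\<lambda>n. g (s n) + g (t n)) \<longlonglongrightarrow> g x + g y"
      by (intro tendsto_add lim_g st)
    ultimately show ?thesis by (rule LIMSEQ_unique)
  qed
  have g_scale: "g (r *\<^sub>R x) = r *\<^sub>R g x" for r x
  proof -
    obtain s where s: "\<forall>n::nat. s n \<in> V" "s \<longlonglongrightarrow> x" using approx by metis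
    have "g (r *\<^sub>R s n) = r *\<^sub>R g (s n)" for n
      using s scale g(2) subspace_scale[OF V(1)] by metis
    then have "(\<lambda>n. r *\<^sub>R g (s n)) \<longlonglongrightarrow> g (r *\<^sub>R x)"
      using lim_g[OF tendsto_scaleR[OF tendsto_const s(2), of r]] by simp
    moreover have "(\<lambda>n. r *\<^sub>R g (s n)) \<longlonglongrightarrow> r *\<^sub>R g x"
      by (intro tendsto_intros lim_g s)
    ultimately show ?thesis by (rule LIMSEQ_unique)
  qed
  have g_norm: "norm (g x) \<le> norm x" for x
  proof -
    obtain s where s: "\<forall>n::nat. s n \<in> V" "s \<longlonglongrightarrow> x" using approx by metis
    show ?thesis
      by (rule LIMSEQ_le[OF tendsto_norm[OF lim_g[OF s(2)]] tendsto_norm[OF s(2)]])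
        (use s contr g(2) in auto)
  qed
  have "bounded_linear g"
    by (rule bounded_linear_intro[of _ 1]) (auto simp: g_add g_scale g_norm)
  then show thesis
    using that[of "Blinfun g"] g(2) g_norm by (simp add: bounded_linear_Blinfun_apply)
qed

lemma blinfun_eq_on_dense:
  assumes "closure V = UNIV" "\<And>x. x \<in> V \<Longrightarrow> blinfun_apply S x = blinfun_apply T x"
  shows "S = T"
proof (rule blinfun_eqI)
  fix x
  have "closed {x. blinfun_apply S x = blinfun_apply T x}"
    by (intro closed_Collect_eq continuous_intros)
  moreover have "V \<subseteq> {x. blinfun_apply S x = blinfun_apply T x}" using assms(2) by blast
  ultimately have "closure V \<subseteq> {x. blinfun_apply S x = blinfun_apply T x}"
    by (rule closure_minimal[rotated])
  then show "blinfun_apply S x = blinfun_apply T x" using assms(1) by blast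
qed

lemma op_scaleC_zero: "op_scaleC c 0 = 0"
  by (rule blinfun_eqI)
    (simp add: op_scaleC.rep_eq linear_0[OF bounded_linear.linear[OF bounded_linear_scaleC]])

section \<open>The square-integrable elements and the extended weight\<close>

context vn_weight
begin

lemma sq_integrable_sym_iff:
  "a \<in> sq_integrable_sym \<A> \<phi> \<longleftrightarrow> a \<in> \<A> \<and> \<phi> (op_adj a o\<^sub>L a) < \<infinity> \<and> \<phi> (a o\<^sub>L op_adj a) < \<infinity>"
proof -
  have "a \<in> op_adj ` sq_integrable \<A> \<phi> \<longleftrightarrow> op_adj a \<in> sq_integrable \<A> \<phi>" if "a \<in> \<A>"
  proof
    assume "a \<in> op_adj ` sq_integrable \<A> \<phi>"
    then obtain b where "b \<in> sq_integrable \<A> \<phi>" "a = op_adj b" by blast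
    then show "op_adj a \<in> sq_integrable \<A> \<phi>"
      by (simp add: sq_integrable_def op_adj_op_adj alg_cbounded)
  next
    assume "op_adj a \<in> sq_integrable \<A> \<phi>"
    then show "a \<in> op_adj ` sq_integrable \<A> \<phi>"
      using op_adj_op_adj[OF alg_cbounded[OF that]] by (metis imageI)
  qed
  then show ?thesis
    by (auto simp: sq_integrable_sym_def sq_integrable_def alg_adj op_adj_op_adj alg_cbounded)
qed

lemma sym_alg: "a \<in> sq_integrable_sym \<A> \<phi> \<Longrightarrow> a \<in> \<A>"
  by (simp add: sq_integrable_sym_iff)

lemma sym_finite: "a \<in> sq_integrable_sym \<A> \<phi> \<Longrightarrow> \<phi> (op_adj a o\<^sub>L a) < \<infinity>"
  by (simp add: sq_integrable_sym_iff)

lemma sym_adj: "a \<in> sq_integrable_sym \<A> \<phi> \<Longrightarrow> op_adj a \<in> sq_integrable_sym \<A> \<phi>"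
  by (simp add: sq_integrable_sym_iff op_adj_op_adj alg_cbounded alg_adj)

lemma symI:
  "a \<in> \<A> \<Longrightarrow> \<phi> (op_adj a o\<^sub>L a) < \<infinity> \<Longrightarrow> \<phi> (op_adj (op_adj a) o\<^sub>L op_adj a) < \<infinity> \<Longrightarrow> a \<in> sq_integrable_sym \<A> \<phi>"
  by (simp add: sq_integrable_sym_iff op_adj_op_adj alg_cbounded)

lemma sym_self_adjointI:
  "a \<in> \<A> \<Longrightarrow> self_adjoint a \<Longrightarrow> \<phi> (a o\<^sub>L a) < \<infinity> \<Longrightarrow> a \<in> sq_integrable_sym \<A> \<phi>"
  by (simp add: sq_integrable_sym_iff op_adj_self_adjoint alg_cbounded)

text \<open>Parallelogram law; the term dropped is the square of a - b.\<close>

lemma weight_sq_add_le: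
  assumes "a \<in> \<A>" "b \<in> \<A>"
  shows "\<phi> (op_adj (a + b) o\<^sub>L (a + b)) \<le> 2 * \<phi> (op_adj a o\<^sub>L a) + 2 * \<phi> (op_adj b o\<^sub>L b)"
proof -
  let ?a = "op_adj a o\<^sub>L a" and ?b = "op_adj b o\<^sub>L b" and ?c = "op_adj (a + b) o\<^sub>L (a + b)"
  have A: "?a \<in> \<A>" "?b \<in> \<A>" "?c \<in> \<A>" by (intro alg_intros assms)+
  have P: "psd ?a" "psd ?b" "psd ?c"
    by (intro psd_op_adj_comp alg_cbounded alg_intros assms)+
  have "psd ((2 *\<^sub>R ?a + 2 *\<^sub>R ?b) - ?c)"
  proof (rule psd_diffI)
    fix x
    have "(norm (blinfun_apply a x + blinfun_apply b x))\<^sup>2 \<le>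
        2 * (norm (blinfun_apply a x))\<^sup>2 + 2 * (norm (blinfun_apply b x))\<^sup>2"
      using zero_le_power2[of "norm (blinfun_apply a x - blinfun_apply b x)"]
      by (simp only: power2_norm_eq_inner) (simp add: inner_simps inner_commute)
    then show "blinfun_apply ?c x \<bullet> x \<le> blinfun_apply (2 *\<^sub>R ?a + 2 *\<^sub>R ?b) x \<bullet> x"
      unfolding op_adj_comp_form[OF alg_cbounded[OF alg_add[OF assms]]] blinfun.add_left blinfun.scaleR_left
        inner_add_left inner_scaleR_left op_adj_comp_form[OF alg_cbounded[OF assms(1)]]
        op_adj_comp_form[OF alg_cbounded[OF assms(2)]] .
  qed (intro self_adjoint_add self_adjoint_scaleR psd_self_adjoint P)+
  then have "\<phi> ?c \<le> \<phi> (2 *\<^sub>R ?a + 2 *\<^sub>R ?b)"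
    using A P by (intro weight_mono alg_add alg_scaleR)
  also have "\<dots> = 2 * \<phi> ?a + 2 * \<phi> ?b"
    using A P by (simp add: weight_add weight_scaleR alg_scaleR psd_scaleR)
  finally show ?thesis .
qed

lemma sym_add:
  assumes "a \<in> sq_integrable_sym \<A> \<phi>" "b \<in> sq_integrable_sym \<A> \<phi>"
  shows "a + b \<in> sq_integrable_sym \<A> \<phi>"
proof (rule symI)
  have fin: "\<phi> (op_adj (c + d) o\<^sub>L (c + d)) < \<infinity>"
    if "c \<in> sq_integrable_sym \<A> \<phi>" "d \<in> sq_integrable_sym \<A> \<phi>" for c d
  proof (rule order_le_less_trans[OF weight_sq_add_le[OF sym_alg sym_alg, OF that]])
    show "2 * \<phi> (op_adj c o\<^sub>L c) + 2 * \<phi> (op_adj d o\<^sub>L d) < \<infinity>"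
      using sym_finite[OF that(1)] sym_finite[OF that(2)] by (simp add: ennreal_mult_less_top)
  qed
  show "\<phi> (op_adj (a + b) o\<^sub>L (a + b)) < \<infinity>" by (rule fin[OF assms])
  show "\<phi> (op_adj (op_adj (a + b)) o\<^sub>L op_adj (a + b)) < \<infinity>"
    using fin[OF sym_adj sym_adj, OF assms] assms
    by (simp add: op_adj_add alg_cbounded sym_alg)
qed (intro alg_add sym_alg assms)

lemma sym_scaleC:
  assumes "a \<in> sq_integrable_sym \<A> \<phi>"
  shows "op_scaleC c a \<in> sq_integrable_sym \<A> \<phi>"
proof (rule symI)
  have fin: "\<phi> (op_adj (op_scaleC d b) o\<^sub>L op_scaleC d b) < \<infinity>" if "b \<in> sq_integrable_sym \<A> \<phi>" for b d
  proof -
    note bA = sym_alg[OF that]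
    have "op_adj (op_scaleC d b) o\<^sub>L op_scaleC d b = (cmod d)\<^sup>2 *\<^sub>R (op_adj b o\<^sub>L b)"
    proof (rule blinfun_eqI)
      fix u
      have "blinfun_apply (op_adj (op_scaleC d b) o\<^sub>L op_scaleC d b) u = (cnj d * d) *\<^sub>C blinfun_apply (op_adj b o\<^sub>L b) u"
        by (simp add: op_adj_op_scaleC alg_cbounded[OF bA] op_scaleC.rep_eq scaleC_scaleC
            cbounded_opsD[OF op_adj_cbounded[OF alg_cbounded[OF bA]]])
      also have "cnj d * d = complex_of_real ((cmod d)\<^sup>2)"
        unfolding complex_norm_square by (rule mult.commute)
      finally show "blinfun_apply (op_adj (op_scaleC d b) o\<^sub>L op_scaleC d b) u = blinfun_apply ((cmod d)\<^sup>2 *\<^sub>R (op_adj b o\<^sub>L b)) u"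
        by (simp only: scaleC_of_real blinfun.scaleR_left)
    qed
    then have "\<phi> (op_adj (op_scaleC d b) o\<^sub>L op_scaleC d b) = ennreal ((cmod d)\<^sup>2) * \<phi> (op_adj b o\<^sub>L b)"
      using bA by (simp add: weight_scaleR alg_intros psd_op_adj_comp alg_cbounded)
    then show ?thesis using sym_finite[OF that] by (simp add: ennreal_mult_less_top)
  qed
  show "\<phi> (op_adj (op_scaleC c a) o\<^sub>L op_scaleC c a) < \<infinity>" by (rule fin[OF assms])
  show "\<phi> (op_adj (op_adj (op_scaleC c a)) o\<^sub>L op_adj (op_scaleC c a)) < \<infinity>"
    using fin[OF sym_adj[OF assms], of "cnj c"] by (simp add: op_adj_op_scaleC alg_cbounded sym_alg[OF assms])
qed (intro alg_scaleC sym_alg assms)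

lemma sym_scaleR: "a \<in> sq_integrable_sym \<A> \<phi> \<Longrightarrow> r *\<^sub>R a \<in> sq_integrable_sym \<A> \<phi>"
  using sym_scaleC[of a "complex_of_real r"] by (simp add: op_scaleC_of_real)

lemma sym_diff: "a \<in> sq_integrable_sym \<A> \<phi> \<Longrightarrow> b \<in> sq_integrable_sym \<A> \<phi> \<Longrightarrow> a - b \<in> sq_integrable_sym \<A> \<phi>"
  using sym_add[of a "(-1) *\<^sub>R b"] sym_scaleR[of b "-1"] by simp

lemma sym_0: "0 \<in> sq_integrable_sym \<A> \<phi>"
  by (rule sym_self_adjointI) (auto simp: alg_0 weight_0)

lemma sym_sum: "(\<And>i. i \<in> I \<Longrightarrow> f i \<in> sq_integrable_sym \<A> \<phi>) \<Longrightarrow> sum f I \<in> sq_integrable_sym \<A> \<phi>"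
  by (induction I rule: infinite_finite_induct) (auto intro: sym_add sym_0)

text \<open>Uniqueness behind \<open>THE\<close> for positive x: self-adjointness forces
  \<open>c = d\<close>, and then a = x + b, where the finite weight of \<open>b\<close> can be
  subtracted. Norms in the completion require only this case.\<close>

lemma weight_ext_finite_pos:
  assumes x: "x \<in> \<A>" "psd x" "\<phi> x < \<infinity>"
  shows "weight_ext \<A> \<phi> x = Complex (enn2real (\<phi> x)) 0"
  unfolding weight_ext_def
proof (rule the_equality)
  have fin: "x \<in> finite_pos \<A> \<phi>" "0 \<in> finite_pos \<A> \<phi>"
    using x by (auto simp: finite_pos_def pos_alg_iff alg_0 weight_0)
  show "\<exists>a\<in>finite_pos \<A> \<phi>. \<exists>b\<in>finite_pos \<A> \<phi>. \<exists>c\<in>finite_pos \<A> \<phi>. \<exists>d\<in>finite_pos \<A> \<phi>.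
      x = a - b + op_scaleC \<i> (c - d) \<and>
      Complex (enn2real (\<phi> x)) 0 = Complex (enn2real (\<phi> a) - enn2real (\<phi> b)) (enn2real (\<phi> c) - enn2real (\<phi> d))"
    by (rule bexI[OF _ fin(1)], rule bexI[OF _ fin(2)], rule bexI[OF _ fin(2)], rule bexI[OF _ fin(2)])
      (simp add: weight_0 op_scaleC_zero)
  fix v
  assume "\<exists>a\<in>finite_pos \<A> \<phi>. \<exists>b\<in>finite_pos \<A> \<phi>. \<exists>c\<in>finite_pos \<A> \<phi>. \<exists>d\<in>finite_pos \<A> \<phi>.
      x = a - b + op_scaleC \<i> (c - d) \<and>
      v = Complex (enn2real (\<phi> a) - enn2real (\<phi> b)) (enn2real (\<phi> c) - enn2real (\<phi> d))"
  then obtain a b c d where fin: "a \<in> finite_pos \<A> \<phi>" "b \<in> finite_pos \<A> \<phi>" "c \<in> finite_pos \<A> \<phi>" "d \<in> finite_pos \<A> \<phi>"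
    and x_eq: "x = a - b + op_scaleC \<i> (c - d)"
    and v: "v = Complex (enn2real (\<phi> a) - enn2real (\<phi> b)) (enn2real (\<phi> c) - enn2real (\<phi> d))"
    by blast
  then have A: "a \<in> \<A>" "psd a" "\<phi> a < \<infinity>" "b \<in> \<A>" "psd b" "\<phi> b < \<infinity>" "c \<in> \<A>" "psd c" "d \<in> \<A>" "psd d"
    by (auto simp: finite_pos_def pos_alg_iff)
  have cb: "a - b \<in> cbounded_ops" "c - d \<in> cbounded_ops" "op_scaleC \<i> (c - d) \<in> cbounded_ops"
    by (intro alg_cbounded alg_intros A)+
  have adj: "op_adj (a - b) = a - b" "op_adj (c - d) = c - d"
    using cb A by (simp_all add: op_adj_self_adjoint[symmetric] self_adjoint_diff psd_self_adjoint)
  have "op_adj x = x"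
    using x by (simp add: op_adj_self_adjoint[symmetric] alg_cbounded psd_self_adjoint)
  \<comment> \<open>Comparing \<open>x\<close> with its adjoint isolates the imaginary part.\<close>
  then have eq: "op_scaleC (- \<i>) (c - d) = op_scaleC \<i> (c - d)"
    unfolding x_eq using cb by (simp add: op_adj_add op_adj_op_scaleC adj)
  have "c - d = 0"
  proof (rule blinfun_eqI)
    fix u
    let ?w = "blinfun_apply (c - d) u"
    have "\<i> *\<^sub>C ((- \<i>) *\<^sub>C ?w) = \<i> *\<^sub>C (\<i> *\<^sub>C ?w)"
      using arg_cong[OF eq, of "\<lambda>T. \<i> *\<^sub>C blinfun_apply T u"] by (simp add: op_scaleC.rep_eq)
    moreover have "\<i> *\<^sub>C ((- \<i>) *\<^sub>C ?w) = ?w"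
      using scaleC_of_real[of 1 ?w] by (simp add: scaleC_scaleC)
    moreover have "\<i> *\<^sub>C (\<i> *\<^sub>C ?w) = - ?w"
      using scaleC_of_real[of "-1" ?w] by (simp add: scaleC_scaleC)
    ultimately have "?w = - ?w" by simp
    then have "?w + ?w = 0" by (subst (1) \<open>?w = - ?w\<close>) (rule left_minus)
    then have "2 *\<^sub>R ?w = 0" by (simp only: scaleR_2)
    then show "?w = blinfun_apply 0 u" by simp
  qed
  then have cd: "c = d" and "a = x + b"
    using x_eq by (simp_all add: op_scaleC_zero)
  then have "\<phi> a = \<phi> x + \<phi> b"
    using x A by (simp add: weight_add)
  then have "enn2real (\<phi> a) = enn2real (\<phi> x) + enn2real (\<phi> b)"
    using x A by (simp add: enn2real_plus)
  then show "v = Complex (enn2real (\<phi> x)) 0"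
    by (simp add: v cd)
qed

end

section \<open>The completion and the contractions induced on it\<close>

locale weight_space = vn_weight \<A> \<phi> for \<A> :: "('h::chilbert \<Rightarrow>\<^sub>L 'h) set" and \<phi> +
  fixes \<Lambda> :: "('h \<Rightarrow>\<^sub>L 'h) \<Rightarrow> 'k::chilbert"
  assumes completion: "weight_completion \<A> \<phi> \<Lambda>"
begin

abbreviation "\<A>\<^sub>0 \<equiv> sq_integrable_sym \<A> \<phi>"

lemma Lambda_add: "a \<in> \<A>\<^sub>0 \<Longrightarrow> b \<in> \<A>\<^sub>0 \<Longrightarrow> \<Lambda> (a + b) = \<Lambda> a + \<Lambda> b"
  using completion unfolding weight_completion_def by blast

lemma Lambda_scaleC: "a \<in> \<A>\<^sub>0 \<Longrightarrow> \<Lambda> (op_scaleC c a) = c *\<^sub>C \<Lambda> a"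
  using completion unfolding weight_completion_def by blast

lemma Lambda_dense: "closure (\<Lambda> ` \<A>\<^sub>0) = UNIV"
  using completion unfolding weight_completion_def by blast

lemma Lambda_scaleR: "a \<in> \<A>\<^sub>0 \<Longrightarrow> \<Lambda> (r *\<^sub>R a) = r *\<^sub>R \<Lambda> a"
  using Lambda_scaleC[of a "complex_of_real r"] by (simp add: op_scaleC_of_real scaleC_of_real)

lemma Lambda_diff: "a \<in> \<A>\<^sub>0 \<Longrightarrow> b \<in> \<A>\<^sub>0 \<Longrightarrow> \<Lambda> (a - b) = \<Lambda> a - \<Lambda> b"
  using Lambda_add[of a "(-1) *\<^sub>R b"] Lambda_scaleR[of b "-1"] sym_scaleR[of b "-1"] by simp

lemma Lambda_0: "\<Lambda> 0 = 0"
  using Lambda_scaleR[OF sym_0, of 0] by simp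

lemma Lambda_sum: "(\<And>i. i \<in> I \<Longrightarrow> f i \<in> \<A>\<^sub>0) \<Longrightarrow> \<Lambda> (sum f I) = (\<Sum>i\<in>I. \<Lambda> (f i))"
  by (induction I rule: infinite_finite_induct) (auto simp: Lambda_0 Lambda_add sym_sum)

text \<open>Every comparison between norms in the completion and weights passes through this
  identity.\<close>

lemma norm_Lambda:
  assumes a: "a \<in> \<A>\<^sub>0"
  shows "\<phi> (op_adj a o\<^sub>L a) = ennreal ((norm (\<Lambda> a))\<^sup>2)"
proof -
  have "complex_of_real ((norm (\<Lambda> a))\<^sup>2) = weight_ext \<A> \<phi> (op_adj a o\<^sub>L a)"
    using completion a unfolding weight_completion_def cinner_self[symmetric] by blast
  also have "\<dots> = Complex (enn2real (\<phi> (op_adj a o\<^sub>L a))) 0"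
    using a sym_finite[OF a]
    by (intro weight_ext_finite_pos alg_intros psd_op_adj_comp alg_cbounded sym_alg)
  finally have "(norm (\<Lambda> a))\<^sup>2 = enn2real (\<phi> (op_adj a o\<^sub>L a))"
    by (simp add: complex_eq_iff)
  then show ?thesis using sym_finite[OF a] by simp
qed

lemma norm_Lambda_self_adjoint:
  "a \<in> \<A>\<^sub>0 \<Longrightarrow> self_adjoint a \<Longrightarrow> \<phi> (a o\<^sub>L a) = ennreal ((norm (\<Lambda> a))\<^sup>2)"
  using norm_Lambda[of a] op_adj_self_adjoint[OF alg_cbounded[OF sym_alg]] by simp

lemma norm_Lambda_le:
  assumes "a \<in> \<A>\<^sub>0" "b \<in> \<A>\<^sub>0" "\<phi> (op_adj a o\<^sub>L a) \<le> \<phi> (op_adj b o\<^sub>L b)"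
  shows "norm (\<Lambda> a) \<le> norm (\<Lambda> b)"
  using assms(3) by (simp add: norm_Lambda assms(1,2))

lemma subspace_Lambda: "subspace (\<Lambda> ` \<A>\<^sub>0)"
proof (rule subspaceI)
  show "0 \<in> \<Lambda> ` \<A>\<^sub>0" using Lambda_0 sym_0 by (metis imageI)
  show "x + y \<in> \<Lambda> ` \<A>\<^sub>0" if "x \<in> \<Lambda> ` \<A>\<^sub>0" "y \<in> \<Lambda> ` \<A>\<^sub>0" for x y
    using that by (auto simp: Lambda_add[symmetric] intro: sym_add)
  show "c *\<^sub>R x \<in> \<Lambda> ` \<A>\<^sub>0" if "x \<in> \<Lambda> ` \<A>\<^sub>0" for c x
    using that by (auto simp: Lambda_scaleR[symmetric] intro: sym_scaleR)
qed

context
  fixes \<sigma> :: "('h \<Rightarrow>\<^sub>L 'h) \<Rightarrow> ('h \<Rightarrow>\<^sub>L 'h)"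
  assumes \<sigma>: "positive_linear_map \<A> \<sigma>" "\<sigma> id_blinfun = id_blinfun" "completely_positive \<A> \<sigma>"
    "invariant_map \<A> \<phi> \<sigma>"
begin

lemma weight_map_sq_le:
  assumes a: "a \<in> \<A>"
  shows "\<phi> (op_adj (\<sigma> a) o\<^sub>L \<sigma> a) \<le> \<phi> (op_adj a o\<^sub>L a)"
proof -
  have "\<phi> (op_adj (\<sigma> a) o\<^sub>L \<sigma> a) \<le> \<phi> (\<sigma> (op_adj a o\<^sub>L a))"
    by (intro weight_mono alg_intros map_alg[OF \<sigma>(1)] psd_op_adj_comp alg_cbounded a
        Schwarz_completely_positive[OF \<sigma>(1-3)])
  also have "\<dots> = \<phi> (op_adj a o\<^sub>L a)"
    using \<sigma>(4) a unfolding invariant_map_def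
    by (simp add: pos_alg_iff psd_op_adj_comp alg_cbounded alg_intros)
  finally show ?thesis .
qed

lemma map_sym:
  assumes a: "a \<in> \<A>\<^sub>0"
  shows "\<sigma> a \<in> \<A>\<^sub>0"
proof (rule symI)
  show "\<phi> (op_adj (\<sigma> a) o\<^sub>L \<sigma> a) < \<infinity>"
    using weight_map_sq_le[OF sym_alg[OF a]] sym_finite[OF a] by (rule order_le_less_trans)
  show "\<phi> (op_adj (op_adj (\<sigma> a)) o\<^sub>L op_adj (\<sigma> a)) < \<infinity>"
    using weight_map_sq_le[OF alg_adj[OF sym_alg[OF a]]] sym_finite[OF sym_adj[OF a]]
    unfolding map_adj[OF \<sigma>(1) sym_alg[OF a]] by (rule order_le_less_trans)
qed (intro map_alg[OF \<sigma>(1)] sym_alg a)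

text \<open>The Schwarz inequality and invariance give contractivity, hence a well-defined map on
  the image of \<Lambda> and its continuous extension; density makes the extension unique, as
  \<open>THE\<close> demands.\<close>

lemma induced_op_properties:
  shows "\<And>b. b \<in> \<A>\<^sub>0 \<Longrightarrow> blinfun_apply (induced_op \<A> \<phi> \<Lambda> \<sigma>) (\<Lambda> b) = \<Lambda> (\<sigma> b)"
    and "\<And>x. norm (blinfun_apply (induced_op \<A> \<phi> \<Lambda> \<sigma>) x) \<le> norm x"
proof -
  have contr: "norm (\<Lambda> (\<sigma> b)) \<le> norm (\<Lambda> b)" if "b \<in> \<A>\<^sub>0" for b
    using that by (intro norm_Lambda_le map_sym weight_map_sq_le sym_alg)
  \<comment> \<open>A representative is chosen; contractivity applied to the difference of two
    representatives shows that the choice does not matter.\<close>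
  define f where "f x = \<Lambda> (\<sigma> (SOME b. b \<in> \<A>\<^sub>0 \<and> \<Lambda> b = x))" for x
  have f: "f (\<Lambda> b) = \<Lambda> (\<sigma> b)" if b: "b \<in> \<A>\<^sub>0" for b
  proof -
    define c where "c = (SOME c. c \<in> \<A>\<^sub>0 \<and> \<Lambda> c = \<Lambda> b)"
    have c: "c \<in> \<A>\<^sub>0" "\<Lambda> c = \<Lambda> b"
      using someI[of "\<lambda>c. c \<in> \<A>\<^sub>0 \<and> \<Lambda> c = \<Lambda> b" b] b by (auto simp: c_def)
    have "norm (\<Lambda> (\<sigma> (c - b))) \<le> norm (\<Lambda> (c - b))" by (intro contr sym_diff c b)
    then have "\<Lambda> (\<sigma> (c - b)) = 0" using c b by (simp add: Lambda_diff)
    then show ?thesis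
      using c b by (simp add: f_def c_def[symmetric] map_diff[OF \<sigma>(1)] sym_alg Lambda_diff map_sym)
  qed
  obtain T where T: "\<And>x. x \<in> \<Lambda> ` \<A>\<^sub>0 \<Longrightarrow> blinfun_apply T x = f x" "\<And>x. norm (blinfun_apply T x) \<le> norm x"
  proof (rule contraction_extension[OF subspace_Lambda Lambda_dense, of f])
    fix x y :: 'k and r :: real
    assume "x \<in> \<Lambda> ` \<A>\<^sub>0"
    then obtain a where a: "a \<in> \<A>\<^sub>0" "x = \<Lambda> a" by blast
    show "norm (f x) \<le> norm x" using a contr by (simp add: f)
    show "f (r *\<^sub>R x) = r *\<^sub>R f x"
      using a by (simp add: Lambda_scaleR[symmetric] f sym_scaleR map_scaleR[OF \<sigma>(1)] sym_alg map_sym)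
    assume "y \<in> \<Lambda> ` \<A>\<^sub>0"
    then obtain b where b: "b \<in> \<A>\<^sub>0" "y = \<Lambda> b" by blast
    show "f (x + y) = f x + f y"
      using a b by (simp add: Lambda_add[symmetric] f sym_add map_add[OF \<sigma>(1)] sym_alg map_sym)
  qed blast
  have "induced_op \<A> \<phi> \<Lambda> \<sigma> = T"
    unfolding induced_op_def
  proof (rule the_equality)
    show "\<forall>b\<in>\<A>\<^sub>0. blinfun_apply T (\<Lambda> b) = \<Lambda> (\<sigma> b)" using T f by simp
    show "S = T" if "\<forall>b\<in>\<A>\<^sub>0. blinfun_apply S (\<Lambda> b) = \<Lambda> (\<sigma> b)" for S
      using that T f by (intro blinfun_eq_on_dense[OF Lambda_dense]) auto
  qed
  with T f show "\<And>b. b \<in> \<A>\<^sub>0 \<Longrightarrow> blinfun_apply (induced_op \<A> \<phi> \<Lambda> \<sigma>) (\<Lambda> b) = \<Lambda> (\<sigma> b)"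
    "\<And>x. norm (blinfun_apply (induced_op \<A> \<phi> \<Lambda> \<sigma>) x) \<le> norm x" by auto
qed

end

end

section \<open>A mean ergodic theorem for two commuting recurrences\<close>

text \<open>Since r = p r + (1 - p) r, the terms with m \<ge> 1 split into a forward and a backward
  telescoping sum, together bounded by 2 Y. The term m = 0, where the recurrence starts differently,
  contributes another 2 Y.\<close>

lemma telescoping_norm_le:
  fixes r :: "nat \<Rightarrow> 'a::real_normed_vector"
  assumes r: "\<And>m. norm (r m) \<le> Y" and p: "0 \<le> p" "p \<le> 1" and d0: "d 0 = r 0 - r 1"
    and d: "\<And>m. 1 \<le> m \<Longrightarrow> d m = r m - (p *\<^sub>R r (m + 1) + (1 - p) *\<^sub>R r (m - 1))"
  shows "norm (\<Sum>m<k. d m) \<le> 4 * Y"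
proof (cases k)
  case 0
  moreover have "0 \<le> Y" using r[of 0] norm_ge_zero[of "r 0"] by linarith
  ultimately show ?thesis by simp
next
  case (Suc j)
  have "(\<Sum>m<Suc j. d m) = (r 0 - r 1) + (p *\<^sub>R (r 1 - r (Suc j)) + (1 - p) *\<^sub>R (r j - r 0))"
  proof (induction j)
    case 0
    then show ?case by (simp add: d0)
  next
    case (Suc j)
    then show ?case by (simp add: d algebra_simps)
  qed
  then have "norm (\<Sum>m<k. d m) \<le> norm (r 0 - r 1) + (p * norm (r 1 - r (Suc j)) + (1 - p) * norm (r j - r 0))"
    unfolding Suc using p by (auto intro!: order_trans[OF norm_triangle_ineq] add_left_mono)
  also have "\<dots> \<le> 2 * Y + (p * (2 * Y) + (1 - p) * (2 * Y))"
  proof -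
    have "norm (r i - r j) \<le> 2 * Y" for i j
      using norm_triangle_ineq4[of "r i" "r j"] r[of i] r[of j] by linarith
    then show ?thesis using p by (intro add_mono mult_left_mono) auto
  qed
  finally show ?thesis by (simp add: algebra_simps)
qed

text \<open>Compare the terms linear in t of |T (g + t y)|^2 \<le> |g + t y|^2. In other words, the
  adjoint of a contraction fixes the same vector.\<close>

lemma contraction_fixed_vector_orthogonal:
  fixes T :: "'a::real_inner \<Rightarrow>\<^sub>L 'a"
  assumes T: "\<And>x. norm (blinfun_apply T x) \<le> norm x" and g: "blinfun_apply T g = g"
  shows "(y - blinfun_apply T y) \<bullet> g = 0"
proof -
  let ?B = "(y - blinfun_apply T y) \<bullet> g"
  let ?Y = "(norm y)\<^sup>2"
  have "?B\<^sup>2 \<le> 0 * ?Y"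
  proof (rule nonneg_quadratic_discriminant)
    fix t :: real
    have "(norm (blinfun_apply T (g + t *\<^sub>R y)))\<^sup>2 \<le> (norm (g + t *\<^sub>R y))\<^sup>2"
      by (intro power_mono T) simp
    moreover have "(norm (g + t *\<^sub>R v))\<^sup>2 = (norm g)\<^sup>2 + 2 * t * (v \<bullet> g) + t\<^sup>2 * (norm v)\<^sup>2" for v
      unfolding power2_norm_eq_inner
      by (simp add: inner_simps inner_commute power2_eq_square algebra_simps)
    moreover have "0 \<le> t\<^sup>2 * (norm (blinfun_apply T y))\<^sup>2" by simp
    moreover have "blinfun_apply T (g + t *\<^sub>R y) = g + t *\<^sub>R blinfun_apply T y"
      by (simp add: blinfun.bilinear_simps g)
    moreover have "2 * t * ?B = 2 * t * (y \<bullet> g) - 2 * t * (blinfun_apply T y \<bullet> g)"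
      by (simp add: inner_diff_left algebra_simps)
    ultimately show "0 \<le> 0 + 2 * t * ?B + t\<^sup>2 * ?Y"
      by (smt (verit))
  qed simp
  then show ?thesis by simp
qed

text \<open>Orthogonality gives <u, T u> = |u|^2, so |u - T u|^2 = |T u|^2 - |u|^2 \<le> 0.\<close>

lemma contraction_fixed_vectorI:
  fixes T :: "'a::real_inner \<Rightarrow>\<^sub>L 'a"
  assumes T: "\<And>x. norm (blinfun_apply T x) \<le> norm x" and u: "(u - blinfun_apply T u) \<bullet> u = 0"
  shows "blinfun_apply T u = u"
proof -
  have "(norm (blinfun_apply T u))\<^sup>2 \<le> (norm u)\<^sup>2" by (intro power_mono T) simp
  then have "(norm (u - blinfun_apply T u))\<^sup>2 \<le> 0"
    using u unfolding power2_norm_eq_inner by (simp add: inner_simps inner_commute)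
  then show ?thesis by simp
qed

lemma subspace_closure:
  fixes V :: "'a::real_normed_vector set"
  assumes V: "subspace V"
  shows "subspace (closure V)"
proof (rule subspaceI)
  show "0 \<in> closure V" using subspace_0[OF V] closure_subset by blast
  show "x + y \<in> closure V" if x: "x \<in> closure V" and y: "y \<in> closure V" for x y
  proof -
    obtain s t where "\<forall>n. s n \<in> V" "s \<longlonglongrightarrow> x" "\<forall>n. t n \<in> V" "t \<longlonglongrightarrow> y"
      using x y unfolding closure_sequential by blast
    then show ?thesis
      unfolding closure_sequential
      by (intro exI[of _ "\<lambda>n. s n + t n"]) (auto intro: tendsto_add subspace_add[OF V])
  qed
  show "c *\<^sub>R x \<in> closure V" if x: "x \<in> closure V" for c x
  proof -
    obtain s where "\<forall>n. s n \<in> V" "s \<longlonglongrightarrow> x"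
      using x unfolding closure_sequential by blast
    then show ?thesis
      unfolding closure_sequential
      by (intro exI[of _ "\<lambda>n. c *\<^sub>R s n"]) (auto intro: tendsto_scaleR subspace_scale[OF V])
  qed
qed

text \<open>The bound on \<open>R\<close> holds on \<open>K\<close> only, so x must be split into
  coboundaries and a fixed vector inside \<open>K\<close>. Nevertheless x - u is orthogonal to all
  fixed vectors, also to those outside \<open>K\<close>.\<close>

lemma double_mean_ergodic:
  fixes T\<^sub>1 T\<^sub>2 :: "'a::{real_inner,complete_space} \<Rightarrow>\<^sub>L 'a" and R :: "nat \<Rightarrow> nat \<Rightarrow> 'a \<Rightarrow>\<^sub>L 'a"
  assumes T\<^sub>1: "\<And>x. norm (blinfun_apply T\<^sub>1 x) \<le> norm x" and T\<^sub>2: "\<And>x. norm (blinfun_apply T\<^sub>2 x) \<le> norm x"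
    and K: "subspace K" "closed K"
    and TK: "\<And>y. y \<in> K \<Longrightarrow> blinfun_apply T\<^sub>1 y \<in> K" "\<And>y. y \<in> K \<Longrightarrow> blinfun_apply T\<^sub>2 y \<in> K"
    and R: "\<And>m n y. y \<in> K \<Longrightarrow> norm (blinfun_apply (R m n) y) \<le> norm y"
    and fixed: "\<And>m n u. blinfun_apply T\<^sub>1 u = u \<Longrightarrow> blinfun_apply T\<^sub>2 u = u \<Longrightarrow> blinfun_apply (R m n) u = u"
    and p: "0 \<le> p\<^sub>1" "p\<^sub>1 \<le> 1" "0 \<le> p\<^sub>2" "p\<^sub>2 \<le> 1"
    and rec1: "\<And>n y. blinfun_apply (R 0 n) (blinfun_apply T\<^sub>1 y) = blinfun_apply (R 1 n) y"
      "\<And>m n y. 1 \<le> m \<Longrightarrow> blinfun_apply (R m n) (blinfun_apply T\<^sub>1 y) =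
         p\<^sub>1 *\<^sub>R blinfun_apply (R (m + 1) n) y + (1 - p\<^sub>1) *\<^sub>R blinfun_apply (R (m - 1) n) y"
    and rec2: "\<And>m y. blinfun_apply (R m 0) (blinfun_apply T\<^sub>2 y) = blinfun_apply (R m 1) y"
      "\<And>m n y. 1 \<le> n \<Longrightarrow> blinfun_apply (R m n) (blinfun_apply T\<^sub>2 y) =
         p\<^sub>2 *\<^sub>R blinfun_apply (R m (n + 1)) y + (1 - p\<^sub>2) *\<^sub>R blinfun_apply (R m (n - 1)) y"
    and x: "x \<in> K"
  obtains u where "blinfun_apply T\<^sub>1 u = u" "blinfun_apply T\<^sub>2 u = u"
    "\<And>g. blinfun_apply T\<^sub>1 g = g \<Longrightarrow> blinfun_apply T\<^sub>2 g = g \<Longrightarrow> (x - u) \<bullet> g = 0"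
    "((\<lambda>(k\<^sub>1, k\<^sub>2). (1 / (real k\<^sub>1 * real k\<^sub>2)) *\<^sub>R (\<Sum>m<k\<^sub>1. \<Sum>n<k\<^sub>2. blinfun_apply (R m n) x)) \<longlongrightarrow> u)
       (sequentially \<times>\<^sub>F sequentially)"
proof -
  define D where "D = {(y - blinfun_apply T\<^sub>1 y) + (z - blinfun_apply T\<^sub>2 z) | y z. y \<in> K \<and> z \<in> K}"
  have DI: "(y - blinfun_apply T\<^sub>1 y) + (z - blinfun_apply T\<^sub>2 z) \<in> D" if "y \<in> K" "z \<in> K" for y z
    using that by (auto simp: D_def)
  have D: "subspace D"
  proof (rule subspaceI)
    show "0 \<in> D" using DI[of 0 0] subspace_0[OF K(1)] by (simp add: blinfun.bilinear_simps)
    fix v assume "v \<in> D"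
    then obtain y z where v: "y \<in> K" "z \<in> K" "v = (y - blinfun_apply T\<^sub>1 y) + (z - blinfun_apply T\<^sub>2 z)"
      by (auto simp: D_def)
    show "c *\<^sub>R v \<in> D" for c
      using DI[of "c *\<^sub>R y" "c *\<^sub>R z"] v subspace_scale[OF K(1)]
      by (simp add: blinfun.bilinear_simps scaleR_add_right scaleR_diff_right)
    fix w assume "w \<in> D"
    then obtain y' z' where w: "y' \<in> K" "z' \<in> K" "w = (y' - blinfun_apply T\<^sub>1 y') + (z' - blinfun_apply T\<^sub>2 z')"
      by (auto simp: D_def)
    have "v + w = ((y + y') - blinfun_apply T\<^sub>1 (y + y')) + ((z + z') - blinfun_apply T\<^sub>2 (z + z'))"
      unfolding v w by (simp add: blinfun.bilinear_simps algebra_simps)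
    also have "\<dots> \<in> D" by (intro DI subspace_add[OF K(1)] v w)
    finally show "v + w \<in> D" .
  qed
  have DK: "D \<subseteq> K"
    unfolding D_def using TK by (auto intro!: subspace_add[OF K(1)] subspace_diff[OF K(1)])
  then have WK: "closure D \<subseteq> K" using K(2) by (rule closure_minimal)
  obtain w where w: "w \<in> closure D" "\<And>v. v \<in> closure D \<Longrightarrow> (x - w) \<bullet> v = 0"
    using orthogonal_decomposition[OF subspace_closure[OF D] closed_closure, of x] by blast
  define u where "u = x - w"
  have uK: "u \<in> K" unfolding u_def using w(1) WK x by (intro subspace_diff[OF K(1)]) auto
  \<comment> \<open>As \<open>u\<close> lies in \<open>K\<close>, its own coboundaries belong to
    \<open>D\<close> and are therefore orthogonal to \<open>u\<close>.\<close>
  have orth: "(u - blinfun_apply T\<^sub>1 u) \<bullet> u = 0" "(u - blinfun_apply T\<^sub>2 u) \<bullet> u = 0"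
    using w(2)[of "u - blinfun_apply T\<^sub>1 u"] w(2)[of "u - blinfun_apply T\<^sub>2 u"]
      DI[OF uK subspace_0[OF K(1)]] DI[OF subspace_0[OF K(1)] uK] closure_subset[of D]
    by (auto simp: u_def[symmetric] blinfun.zero_right inner_commute subset_iff)
  have u: "blinfun_apply T\<^sub>1 u = u" "blinfun_apply T\<^sub>2 u = u"
    by (rule contraction_fixed_vectorI[OF T\<^sub>1 orth(1)], rule contraction_fixed_vectorI[OF T\<^sub>2 orth(2)])
  define S where "S k\<^sub>1 k\<^sub>2 y = (1 / (real k\<^sub>1 * real k\<^sub>2)) *\<^sub>R (\<Sum>m<k\<^sub>1. \<Sum>n<k\<^sub>2. blinfun_apply (R m n) y)" for k\<^sub>1 k\<^sub>2 y
  have S_add: "S k\<^sub>1 k\<^sub>2 (y + z) = S k\<^sub>1 k\<^sub>2 y + S k\<^sub>1 k\<^sub>2 z" for k\<^sub>1 k\<^sub>2 y z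
    by (simp add: S_def blinfun.bilinear_simps sum.distrib scaleR_add_right)
  have S_norm: "norm (S k\<^sub>1 k\<^sub>2 y) \<le> norm y" if "y \<in> K" for k\<^sub>1 k\<^sub>2 y
  proof -
    have "norm (\<Sum>m<k\<^sub>1. \<Sum>n<k\<^sub>2. blinfun_apply (R m n) y) \<le> (\<Sum>m<k\<^sub>1. \<Sum>n<k\<^sub>2. norm y)"
      by (intro order_trans[OF norm_sum] sum_mono R that)
    then show ?thesis
      \<comment> \<open>An empty average is 0, because \<open>1 / 0 = 0\<close>.\<close>
      by (cases "k\<^sub>1 = 0 \<or> k\<^sub>2 = 0") (auto simp: S_def divide_simps mult_ac)
  qed
  have S_cob1: "norm (S k\<^sub>1 k\<^sub>2 (y - blinfun_apply T\<^sub>1 y)) \<le> 4 * norm y / real k\<^sub>1" if y: "y \<in> K" for k\<^sub>1 k\<^sub>2 y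
  proof -
    have "norm (\<Sum>m<k\<^sub>1. blinfun_apply (R m n) (y - blinfun_apply T\<^sub>1 y)) \<le> 4 * norm y" for n
      using R[OF y] p rec1
      by (intro telescoping_norm_le[of "\<lambda>m. blinfun_apply (R m n) y" _ p\<^sub>1]) (auto simp: blinfun.diff_right)
    then have "norm (\<Sum>n<k\<^sub>2. \<Sum>m<k\<^sub>1. blinfun_apply (R m n) (y - blinfun_apply T\<^sub>1 y)) \<le> (\<Sum>n<k\<^sub>2. 4 * norm y)"
      by (rule order_trans[OF norm_sum sum_mono])
    then show ?thesis
      \<comment> \<open>The first index must become the inner one, since it is the sum over it that
        telescopes.\<close>
      unfolding S_def by (subst sum.swap, cases "k\<^sub>1 = 0 \<or> k\<^sub>2 = 0") (auto simp: divide_simps mult_ac)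
  qed
  have S_cob2: "norm (S k\<^sub>1 k\<^sub>2 (y - blinfun_apply T\<^sub>2 y)) \<le> 4 * norm y / real k\<^sub>2" if y: "y \<in> K" for k\<^sub>1 k\<^sub>2 y
  proof -
    have "norm (\<Sum>n<k\<^sub>2. blinfun_apply (R m n) (y - blinfun_apply T\<^sub>2 y)) \<le> 4 * norm y" for m
      using R[OF y] p rec2
      by (intro telescoping_norm_le[of "\<lambda>n. blinfun_apply (R m n) y" _ p\<^sub>2]) (auto simp: blinfun.diff_right)
    then have "norm (\<Sum>m<k\<^sub>1. \<Sum>n<k\<^sub>2. blinfun_apply (R m n) (y - blinfun_apply T\<^sub>2 y)) \<le> (\<Sum>m<k\<^sub>1. 4 * norm y)"
      by (rule order_trans[OF norm_sum sum_mono])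
    then show ?thesis
      unfolding S_def by (cases "k\<^sub>1 = 0 \<or> k\<^sub>2 = 0") (auto simp: divide_simps mult_ac)
  qed
  let ?F = "sequentially \<times>\<^sub>F sequentially :: (nat \<times> nat) filter"
  have S_D: "((\<lambda>k. S (fst k) (snd k) v) \<longlongrightarrow> 0) ?F" if "v \<in> D" for v
  proof -
    obtain y z where v: "y \<in> K" "z \<in> K" "v = (y - blinfun_apply T\<^sub>1 y) + (z - blinfun_apply T\<^sub>2 z)"
      using \<open>v \<in> D\<close> by (auto simp: D_def)
    have "norm (S (fst k) (snd k) v) \<le> 4 * norm y / real (fst k) + 4 * norm z / real (snd k)" for k
      unfolding v(3) S_add
      by (rule order_trans[OF norm_triangle_ineq add_mono[OF S_cob1[OF v(1)] S_cob2[OF v(2)]]])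
    moreover have "((\<lambda>k. 4 * norm y / real (fst k) + 4 * norm z / real (snd k)) \<longlongrightarrow> 0 + 0) ?F"
      by (rule tendsto_add[OF filterlim_compose[OF lim_const_over_n filterlim_fst]
          filterlim_compose[OF lim_const_over_n filterlim_snd]])
    ultimately show ?thesis
      by (simp only: add_0_right) (rule Lim_null_comparison[OF always_eventually[OF allI]])
  qed
  have S_w: "((\<lambda>k. S (fst k) (snd k) w) \<longlongrightarrow> 0) ?F"
  proof (rule tendstoI, simp add: dist_norm)
    fix e :: real assume e: "0 < e"
    then obtain v where v: "v \<in> D" "dist v w < e / 2"
      using w(1) unfolding closure_approachable by (meson half_gt_zero)
    have "w - v \<in> K" using w(1) v(1) WK DK by (intro subspace_diff[OF K(1)]) auto
    then have wv: "norm (S k\<^sub>1 k\<^sub>2 (w - v)) < e / 2" for k\<^sub>1 k\<^sub>2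
      using S_norm[of "w - v" k\<^sub>1 k\<^sub>2] v(2) by (simp add: dist_norm norm_minus_commute)
    have "\<forall>\<^sub>F k in ?F. norm (S (fst k) (snd k) v) < e / 2"
      using tendstoD[OF S_D[OF v(1)], of "e / 2"] e by (simp add: dist_norm)
    then show "\<forall>\<^sub>F k in ?F. norm (S (fst k) (snd k) w) < e"
    proof (rule eventually_mono)
      fix k :: "nat \<times> nat" assume k: "norm (S (fst k) (snd k) v) < e / 2"
      have "S (fst k) (snd k) w = S (fst k) (snd k) (w - v) + S (fst k) (snd k) v"
        using S_add[of "fst k" "snd k" "w - v" v] by simp
      then have "norm (S (fst k) (snd k) w) \<le> norm (S (fst k) (snd k) (w - v)) + norm (S (fst k) (snd k) v)"
        by (simp only: norm_triangle_ineq)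
      then show "norm (S (fst k) (snd k) w) < e"
        using k wv[of "fst k" "snd k"] by linarith
    qed
  qed
  have S_u: "S k\<^sub>1 k\<^sub>2 u = u" if "1 \<le> k\<^sub>1" "1 \<le> k\<^sub>2" for k\<^sub>1 k\<^sub>2
    using that by (simp add: S_def fixed[OF u] sum_constant_scaleR)
  have "((\<lambda>k. S (fst k) (snd k) w + u) \<longlongrightarrow> 0 + u) ?F"
    by (intro tendsto_add S_w tendsto_const)
  moreover have "\<forall>\<^sub>F k in ?F. S (fst k) (snd k) w + u = S (fst k) (snd k) x"
  proof -
    have x_eq: "x = w + u" by (simp add: u_def)
    show ?thesis
      \<comment> \<open>The identity starts at index 1: an empty average of \<open>u\<close> would
        be 0 and not \<open>u\<close>.\<close>
      unfolding eventually_prod_sequentially x_eq S_add by (rule exI[of _ 1]) (simp add: S_u)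
  qed
  ultimately have "((\<lambda>k. S (fst k) (snd k) x) \<longlongrightarrow> 0 + u) ?F"
    by (rule Lim_transform_eventually)
  then have lim: "((\<lambda>(k\<^sub>1, k\<^sub>2). (1 / (real k\<^sub>1 * real k\<^sub>2)) *\<^sub>R (\<Sum>m<k\<^sub>1. \<Sum>n<k\<^sub>2. blinfun_apply (R m n) x)) \<longlongrightarrow> u) ?F"
    by (simp add: S_def case_prod_unfold)
  have "(x - u) \<bullet> g = 0" if g: "blinfun_apply T\<^sub>1 g = g" "blinfun_apply T\<^sub>2 g = g" for g
  proof -
    have "D \<subseteq> {v. v \<bullet> g = 0}"
      unfolding D_def using contraction_fixed_vector_orthogonal[OF T\<^sub>1 g(1)]
        contraction_fixed_vector_orthogonal[OF T\<^sub>2 g(2)] by (auto simp: inner_add_left)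
    then have "closure D \<subseteq> {v. v \<bullet> g = 0}"
      by (rule closure_minimal) (intro closed_Collect_eq continuous_intros)
    then show ?thesis using w(1) by (auto simp: u_def)
  qed
  then show thesis using that u lim by blast
qed

text \<open>The recurrence solved for its highest term, a polynomial in \<open>T\<close>. It
  provides a bounded operator on the whole space for each index before any bound uniform in the
  index is known.\<close>

fun recurrence_op :: "real \<Rightarrow> ('a::real_normed_vector \<Rightarrow>\<^sub>L 'a) \<Rightarrow> nat \<Rightarrow> ('a \<Rightarrow>\<^sub>L 'a)" where
  "recurrence_op p T 0 = id_blinfun"
| "recurrence_op p T (Suc 0) = T"
| "recurrence_op p T (Suc (Suc m)) =
     (1 / p) *\<^sub>R ((T o\<^sub>L recurrence_op p T (Suc m)) - (1 - p) *\<^sub>R recurrence_op p T m)"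

lemma recurrence_op_step:
  assumes "0 < p" "1 \<le> m"
  shows "blinfun_apply T (blinfun_apply (recurrence_op p T m) x) =
    p *\<^sub>R blinfun_apply (recurrence_op p T (m + 1)) x + (1 - p) *\<^sub>R blinfun_apply (recurrence_op p T (m - 1)) x"
proof -
  obtain j where "m = Suc j" using assms(2) by (cases m) auto
  then show ?thesis using assms(1) by (simp add: blinfun.bilinear_simps)
qed

lemma recurrence_op_commute:
  assumes "\<And>x. blinfun_apply S (blinfun_apply T x) = blinfun_apply T (blinfun_apply S x)"
  shows "blinfun_apply S (blinfun_apply (recurrence_op p T m) x) = blinfun_apply (recurrence_op p T m) (blinfun_apply S x)"
proof (induction m arbitrary: x rule: induct_nat_012)
  case (ge2 m)
  then show ?case by (simp add: blinfun.bilinear_simps assms del: recurrence_op.simps(2))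
qed (simp_all add: assms)

lemma recurrence_op_fixed:
  assumes "0 < p" "blinfun_apply T u = u"
  shows "blinfun_apply (recurrence_op p T m) u = u"
  using assms
proof (induction p T m rule: recurrence_op.induct)
  case (3 p T m)
  then have "blinfun_apply (recurrence_op p T (Suc (Suc m))) u = (1 / p) *\<^sub>R (u - (1 - p) *\<^sub>R u)"
    by (simp add: blinfun.bilinear_simps)
  also have "u - (1 - p) *\<^sub>R u = p *\<^sub>R u" by (simp add: algebra_simps)
  finally show ?case using 3 by simp
qed simp_all

section \<open>Families of maps generated by a recurrence\<close>

text \<open>One index direction of the double family. Complete positivity and invariance are assumed
  of the generator \<open>\<tau> 1\<close>; unitality and, on finite weights, invariance of the
  other maps are deduced from the recurrence.\<close>

locale recurrence_family = weight_space \<A> \<phi> \<Lambda>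
  for \<A> :: "('h::chilbert \<Rightarrow>\<^sub>L 'h) set" and \<phi> and \<Lambda> :: "('h \<Rightarrow>\<^sub>L 'h) \<Rightarrow> 'k::chilbert" +
  fixes p :: real and \<tau> :: "nat \<Rightarrow> ('h \<Rightarrow>\<^sub>L 'h) \<Rightarrow> ('h \<Rightarrow>\<^sub>L 'h)"
  assumes p: "0 < p" "p \<le> 1"
    and pos: "\<And>m. positive_linear_map \<A> (\<tau> m)"
    and \<tau>_0: "\<And>a. a \<in> \<A> \<Longrightarrow> \<tau> 0 a = a"
    and gen: "\<tau> 1 id_blinfun = id_blinfun" "completely_positive \<A> (\<tau> 1)" "invariant_map \<A> \<phi> (\<tau> 1)"
    and recurrence: "\<And>m a. 1 \<le> m \<Longrightarrow> a \<in> \<A> \<Longrightarrow>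
      \<tau> 1 (\<tau> m a) = p *\<^sub>R \<tau> (m + 1) a + (1 - p) *\<^sub>R \<tau> (m - 1) a"
begin

abbreviation "T \<equiv> induced_op \<A> \<phi> \<Lambda> (\<tau> 1)"

lemma \<tau>_Suc_Suc:
  assumes "a \<in> \<A>"
  shows "\<tau> (Suc (Suc m)) a = (1 / p) *\<^sub>R (\<tau> 1 (\<tau> (Suc m) a) - (1 - p) *\<^sub>R \<tau> m a)"
  using recurrence[of "Suc m" a] assms p by simp

lemma \<tau>_unital: "\<tau> m id_blinfun = id_blinfun"
proof (induction m rule: induct_nat_012)
  case (ge2 m)
  then have "\<tau> (Suc (Suc m)) id_blinfun = (1 / p) *\<^sub>R (id_blinfun - (1 - p) *\<^sub>R id_blinfun)"
    using gen by (simp add: \<tau>_Suc_Suc alg_id)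
  also have "id_blinfun - (1 - p) *\<^sub>R id_blinfun = p *\<^sub>R (id_blinfun :: 'h \<Rightarrow>\<^sub>L 'h)"
    by (simp add: algebra_simps)
  finally show ?case using p by simp
qed (use gen \<tau>_0 alg_id in auto)

lemma \<tau>_1_invariant: "a \<in> \<A> \<Longrightarrow> psd a \<Longrightarrow> \<phi> (\<tau> 1 a) = \<phi> a"
  using gen(3) unfolding invariant_map_def by (simp add: pos_alg_iff)

text \<open>Solving the recurrence for the highest index requires a subtraction of weights, hence
  the restriction to finite weight.\<close>

lemma \<tau>_invariant:
  assumes a: "a \<in> \<A>" "psd a" "\<phi> a < \<infinity>"
  shows "\<phi> (\<tau> m a) = \<phi> a"
proof (induction m rule: induct_nat_012)
  case (ge2 m)
  let ?x = "\<phi> (\<tau> (Suc (Suc m)) a)"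
  have \<tau>: "\<tau> m a \<in> \<A>" "psd (\<tau> m a)" for m
    using a map_alg[OF pos] map_psd[OF pos] by auto
  have "\<phi> a = \<phi> (\<tau> 1 (\<tau> (Suc m) a))"
    using ge2 \<tau> by (simp only: \<tau>_1_invariant)
  also have "\<dots> = \<phi> (p *\<^sub>R \<tau> (Suc (Suc m)) a + (1 - p) *\<^sub>R \<tau> m a)"
    using recurrence[of "Suc m" a] a by simp
  also have "\<dots> = ennreal p * ?x + ennreal (1 - p) * \<phi> a"
    using p \<tau> ge2 by (simp add: weight_add weight_scaleR alg_scaleR psd_scaleR)
  finally have eq: "\<phi> a = ennreal p * ?x + ennreal (1 - p) * \<phi> a" .
  obtain r where r: "0 \<le> r" "\<phi> a = ennreal r" using a(3) by (cases "\<phi> a") auto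
  show ?case
  proof (cases ?x)
    case (real s)
    then have "ennreal r = ennreal (p * s + (1 - p) * r)"
      using eq r p by (simp add: ennreal_mult[symmetric] ennreal_plus[symmetric] del: ennreal_plus)
    then have "r = p * s + (1 - p) * r"
      using r real p by (subst (asm) ennreal_inj) auto
    then have "p * (r - s) = 0" by (simp add: algebra_simps)
    then show ?thesis using real r p by simp
  next
    \<comment> \<open>As \<open>p\<close> is positive, an infinite value would make the right-hand
      side of \<open>eq\<close> infinite.\<close>
    case top
    then show ?thesis using eq r p by (simp add: ennreal_mult_top)
  qed
qed (use a \<tau>_0 \<tau>_1_invariant in auto)

lemma \<tau>_sym_Lambda:
  assumes b: "b \<in> \<A>\<^sub>0"
  shows "\<tau> m b \<in> \<A>\<^sub>0 \<and> \<Lambda> (\<tau> m b) = blinfun_apply (recurrence_op p T m) (\<Lambda> b)"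
proof (induction m rule: induct_nat_012)
  case 0
  show ?case using b by (simp add: \<tau>_0 sym_alg)
next
  case 1
  show ?case
    using map_sym[OF pos gen b] induced_op_properties(1)[OF pos gen b] by simp
next
  case (ge2 m)
  have "\<tau> 1 (\<tau> (Suc m) b) \<in> \<A>\<^sub>0" using ge2 map_sym[OF pos gen] by blast
  moreover have "\<Lambda> (\<tau> 1 (\<tau> (Suc m) b)) = blinfun_apply T (\<Lambda> (\<tau> (Suc m) b))"
    by (rule induced_op_properties(1)[OF pos gen, symmetric]) (use ge2 in blast)
  ultimately show ?case
    unfolding \<tau>_Suc_Suc[OF sym_alg[OF b]] using ge2
    by (simp add: sym_scaleR sym_diff Lambda_scaleR Lambda_diff blinfun.bilinear_simps)
qed

lemma T_contraction: "norm (blinfun_apply T x) \<le> norm x"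
  by (rule induced_op_properties(2)[OF pos gen])

lemma T_Lambda: "b \<in> \<A>\<^sub>0 \<Longrightarrow> blinfun_apply T (\<Lambda> b) = \<Lambda> (\<tau> 1 b)"
  by (rule induced_op_properties(1)[OF pos gen])

end

lemma double_average_op_scaleC_add:
  assumes "\<And>m n. f m n a = f m n h + op_scaleC c (f m n k)"
  shows "double_average f k\<^sub>1 k\<^sub>2 a = double_average f k\<^sub>1 k\<^sub>2 h + op_scaleC c (double_average f k\<^sub>1 k\<^sub>2 k)"
proof (rule blinfun_eqI)
  fix x
  have sumC: "c *\<^sub>C (\<Sum>i\<in>I. g i) = (\<Sum>i\<in>I. c *\<^sub>C g i)" for I and g :: "nat \<Rightarrow> 'a"
    using linear_sum[OF bounded_linear.linear[OF bounded_linear_scaleC]] .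
  show "blinfun_apply (double_average f k\<^sub>1 k\<^sub>2 a) x =
      blinfun_apply (double_average f k\<^sub>1 k\<^sub>2 h + op_scaleC c (double_average f k\<^sub>1 k\<^sub>2 k)) x"
    by (simp add: double_average_def assms blinfun.bilinear_simps blinfun.sum_left op_scaleC.rep_eq
        sum.distrib scaleR_add_right scaleC_scaleR_right sumC)
qed

text \<open>The operators induced by the \<open>\<sigma> m n\<close> need not be uniformly bounded on the whole Hilbert space, because these
  positive maps satisfy the Schwarz inequality on self-adjoint elements only.  The ergodic
  theorem is therefore applied on the closed real subspace generated by the self-adjoint part of \<open>\<A>\<^sub>0\<close>.\<close>

locale double_family = weight_space \<A> \<phi> \<Lambda> +
  X: recurrence_family \<A> \<phi> \<Lambda> p\<^sub>1 "\<lambda>m. \<sigma> m 0" + Y: recurrence_family \<A> \<phi> \<Lambda> p\<^sub>2 "\<lambda>n. \<sigma> 0 n"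
  for \<A> :: "('h::chilbert \<Rightarrow>\<^sub>L 'h) set" and \<phi> and \<Lambda> :: "('h \<Rightarrow>\<^sub>L 'h) \<Rightarrow> 'k::chilbert"
    and p\<^sub>1 p\<^sub>2 :: real and \<sigma> :: "nat \<Rightarrow> nat \<Rightarrow> ('h \<Rightarrow>\<^sub>L 'h) \<Rightarrow> ('h \<Rightarrow>\<^sub>L 'h)" +
  assumes \<sigma>_pos: "\<And>m n. positive_linear_map \<A> (\<sigma> m n)"
    and \<sigma>_comp: "\<And>m n a. a \<in> \<A> \<Longrightarrow> \<sigma> m n a = \<sigma> 0 n (\<sigma> m 0 a)"
    and \<sigma>_commute: "\<And>a. a \<in> \<A> \<Longrightarrow> \<sigma> 1 0 (\<sigma> 0 1 a) = \<sigma> 0 1 (\<sigma> 1 0 a)"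
begin

definition "R m n = recurrence_op p\<^sub>2 Y.T n o\<^sub>L recurrence_op p\<^sub>1 X.T m"

lemma \<sigma>_unital: "\<sigma> m n id_blinfun = id_blinfun"
  using \<sigma>_comp[OF alg_id, of m n] X.\<tau>_unital[of m] Y.\<tau>_unital[of n] by simp

lemma \<sigma>_sym: "b \<in> \<A>\<^sub>0 \<Longrightarrow> \<sigma> m n b \<in> \<A>\<^sub>0"
  using \<sigma>_comp[OF sym_alg, of b m n] X.\<tau>_sym_Lambda[of b m] Y.\<tau>_sym_Lambda[of "\<sigma> m 0 b" n] by simp

lemma \<sigma>_Lambda: "b \<in> \<A>\<^sub>0 \<Longrightarrow> \<Lambda> (\<sigma> m n b) = blinfun_apply (R m n) (\<Lambda> b)"
  using \<sigma>_comp[OF sym_alg, of b m n] X.\<tau>_sym_Lambda[of b m] Y.\<tau>_sym_Lambda[of "\<sigma> m 0 b" n]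
  by (simp add: R_def)

lemma T_commute: "blinfun_apply X.T (blinfun_apply Y.T x) = blinfun_apply Y.T (blinfun_apply X.T x)"
proof -
  have "X.T o\<^sub>L Y.T = Y.T o\<^sub>L X.T"
  proof (rule blinfun_eq_on_dense[OF Lambda_dense])
    fix y assume "y \<in> \<Lambda> ` \<A>\<^sub>0"
    then obtain b where b: "b \<in> \<A>\<^sub>0" "y = \<Lambda> b" by blast
    have "blinfun_apply X.T (blinfun_apply Y.T y) = \<Lambda> (\<sigma> 1 0 (\<sigma> 0 1 b))"
      unfolding b(2) Y.T_Lambda[OF b(1)] by (rule X.T_Lambda[OF \<sigma>_sym[OF b(1)]])
    moreover have "blinfun_apply Y.T (blinfun_apply X.T y) = \<Lambda> (\<sigma> 0 1 (\<sigma> 1 0 b))"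
      unfolding b(2) X.T_Lambda[OF b(1)] by (rule Y.T_Lambda[OF \<sigma>_sym[OF b(1)]])
    ultimately show "blinfun_apply (X.T o\<^sub>L Y.T) y = blinfun_apply (Y.T o\<^sub>L X.T) y"
      by (simp only: blinfun_apply_blinfun_compose \<sigma>_commute[OF sym_alg[OF b(1)]])
  qed
  from arg_cong[OF this, of "\<lambda>S. blinfun_apply S x"] show ?thesis
    by (simp only: blinfun_apply_blinfun_compose)
qed

lemma \<sigma>_norm_Lambda_le:
  assumes b: "b \<in> \<A>\<^sub>0" "self_adjoint b"
  shows "norm (\<Lambda> (\<sigma> m n b)) \<le> norm (\<Lambda> b)"
proof -
  note bA = sym_alg[OF b(1)]
  have bb: "b o\<^sub>L b \<in> \<A>" "psd (b o\<^sub>L b)" "\<phi> (b o\<^sub>L b) < \<infinity>"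
    using bA b norm_Lambda_self_adjoint[OF b] by (auto intro: alg_comp psd_square)
  have "\<phi> (\<sigma> m n b o\<^sub>L \<sigma> m n b) \<le> \<phi> (\<sigma> m n (b o\<^sub>L b))"
    by (intro weight_mono Kadison_inequality[OF \<sigma>_pos \<sigma>_unital bA b(2)] alg_comp
        map_alg[OF \<sigma>_pos] psd_square map_self_adjoint[OF \<sigma>_pos] bA b)
  also have "\<dots> = \<phi> (\<sigma> 0 n (\<sigma> m 0 (b o\<^sub>L b)))"
    by (simp only: \<sigma>_comp[OF bb(1), of m n])
  \<comment> \<open>Invariance in the first direction keeps the weight finite, so invariance in the
    second direction applies to the result.\<close>
  also have "\<dots> = \<phi> (b o\<^sub>L b)"
    using bb map_alg[OF \<sigma>_pos bb(1)] map_psd[OF \<sigma>_pos bb(1,2)]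
    by (simp add: X.\<tau>_invariant Y.\<tau>_invariant)
  finally show ?thesis
    by (simp add: norm_Lambda_self_adjoint b \<sigma>_sym map_self_adjoint[OF \<sigma>_pos] bA)
qed

definition "sa_part = closure (\<Lambda> ` {b \<in> \<A>\<^sub>0. self_adjoint b})"

lemma sa_part_subspace: "subspace sa_part"
  unfolding sa_part_def
proof (rule subspace_closure, rule subspaceI)
  let ?V = "\<Lambda> ` {b \<in> \<A>\<^sub>0. self_adjoint b}"
  show "0 \<in> ?V" using Lambda_0 sym_0 by force
  show "x + y \<in> ?V" if "x \<in> ?V" "y \<in> ?V" for x y
    using that by (auto simp: Lambda_add[symmetric] intro!: sym_add self_adjoint_add)
  show "c *\<^sub>R x \<in> ?V" if "x \<in> ?V" for c x
    using that by (auto simp: Lambda_scaleR[symmetric] intro!: sym_scaleR self_adjoint_scaleR)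
qed

lemma sa_part_closed: "closed sa_part"
  by (simp add: sa_part_def)

lemma sa_part_invariant:
  assumes "\<And>b. b \<in> \<A>\<^sub>0 \<Longrightarrow> self_adjoint b \<Longrightarrow> blinfun_apply S (\<Lambda> b) \<in> \<Lambda> ` {b \<in> \<A>\<^sub>0. self_adjoint b}"
    and "y \<in> sa_part"
  shows "blinfun_apply S y \<in> sa_part"
proof -
  have "blinfun_apply S ` sa_part \<subseteq> closure (blinfun_apply S ` (\<Lambda> ` {b \<in> \<A>\<^sub>0. self_adjoint b}))"
    unfolding sa_part_def by (intro image_closure_subset continuous_intros closed_closure closure_subset)
  also have "\<dots> \<subseteq> sa_part"
    unfolding sa_part_def using assms(1) by (intro closure_mono) blast
  finally show ?thesis using assms(2) by blast
qed

lemma R_norm_le: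
  assumes "y \<in> sa_part"
  shows "norm (blinfun_apply (R m n) y) \<le> norm y"
proof -
  have "sa_part \<subseteq> {y. norm (blinfun_apply (R m n) y) \<le> norm y}"
    unfolding sa_part_def
  proof (rule closure_minimal)
    show "closed {y. norm (blinfun_apply (R m n) y) \<le> norm y}"
      by (intro closed_Collect_le continuous_intros)
  qed (auto simp: \<sigma>_Lambda[symmetric] \<sigma>_norm_Lambda_le)
  with assms show ?thesis by blast
qed

lemma R_rec1:
  "blinfun_apply (R 0 n) (blinfun_apply X.T y) = blinfun_apply (R 1 n) y"
  "1 \<le> m \<Longrightarrow> blinfun_apply (R m n) (blinfun_apply X.T y) =
     p\<^sub>1 *\<^sub>R blinfun_apply (R (m + 1) n) y + (1 - p\<^sub>1) *\<^sub>R blinfun_apply (R (m - 1) n) y"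
proof -
  show "blinfun_apply (R 0 n) (blinfun_apply X.T y) = blinfun_apply (R 1 n) y"
    by (simp add: R_def)
  assume "1 \<le> m"
  from recurrence_op_step[OF X.p(1) this, of X.T y] recurrence_op_commute[of X.T X.T p\<^sub>1 m y, OF refl]
  have "blinfun_apply (recurrence_op p\<^sub>1 X.T m) (blinfun_apply X.T y) =
      p\<^sub>1 *\<^sub>R blinfun_apply (recurrence_op p\<^sub>1 X.T (m + 1)) y + (1 - p\<^sub>1) *\<^sub>R blinfun_apply (recurrence_op p\<^sub>1 X.T (m - 1)) y"
    by (simp only:)
  then show "blinfun_apply (R m n) (blinfun_apply X.T y) =
     p\<^sub>1 *\<^sub>R blinfun_apply (R (m + 1) n) y + (1 - p\<^sub>1) *\<^sub>R blinfun_apply (R (m - 1) n) y"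
    unfolding R_def blinfun_apply_blinfun_compose by (simp only: blinfun.add_right blinfun.scaleR_right)
qed

lemma R_rec2:
  "blinfun_apply (R m 0) (blinfun_apply Y.T y) = blinfun_apply (R m 1) y"
  "1 \<le> n \<Longrightarrow> blinfun_apply (R m n) (blinfun_apply Y.T y) =
     p\<^sub>2 *\<^sub>R blinfun_apply (R m (n + 1)) y + (1 - p\<^sub>2) *\<^sub>R blinfun_apply (R m (n - 1)) y"
proof -
  \<comment> \<open>In the second direction the generator must first pass the factor belonging to
    the first; here commutation of the generators enters.\<close>
  have comm: "blinfun_apply (recurrence_op p\<^sub>1 X.T m) (blinfun_apply Y.T y) =
      blinfun_apply Y.T (blinfun_apply (recurrence_op p\<^sub>1 X.T m) y)"
    by (rule recurrence_op_commute[OF T_commute[symmetric], symmetric])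
  then show "blinfun_apply (R m 0) (blinfun_apply Y.T y) = blinfun_apply (R m 1) y"
    by (simp add: R_def)
  assume "1 \<le> n"
  from recurrence_op_step[OF Y.p(1) this, of Y.T "blinfun_apply (recurrence_op p\<^sub>1 X.T m) y"]
    recurrence_op_commute[of Y.T Y.T p\<^sub>2 n "blinfun_apply (recurrence_op p\<^sub>1 X.T m) y", OF refl]
  show "blinfun_apply (R m n) (blinfun_apply Y.T y) =
     p\<^sub>2 *\<^sub>R blinfun_apply (R m (n + 1)) y + (1 - p\<^sub>2) *\<^sub>R blinfun_apply (R m (n - 1)) y"
    unfolding R_def blinfun_apply_blinfun_compose comm by (simp only:)
qed

abbreviation "s \<equiv> double_average \<sigma>"

lemma s_properties:
  assumes b: "b \<in> \<A>\<^sub>0" "self_adjoint b"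
  shows "s k\<^sub>1 k\<^sub>2 b \<in> \<A>\<^sub>0" "self_adjoint (s k\<^sub>1 k\<^sub>2 b)" "norm (s k\<^sub>1 k\<^sub>2 b) \<le> norm b"
    "\<Lambda> (s k\<^sub>1 k\<^sub>2 b) = (1 / (real k\<^sub>1 * real k\<^sub>2)) *\<^sub>R (\<Sum>m<k\<^sub>1. \<Sum>n<k\<^sub>2. blinfun_apply (R m n) (\<Lambda> b))"
proof -
  show "s k\<^sub>1 k\<^sub>2 b \<in> \<A>\<^sub>0"
    unfolding double_average_def by (intro sym_scaleR sym_sum \<sigma>_sym b)
  show "self_adjoint (s k\<^sub>1 k\<^sub>2 b)"
    unfolding double_average_def
    by (intro self_adjoint_scaleR self_adjoint_sum map_self_adjoint[OF \<sigma>_pos] sym_alg b)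
  show "\<Lambda> (s k\<^sub>1 k\<^sub>2 b) = (1 / (real k\<^sub>1 * real k\<^sub>2)) *\<^sub>R (\<Sum>m<k\<^sub>1. \<Sum>n<k\<^sub>2. blinfun_apply (R m n) (\<Lambda> b))"
    unfolding double_average_def using b
    by (simp add: Lambda_scaleR Lambda_sum sym_sum \<sigma>_sym \<sigma>_Lambda)
  have "norm (\<Sum>m<k\<^sub>1. \<Sum>n<k\<^sub>2. \<sigma> m n b) \<le> (\<Sum>m<k\<^sub>1. \<Sum>n<k\<^sub>2. norm b)"
    by (intro order_trans[OF norm_sum] sum_mono map_norm_le[OF \<sigma>_pos \<sigma>_unital] sym_alg b)
  then show "norm (s k\<^sub>1 k\<^sub>2 b) \<le> norm b"
    by (cases "k\<^sub>1 = 0 \<or> k\<^sub>2 = 0") (auto simp: double_average_def divide_simps mult_ac)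
qed

text \<open>The diagonal averages identify an operator \<open>l\<close> with \<Lambda> l equal to
  the ergodic limit. The whole double sequence is then compared with \<open>l\<close>: its distance
  to \<open>l\<close> in the completion tends to 0 while operator norms stay bounded, which forces
  strong convergence.\<close>

lemma self_adjoint_limit:
  assumes b: "b \<in> \<A>\<^sub>0" "self_adjoint b"
  obtains l where "l \<in> \<A>\<^sub>0"
    "\<And>x. ((\<lambda>(k\<^sub>1, k\<^sub>2). blinfun_apply (s k\<^sub>1 k\<^sub>2 b) x) \<longlongrightarrow> blinfun_apply l x) (sequentially \<times>\<^sub>F sequentially)"
    "blinfun_apply X.T (\<Lambda> l) = \<Lambda> l" "blinfun_apply Y.T (\<Lambda> l) = \<Lambda> l"
    "\<And>g. blinfun_apply X.T g = g \<Longrightarrow> blinfun_apply Y.T g = g \<Longrightarrow> (\<Lambda> b - \<Lambda> l) \<bullet> g = 0"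
proof -
  let ?F = "sequentially \<times>\<^sub>F sequentially :: (nat \<times> nat) filter"
  obtain u where u: "blinfun_apply X.T u = u" "blinfun_apply Y.T u = u"
    "\<And>g. blinfun_apply X.T g = g \<Longrightarrow> blinfun_apply Y.T g = g \<Longrightarrow> (\<Lambda> b - u) \<bullet> g = 0"
    and lim': "((\<lambda>(k\<^sub>1, k\<^sub>2). (1 / (real k\<^sub>1 * real k\<^sub>2)) *\<^sub>R (\<Sum>m<k\<^sub>1. \<Sum>n<k\<^sub>2. blinfun_apply (R m n) (\<Lambda> b))) \<longlongrightarrow> u) ?F"
  proof (rule double_mean_ergodic[of X.T Y.T sa_part R p\<^sub>1 p\<^sub>2 "\<Lambda> b"])
    show "blinfun_apply X.T y \<in> sa_part" if "y \<in> sa_part" for y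
      using that by (rule sa_part_invariant[rotated])
        (auto simp: X.T_Lambda simp del: One_nat_def intro!: imageI \<sigma>_sym map_self_adjoint[OF \<sigma>_pos] sym_alg)
    show "blinfun_apply Y.T y \<in> sa_part" if "y \<in> sa_part" for y
      using that by (rule sa_part_invariant[rotated])
        (auto simp: Y.T_Lambda simp del: One_nat_def intro!: imageI \<sigma>_sym map_self_adjoint[OF \<sigma>_pos] sym_alg)
    show "blinfun_apply (R m n) v = v" if "blinfun_apply X.T v = v" "blinfun_apply Y.T v = v" for m n v
      using that by (simp add: R_def recurrence_op_fixed X.p Y.p)
    show "\<Lambda> b \<in> sa_part"
      unfolding sa_part_def using b closure_subset by fastforce
  qed (use X.p Y.p in \<open>auto intro: X.T_contraction Y.T_contraction sa_part_subspace sa_part_closed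
        R_norm_le R_rec1 R_rec2 simp del: One_nat_def\<close>)
  have lim: "((\<lambda>k. \<Lambda> (s (fst k) (snd k) b)) \<longlongrightarrow> u) ?F"
    using lim' by (simp add: s_properties(4)[OF b] case_prod_unfold)
  define y where "y k = s k k b" for k
  have y: "y k \<in> \<A>\<^sub>0" "self_adjoint (y k)" "norm (y k) \<le> norm b" for k
    unfolding y_def by (rule s_properties[OF b])+
  have diag: "(\<lambda>k. \<Lambda> (y k)) \<longlonglongrightarrow> u"
  proof -
    have "filterlim (\<lambda>k::nat. (k, k)) ?F sequentially"
      by (intro filterlim_Pair filterlim_ident)
    from filterlim_compose[OF lim this] show ?thesis by (simp add: y_def)
  qed
  have sq: "\<phi> ((c - d) o\<^sub>L (c - d)) = ennreal ((norm (\<Lambda> c - \<Lambda> d))\<^sup>2)"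
    if "c \<in> \<A>\<^sub>0" "self_adjoint c" "d \<in> \<A>\<^sub>0" "self_adjoint d" for c d
    using that by (simp add: norm_Lambda_self_adjoint sym_diff self_adjoint_diff Lambda_diff)
  have "\<exists>N. \<forall>m\<ge>N. \<forall>n\<ge>N. \<phi> ((y m - y n) o\<^sub>L (y m - y n)) \<le> ennreal \<delta>" if "0 < \<delta>" for \<delta> :: real
  proof -
    have "Cauchy (\<lambda>k. \<Lambda> (y k))" using diag by (rule LIMSEQ_imp_Cauchy)
    then obtain N where N: "\<And>m n. m \<ge> N \<Longrightarrow> n \<ge> N \<Longrightarrow> norm (\<Lambda> (y m) - \<Lambda> (y n)) < sqrt \<delta>"
      using real_sqrt_gt_zero[OF \<open>0 < \<delta>\<close>] unfolding Cauchy_iff by blast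
    have "(norm (\<Lambda> (y m) - \<Lambda> (y n)))\<^sup>2 \<le> \<delta>" if "m \<ge> N" "n \<ge> N" for m n
      using power_mono[OF less_imp_le[OF N[OF that]] norm_ge_zero, of 2] \<open>0 < \<delta>\<close> by simp
    then show ?thesis using y by (auto simp: sq intro!: ennreal_leI)
  qed
  with sym_alg[OF y(1)] y(2,3) obtain l where l: "l \<in> \<A>" "self_adjoint l" "norm l \<le> norm b"
    "\<And>\<delta>::real. 0 < \<delta> \<Longrightarrow> \<exists>N. \<forall>k\<ge>N. \<phi> ((l - y k) o\<^sub>L (l - y k)) \<le> ennreal \<delta>"
    by (rule weight_Cauchy_limit) (assumption, (rule that; assumption))
  \<comment> \<open>\<open>l\<close> is the sum of an average and of a self-adjoint difference whose
    square has finite weight.\<close>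
  have l_sym: "l \<in> \<A>\<^sub>0"
  proof -
    obtain N where N: "\<phi> ((l - y N) o\<^sub>L (l - y N)) \<le> ennreal 1"
      using l(4)[of 1] by auto
    then have "\<phi> ((l - y N) o\<^sub>L (l - y N)) < \<infinity>"
      by (rule order_le_less_trans) simp
    then have "l - y N \<in> \<A>\<^sub>0"
      by (rule sym_self_adjointI[OF alg_diff[OF l(1) sym_alg[OF y(1)]] self_adjoint_diff[OF l(2) y(2)]])
    from sym_add[OF this y(1)[of N]] show ?thesis by simp
  qed
  have "(\<lambda>k. \<Lambda> (y k)) \<longlonglongrightarrow> \<Lambda> l"
  proof (rule LIMSEQ_I)
    fix e :: real assume e: "0 < e"
    then obtain N where N: "\<And>k. k \<ge> N \<Longrightarrow> \<phi> ((l - y k) o\<^sub>L (l - y k)) \<le> ennreal ((e / 2)\<^sup>2)"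
      using l(4)[of "(e / 2)\<^sup>2"] by auto
    have "norm (\<Lambda> (y k) - \<Lambda> l) < e" if "k \<ge> N" for k
    proof -
      have "(norm (\<Lambda> l - \<Lambda> (y k)))\<^sup>2 \<le> (e / 2)\<^sup>2"
        using N[OF that] by (simp add: sq l_sym l y)
      then have "norm (\<Lambda> l - \<Lambda> (y k)) \<le> e / 2"
        by (rule power2_le_imp_le) (use e in simp)
      then show ?thesis using e by (simp add: norm_minus_commute)
    qed
    then show "\<exists>N. \<forall>k\<ge>N. norm (\<Lambda> (y k) - \<Lambda> l) < e" by blast
  qed
  then have lu: "\<Lambda> l = u" using diag LIMSEQ_unique by blast
  have strong: "((\<lambda>(k\<^sub>1, k\<^sub>2). blinfun_apply (s k\<^sub>1 k\<^sub>2 b) x) \<longlongrightarrow> blinfun_apply l x) ?F" for x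
  proof (rule tendstoI)
    fix e :: real assume e: "0 < e"
    \<comment> \<open>The averages and \<open>l\<close> have norm at most \<open>norm b\<close>,
      which explains the radius 2 * norm b.\<close>
    obtain \<delta> :: real where \<delta>: "0 < \<delta>"
      "\<And>y. y \<in> \<A> \<Longrightarrow> norm y \<le> 2 * norm b \<Longrightarrow> \<phi> (op_adj y o\<^sub>L y) \<le> ennreal \<delta> \<Longrightarrow> norm (blinfun_apply y x) < e"
      using weight_small_imp_strongly_small[OF e, of "2 * norm b" x] by auto
    have "\<forall>\<^sub>F k in ?F. dist (\<Lambda> (s (fst k) (snd k) b)) (\<Lambda> l) < sqrt \<delta>"
      using tendstoD[OF lim, of "sqrt \<delta>"] \<delta>(1) by (simp add: lu)
    then show "\<forall>\<^sub>F k in ?F. dist (case k of (k\<^sub>1, k\<^sub>2) \<Rightarrow> blinfun_apply (s k\<^sub>1 k\<^sub>2 b) x) (blinfun_apply l x) < e"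
    proof (rule eventually_mono)
      fix k :: "nat \<times> nat"
      let ?s = "s (fst k) (snd k) b"
      assume k: "dist (\<Lambda> ?s) (\<Lambda> l) < sqrt \<delta>"
      note sp = s_properties[OF b, of "fst k" "snd k"]
      have sa: "self_adjoint (?s - l)" by (intro self_adjoint_diff sp l)
      have "norm (blinfun_apply (?s - l) x) < e"
      proof (rule \<delta>(2))
        show A: "?s - l \<in> \<A>" by (intro alg_diff sym_alg sp l_sym)
        show "norm (?s - l) \<le> 2 * norm b"
          using norm_triangle_ineq4[of ?s l] sp(3) l(3) by linarith
        have "(norm (\<Lambda> ?s - \<Lambda> l))\<^sup>2 \<le> \<delta>"
          using power_mono[OF less_imp_le[OF k[unfolded dist_norm]] norm_ge_zero, of 2] \<delta>(1) by simp
        then show "\<phi> (op_adj (?s - l) o\<^sub>L (?s - l)) \<le> ennreal \<delta>"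
          using op_adj_self_adjoint[OF alg_cbounded[OF A]] sa
          by (simp add: sq sp(1,2) l_sym l(2) ennreal_leI)
      qed
      then show "dist (case k of (k\<^sub>1, k\<^sub>2) \<Rightarrow> blinfun_apply (s k\<^sub>1 k\<^sub>2 b) x) (blinfun_apply l x) < e"
        by (simp add: case_prod_unfold dist_norm blinfun.diff_left)
    qed
  qed
  show thesis by (rule that[OF l_sym strong]) (use u lu in auto)
qed

text \<open>\<open>P\<close> is self-adjoint for the real inner product too, so real orthogonality
  to the fixed vectors already gives P (x - u) = 0.\<close>

lemma projection_limit:
  assumes P: "is_orthogonal_projection P {\<eta>. blinfun_apply Y.T \<eta> = \<eta> \<and> blinfun_apply X.T \<eta> = \<eta>}"
    and u: "blinfun_apply X.T u = u" "blinfun_apply Y.T u = u"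
    and orth: "\<And>g. blinfun_apply X.T g = g \<Longrightarrow> blinfun_apply Y.T g = g \<Longrightarrow> (x - u) \<bullet> g = 0"
  shows "blinfun_apply P x = u"
proof -
  have Pc: "P \<in> cbounded_ops" and PP: "P o\<^sub>L P = P" and Pa: "op_adj P = P"
    and range: "range (blinfun_apply P) = {\<eta>. blinfun_apply Y.T \<eta> = \<eta> \<and> blinfun_apply X.T \<eta> = \<eta>}"
    using P unfolding is_orthogonal_projection_def by auto
  have "u \<in> range (blinfun_apply P)" using range u by simp
  then obtain v where "u = blinfun_apply P v" by blast
  then have Pu: "blinfun_apply P u = u"
    using PP by (metis blinfun_apply_blinfun_compose)
  have "blinfun_apply P (x - u) \<bullet> h = 0" for h
  proof -
    have "blinfun_apply P h \<in> range (blinfun_apply P)" by simp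
    then have "(x - u) \<bullet> blinfun_apply P h = 0" unfolding range by (intro orth) auto
    then show ?thesis using op_adj_inner[OF Pc, of "x - u" h] by (simp add: Pa)
  qed
  then have "blinfun_apply P (x - u) = 0" by (metis inner_eq_zero_iff)
  then show ?thesis by (simp add: blinfun.diff_right Pu)
qed

text \<open>Averages, \<Lambda> and \<open>P\<close> are complex-linear, so the limits of the
  self-adjoint parts \<open>h\<close> and \<open>k\<close> recombine to the limit for
  \<open>A\<close>.\<close>

lemma double_ergodic:
  assumes A: "A \<in> \<A>\<^sub>0"
  shows "\<exists>A'\<in>\<A>\<^sub>0.
     pringsheim_limit strong_operator_topology (\<lambda>m n. s m n A) A' \<and>
     (\<forall>P. is_orthogonal_projection P {\<eta>. blinfun_apply Y.T \<eta> = \<eta> \<and> blinfun_apply X.T \<eta> = \<eta>}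
        \<longrightarrow> \<Lambda> A' = blinfun_apply P (\<Lambda> A))"
proof -
  let ?F = "sequentially \<times>\<^sub>F sequentially :: (nat \<times> nat) filter"
  obtain h k where hk: "h \<in> \<A>" "k \<in> \<A>" "self_adjoint h" "self_adjoint k"
    "A = h + op_scaleC \<i> k" and hk_def: "h = (1/2) *\<^sub>R (A + op_adj A)"
    "k = op_scaleC (- \<i> / 2) A + op_scaleC (\<i> / 2) (op_adj A)"
    by (rule self_adjoint_decomposition[OF sym_alg[OF A]])
  have h: "h \<in> \<A>\<^sub>0" unfolding hk_def by (intro sym_scaleR sym_add sym_adj A)
  have k: "k \<in> \<A>\<^sub>0" unfolding hk_def by (intro sym_scaleC sym_add sym_adj A)
  obtain lh where lh: "lh \<in> \<A>\<^sub>0"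
    "\<And>x. ((\<lambda>(k\<^sub>1, k\<^sub>2). blinfun_apply (s k\<^sub>1 k\<^sub>2 h) x) \<longlongrightarrow> blinfun_apply lh x) ?F"
    "blinfun_apply X.T (\<Lambda> lh) = \<Lambda> lh" "blinfun_apply Y.T (\<Lambda> lh) = \<Lambda> lh"
    "\<And>g. blinfun_apply X.T g = g \<Longrightarrow> blinfun_apply Y.T g = g \<Longrightarrow> (\<Lambda> h - \<Lambda> lh) \<bullet> g = 0"
    by (rule self_adjoint_limit[OF h hk(3)]) (rule that; assumption)
  obtain lk where lk: "lk \<in> \<A>\<^sub>0"
    "\<And>x. ((\<lambda>(k\<^sub>1, k\<^sub>2). blinfun_apply (s k\<^sub>1 k\<^sub>2 k) x) \<longlongrightarrow> blinfun_apply lk x) ?F"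
    "blinfun_apply X.T (\<Lambda> lk) = \<Lambda> lk" "blinfun_apply Y.T (\<Lambda> lk) = \<Lambda> lk"
    "\<And>g. blinfun_apply X.T g = g \<Longrightarrow> blinfun_apply Y.T g = g \<Longrightarrow> (\<Lambda> k - \<Lambda> lk) \<bullet> g = 0"
    by (rule self_adjoint_limit[OF k hk(4)]) (rule that; assumption)
  let ?l = "lh + op_scaleC \<i> lk"
  have l: "?l \<in> \<A>\<^sub>0" by (intro sym_add sym_scaleC lh lk)
  have s_eq: "s k\<^sub>1 k\<^sub>2 A = s k\<^sub>1 k\<^sub>2 h + op_scaleC \<i> (s k\<^sub>1 k\<^sub>2 k)" for k\<^sub>1 k\<^sub>2
    by (rule double_average_op_scaleC_add)
      (simp add: hk(5) map_add[OF \<sigma>_pos] map_scaleC[OF \<sigma>_pos] hk(1,2) alg_scaleC)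
  have "((\<lambda>k. blinfun_apply (s (fst k) (snd k) A) x) \<longlongrightarrow> blinfun_apply ?l x) ?F" for x
    unfolding s_eq blinfun.add_left op_scaleC.rep_eq
    by (intro tendsto_add bounded_linear.tendsto[OF bounded_linear_scaleC])
      (use lh(2)[of x] lk(2)[of x] in \<open>simp_all add: case_prod_unfold\<close>)
  then have lim: "limitin strong_operator_topology (\<lambda>k. s (fst k) (snd k) A) ?l ?F"
    by (rule limitin_strong_operator_topology)
  have "pringsheim_limit strong_operator_topology (\<lambda>m n. s m n A) ?l"
    unfolding pringsheim_limit_def
  proof (intro conjI allI impI)
    show "?l \<in> topspace strong_operator_topology" by (simp add: strong_operator_topology_topspace)
    fix U assume "openin strong_operator_topology U" "?l \<in> U"
    with lim have "\<forall>\<^sub>F k in ?F. s (fst k) (snd k) A \<in> U" by (rule limitinD)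
    then obtain N where "\<And>m n. m \<ge> N \<Longrightarrow> n \<ge> N \<Longrightarrow> s n m A \<in> U"
      unfolding eventually_prod_sequentially by auto
    then show "\<exists>n\<ge>1. \<forall>k\<^sub>1 k\<^sub>2. n \<le> min k\<^sub>1 k\<^sub>2 \<longrightarrow> s k\<^sub>1 k\<^sub>2 A \<in> U"
      by (intro exI[of _ "max 1 N"]) auto
  qed
  moreover have "\<Lambda> ?l = blinfun_apply P (\<Lambda> A)"
    if P: "is_orthogonal_projection P {\<eta>. blinfun_apply Y.T \<eta> = \<eta> \<and> blinfun_apply X.T \<eta> = \<eta>}" for P
  proof -
    have Pc: "P \<in> cbounded_ops" using P by (simp add: is_orthogonal_projection_def)
    have "blinfun_apply P (\<Lambda> A) = blinfun_apply P (\<Lambda> h) + \<i> *\<^sub>C blinfun_apply P (\<Lambda> k)"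
      by (simp add: hk(5) Lambda_add Lambda_scaleC h k sym_scaleC blinfun.add_right cbounded_opsD[OF Pc])
    also have "\<dots> = \<Lambda> lh + \<i> *\<^sub>C \<Lambda> lk"
      using projection_limit[OF P lh(3-5)] projection_limit[OF P lk(3-5)] by simp
    finally show ?thesis by (simp add: Lambda_add Lambda_scaleC lh lk sym_scaleC)
  qed
  ultimately show ?thesis using l by blast
qed

end

theorem theorem3p4:
  fixes \<A> :: "('h::chilbert \<Rightarrow>\<^sub>L 'h) set"
    and \<phi> :: "('h \<Rightarrow>\<^sub>L 'h) \<Rightarrow> ennreal"
    and \<sigma> :: "nat \<Rightarrow> nat \<Rightarrow> ('h \<Rightarrow>\<^sub>L 'h) \<Rightarrow> ('h \<Rightarrow>\<^sub>L 'h)"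
    and \<Lambda> :: "('h \<Rightarrow>\<^sub>L 'h) \<Rightarrow> 'k::chilbert"
    and p\<^sub>1 p\<^sub>2 :: real
    and A :: "'h \<Rightarrow>\<^sub>L 'h"
  assumes "von_neumann_algebra \<A>"
    and "weight_on \<A> \<phi>" and "faithful_weight \<A> \<phi>"
    and "normal_weight \<A> \<phi>" and "semifinite_weight \<A> \<phi>"
    and "weight_completion \<A> \<phi> \<Lambda>"
    and "0 < p\<^sub>1" "p\<^sub>1 \<le> 1" and "0 < p\<^sub>2" "p\<^sub>2 \<le> 1"
    and "\<And>m n. positive_linear_map \<A> (\<sigma> m n)"
    and "\<forall>a\<in>\<A>. \<sigma> 0 0 a = a"
    and "\<forall>a\<in>\<A>. \<sigma> 1 0 (\<sigma> 0 1 a) = \<sigma> 0 1 (\<sigma> 1 0 a)"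
    and "normal_map \<A> (\<sigma> 1 0)" and "normal_map \<A> (\<sigma> 0 1)"
    and "completely_positive \<A> (\<sigma> 1 0)" and "completely_positive \<A> (\<sigma> 0 1)"
    and "\<sigma> 1 0 id_blinfun = id_blinfun" and "\<sigma> 0 1 id_blinfun = id_blinfun"
    and "invariant_map \<A> \<phi> (\<sigma> 1 0)" and "invariant_map \<A> \<phi> (\<sigma> 0 1)"
    and "\<And>m n a. m \<ge> 1 \<Longrightarrow> a \<in> \<A> \<Longrightarrow>
           \<sigma> 1 0 (\<sigma> m n a) = p\<^sub>1 *\<^sub>R \<sigma> (m + 1) n a + (1 - p\<^sub>1) *\<^sub>R \<sigma> (m - 1) n a"
    and "\<And>m n a. n \<ge> 1 \<Longrightarrow> a \<in> \<A> \<Longrightarrow>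
           \<sigma> 0 1 (\<sigma> m n a) = p\<^sub>2 *\<^sub>R \<sigma> m (n + 1) a + (1 - p\<^sub>2) *\<^sub>R \<sigma> m (n - 1) a"
    and "\<And>m n a. a \<in> \<A> \<Longrightarrow> \<sigma> m n a = \<sigma> 0 n (\<sigma> m 0 a)"
    and "op_spectrum (induced_op \<A> \<phi> \<Lambda> (\<sigma> 1 0)) \<subseteq> D_region p\<^sub>1"
    and "op_spectrum (induced_op \<A> \<phi> \<Lambda> (\<sigma> 0 1)) \<subseteq> D_region p\<^sub>2"
    and "A \<in> sq_integrable_sym \<A> \<phi>"
  shows "\<exists>A'\<in>sq_integrable_sym \<A> \<phi>.
           pringsheim_limit strong_operator_topology (\<lambda>m n. double_average \<sigma> m n A) A' \<and>
           (\<forall>P. is_orthogonal_projection P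
                  {\<eta>. blinfun_apply (induced_op \<A> \<phi> \<Lambda> (\<sigma> 0 1)) \<eta> = \<eta> \<and>
                      blinfun_apply (induced_op \<A> \<phi> \<Lambda> (\<sigma> 1 0)) \<eta> = \<eta>}
                \<longrightarrow> \<Lambda> A' = blinfun_apply P (\<Lambda> A))"
proof -
  \<comment> \<open>The recurrences required in each direction are the cases n = 0 and m = 0 of the
    two-index ones.\<close>
  interpret double_family \<A> \<phi> \<Lambda> p\<^sub>1 p\<^sub>2 \<sigma>
  proof unfold_locales
    show "\<sigma> 0 0 a = a" if "a \<in> \<A>" for a
      using assms(12) that by blast
    show "\<sigma> 1 0 (\<sigma> 0 1 a) = \<sigma> 0 1 (\<sigma> 1 0 a)" if "a \<in> \<A>" for a
      using assms(13) that by blast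
  qed (rule assms; assumption)+
  show ?thesis by (rule double_ergodic) (rule assms)
qed

end
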